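(* Let $\mathfrak g$ be a finite-dimensional complex reductive Lie algebra with fixed data $\mathfrak j_0,\mathfrak b_0,\mathfrak b_0',\mathfrak p=\mathfrak l\oplus\mathfrak n,\mathfrak p'=\mathfrak l'\oplus\mathfrak n'$ as in the context. Let $B$ be a real (resp. complex) Manin form on $\mathfrak g$ and let $\mathfrak i,\mathfrak i'$ be real (resp. complex) Lie subalgebras of $\mathfrak g$, Lagrangian for $B$, with $\mathfrak i$ under $\mathfrak p$ and $\mathfrak i'$ under $\mathfrak p'$. Put $\mathfrak m=[\mathfrak l,\mathfrak l]$, $\mathfrak m'=[\mathfrak l',\mathfrak l']$, $\mathfrak h=\mathfrak i\cap\mathfrak m$, $\mathfrak h'=\mathfrak i'\cap\mathfrak m'$, $\tilde{\mathfrak h}=\mathfrak i\cap\mathfrak l$, $\tilde{\mathfrak h}'=\mathfrak i'\cap\mathfrak l'$. The following conditions are equivalent: (i) $(B,\mathfrak i,\mathfrak i')$ is a Manin triple. (ii) With $\mathfrak i_1:=p^{\mathfrak n'}(\tilde{\mathfrak h}\cap\mathfrak p')$ and $\mathfrak i'_1:=p^{\mathfrak n}(\tilde{\mathfrak h}'\cap\mathfrak p)$, one has: a) $\mathfrak i_1$ and $\mathfrak i_1'$ are contained in $\mathfrak l\cap\mathfrak l'$, and $(B_1,\mathfrak i_1,\mathfrak i_1')$ is a (real, resp. complex) Manin triple in $\mathfrak l\cap\mathfrak l'$, where $B_1$ denotes the restriction of $B$ to $\mathfrak l\cap\mathfrak l'$; b) $\mathfrak n\cap\mathfrak h'=\{0\}$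 and $\mathfrak n'\cap\mathfrak h=\{0\}$.
   Context: A real Manin form on a complex reductive Lie algebra $\mathfrak g$ is a symmetric $\mathfrak g$-invariant $\mathbb R$-bilinear form $\mathfrak g\times\mathfrak g\to\mathbb R$ of signature $(\dim_{\mathbb C}\mathfrak g,\dim_{\mathbb C}\mathfrak g)$; a complex Manin form is a symmetric $\mathfrak g$-invariant non-degenerate $\mathbb C$-bilinear form. A real (resp. complex) Lie subalgebra $\mathfrak i$ is Lagrangian for $B$ if it is isotropic and $\dim_{\mathbb R}\mathfrak i=\dim_{\mathbb C}\mathfrak g$. A real (resp. complex) Manin triple of $\mathfrak g$ is $(B,\mathfrak i,\mathfrak i')$ with $B$ a real (resp. complex) Manin form and $\mathfrak i,\mathfrak i'$ real (resp. complex) Lie subalgebras isotropic for $B$ with $\mathfrak g=\mathfrak i\oplus\mathfrak i'$. The nilpotent radical of a Lie algebra is its largest ideal whose elements act nilpotently in every finite-dimensional representation. A Langlands decomposition of a parabolic subalgebra $\mathfrak p$ is $\mathfrak p=\mathfrak l\oplus\mathfrak n$ with $\mathfrak n$ its nilpotent radical and $\mathfrak l$ a complex subalgebra reductive in $\mathfrak g$. For a Lagrangian subalgebra $\mathfrak i$, the normalizer $\mathfrak p$ in $\mathfrak g$ of the nilpotent radical of $\mathfrak i$ is a parabolic subalgebra with the same nilpotent radical as $\mathfrak i$, and one says that $\mathfrak i$ is under $\mathfrak p$. Fixed data: $\mathfrak j_0$ is a Cartan subalgebra of $\mathfrak g$, $\mathfrak b_0\supset\mathfrak j_0$ a Borel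 subalgebra, $\mathfrak b'_0$ the Borel subalgebra opposite to $\mathfrak b_0$ relative to $\mathfrak j_0$; $\mathfrak p\supset\mathfrak b_0$, $\mathfrak p'\supset\mathfrak b_0'$ are parabolic subalgebras, with Langlands decompositions $\mathfrak p=\mathfrak l\oplus\mathfrak n$, $\mathfrak p'=\mathfrak l'\oplus\mathfrak n'$ such that $\mathfrak l,\mathfrak l'\supset\mathfrak j_0$. If $V\subset\mathfrak g$ is a sum of full weight spaces of $\mathfrak j_0$ in $\mathfrak g$, then $p^{V}$ denotes the projection of $\mathfrak g$ with kernel $V$ onto the unique $\mathfrak j_0$-invariant complement of $V$ (the sum of the weight spaces of $\mathfrak j_0$ meeting $V$ trivially). When the equivalent conditions hold, $(B_1,\mathfrak i_1,\mathfrak i'_1)$ is called the predecessor of the Manin triple $(B,\mathfrak i,\mathfrak i')$. *)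

theory Defs
  imports Complex_Main "Jordan_Normal_Form.Matrix"
begin

definition is_direct_sum :: "'a::ab_group_add set \<Rightarrow> 'a set \<Rightarrow> 'a set \<Rightarrow> bool" where
  "is_direct_sum V A C \<longleftrightarrow> V = {a + c | a c. a \<in> A \<and> c \<in> C} \<and> A \<inter> C = {0}"

text \<open>
  The ambient Lie algebra is a whole type; its subalgebras and ideals are sets. The base field is
  a parameter, so that a complex Lie algebra can also be used as a real one: the real and complex
  notions of subalgebra, representation, nilpotent radical, ... are instances of the same
  definition.
\<close>

locale lie_algebra = vector_space scale
  for scale :: "'k::field \<Rightarrow> 'a::ab_group_add \<Rightarrow> 'a" (infixr "*s" 75) +
  fixes bracket :: "'a \<Rightarrow> 'a \<Rightarrow> 'a"
  assumes bracket_add_left: "bracket (x + y) z = bracket x z + bracket y z"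
    and bracket_add_right: "bracket x (y + z) = bracket x y + bracket x z"
    and bracket_scale_left: "bracket (c *s x) y = c *s bracket x y"
    and bracket_scale_right: "bracket x (c *s y) = c *s bracket x y"
    and bracket_self: "bracket x x = 0"
    and jacobi: "bracket x (bracket y z) + bracket y (bracket z x) + bracket z (bracket x y) = 0"
begin

definition lie_subalgebra :: "'a set \<Rightarrow> bool" where
  "lie_subalgebra L \<longleftrightarrow> subspace L \<and> (\<forall>x\<in>L. \<forall>y\<in>L. bracket x y \<in> L)"

definition lie_ideal :: "'a set \<Rightarrow> 'a set \<Rightarrow> bool" where
  "lie_ideal I L \<longleftrightarrow> subspace I \<and> I \<subseteq> L \<and> (\<forall>x\<in>L. \<forall>y\<in>I. bracket x y \<in> I)"

definition lie_normalizer :: "'a set \<Rightarrow> 'a set" where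
  "lie_normalizer A = {x. \<forall>y\<in>A. bracket x y \<in> A}"

definition commutator :: "'a set \<Rightarrow> 'a set \<Rightarrow> 'a set" where
  "commutator A C = span {bracket x y | x y. x \<in> A \<and> y \<in> C}"

definition lie_nilpotent :: "'a set \<Rightarrow> bool" where
  "lie_nilpotent L \<longleftrightarrow> (\<exists>k. (commutator L ^^ k) L = {0})"

definition lie_solvable :: "'a set \<Rightarrow> bool" where
  "lie_solvable L \<longleftrightarrow> (\<exists>k. ((\<lambda>A. commutator A A) ^^ k) L = {0})"

text \<open>
  \<open>L\<close> is reductive in the ambient algebra: the adjoint action of \<open>L\<close> on the ambient algebra is
  semisimple. The ambient algebra is reductive if this holds for \<open>L = UNIV\<close>.
\<close>

definition reductive_in_ambient :: "'a set \<Rightarrow> bool" where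
  "reductive_in_ambient L \<longleftrightarrow>
     (\<forall>W. subspace W \<and> (\<forall>x\<in>L. \<forall>y\<in>W. bracket x y \<in> W) \<longrightarrow>
       (\<exists>W'. subspace W' \<and> (\<forall>x\<in>L. \<forall>y\<in>W'. bracket x y \<in> W') \<and> is_direct_sum UNIV W W'))"

definition cartan_subalgebra :: "'a set \<Rightarrow> bool" where
  "cartan_subalgebra j \<longleftrightarrow> lie_subalgebra j \<and> lie_nilpotent j \<and> lie_normalizer j = j"

definition borel_subalgebra :: "'a set \<Rightarrow> bool" where
  "borel_subalgebra b \<longleftrightarrow> lie_subalgebra b \<and> lie_solvable b \<and>
     (\<forall>c. lie_subalgebra c \<and> lie_solvable c \<and> b \<subseteq> c \<longrightarrow> c = b)"

text \<open>The opposite of a Borel subalgebra \<open>b\<close> containing a Cartan subalgebra \<open>j\<close>.\<close>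

definition opposite_borel :: "'a set \<Rightarrow> 'a set \<Rightarrow> 'a set \<Rightarrow> bool" where
  "opposite_borel j b b' \<longleftrightarrow> borel_subalgebra b' \<and> b \<inter> b' = j"

definition parabolic_subalgebra :: "'a set \<Rightarrow> bool" where
  "parabolic_subalgebra p \<longleftrightarrow> lie_subalgebra p \<and> (\<exists>b. borel_subalgebra b \<and> b \<subseteq> p)"

text \<open>
  Representations are taken on the coordinate spaces of all finite dimensions over the base field.
  Only the values of \<open>\<rho>\<close> on \<open>L\<close> matter.
\<close>

definition lie_representation :: "'a set \<Rightarrow> nat \<Rightarrow> ('a \<Rightarrow> 'k mat) \<Rightarrow> bool" where
  "lie_representation L d \<rho> \<longleftrightarrow>
     (\<forall>x\<in>L. \<rho> x \<in> carrier_mat d d) \<and>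
     (\<forall>x\<in>L. \<forall>y\<in>L. \<rho> (x + y) = \<rho> x + \<rho> y) \<and>
     (\<forall>c. \<forall>x\<in>L. \<rho> (c *s x) = c \<cdot>\<^sub>m \<rho> x) \<and>
     (\<forall>x\<in>L. \<forall>y\<in>L. \<rho> (bracket x y) = \<rho> x * \<rho> y - \<rho> y * \<rho> x)"

definition acts_nilpotently :: "'a set \<Rightarrow> 'a set \<Rightarrow> bool" where
  "acts_nilpotently N L \<longleftrightarrow>
     (\<forall>d \<rho>. lie_representation L d \<rho> \<longrightarrow> (\<forall>x\<in>N. \<exists>k. \<rho> x ^\<^sub>m k = 0\<^sub>m d d))"

definition is_nilpotent_radical :: "'a set \<Rightarrow> 'a set \<Rightarrow> bool" where
  "is_nilpotent_radical N L \<longleftrightarrow> lie_ideal N L \<and> acts_nilpotently N L \<and>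
     (\<forall>I. lie_ideal I L \<and> acts_nilpotently I L \<longrightarrow> I \<subseteq> N)"

definition langlands_decomposition :: "'a set \<Rightarrow> 'a set \<Rightarrow> 'a set \<Rightarrow> bool" where
  "langlands_decomposition p l n \<longleftrightarrow> is_nilpotent_radical n p \<and>
     lie_subalgebra l \<and> reductive_in_ambient l \<and> is_direct_sum p l n"

text \<open>Used for Lagrangian \<open>i\<close> only; \<open>p\<close> is then parabolic, with the same nilpotent radical.\<close>

definition under :: "'a set \<Rightarrow> 'a set \<Rightarrow> bool" where
  "under i p \<longleftrightarrow> (\<exists>N. is_nilpotent_radical N i \<and> p = lie_normalizer N)"

text \<open>
  A Cartan subalgebra of a reductive algebra acts diagonalizably, so weight spaces are honest
  eigenspaces. The zero weight is included.
\<close>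

definition weight_space :: "'a set \<Rightarrow> ('a \<Rightarrow> 'k) \<Rightarrow> 'a set" where
  "weight_space j w = {x. \<forall>h\<in>j. bracket h x = w h *s x}"

definition weight_spaces :: "'a set \<Rightarrow> 'a set set" where
  "weight_spaces j = {W. W \<noteq> {0} \<and> (\<exists>w. W = weight_space j w)}"

definition weight_complement :: "'a set \<Rightarrow> 'a set \<Rightarrow> 'a set" where
  "weight_complement j V = span (\<Union>{W \<in> weight_spaces j. W \<inter> V = {0}})"

text \<open>
  The projection with kernel \<open>V\<close> onto \<open>weight_complement j V\<close>, meaningful when \<open>V\<close> is a sum of
  full weight spaces of \<open>j\<close>.
\<close>

definition weight_proj :: "'a set \<Rightarrow> 'a set \<Rightarrow> 'a \<Rightarrow> 'a" where
  "weight_proj j V x = (THE y. y \<in> weight_complement j V \<and> x - y \<in> V)"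

definition bilinear_form_on :: "'a set \<Rightarrow> ('a \<Rightarrow> 'a \<Rightarrow> 'k) \<Rightarrow> bool" where
  "bilinear_form_on L B \<longleftrightarrow>
     (\<forall>x\<in>L. \<forall>y\<in>L. \<forall>z\<in>L. B (x + y) z = B x z + B y z \<and> B z (x + y) = B z x + B z y) \<and>
     (\<forall>c. \<forall>x\<in>L. \<forall>y\<in>L. B (c *s x) y = c * B x y \<and> B x (c *s y) = c * B x y)"

definition symmetric_invariant_form_on :: "'a set \<Rightarrow> ('a \<Rightarrow> 'a \<Rightarrow> 'k) \<Rightarrow> bool" where
  "symmetric_invariant_form_on L B \<longleftrightarrow> bilinear_form_on L B \<and>
     (\<forall>x\<in>L. \<forall>y\<in>L. B x y = B y x) \<and>
     (\<forall>x\<in>L. \<forall>y\<in>L. \<forall>z\<in>L. B (bracket x y) z = - B y (bracket x z))"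

definition nondegenerate_on :: "'a set \<Rightarrow> ('a \<Rightarrow> 'a \<Rightarrow> 'k) \<Rightarrow> bool" where
  "nondegenerate_on L B \<longleftrightarrow> (\<forall>x\<in>L. (\<forall>y\<in>L. B x y = 0) \<longrightarrow> x = 0)"

definition isotropic :: "('a \<Rightarrow> 'a \<Rightarrow> 'k) \<Rightarrow> 'a set \<Rightarrow> bool" where
  "isotropic B i \<longleftrightarrow> (\<forall>x\<in>i. \<forall>y\<in>i. B x y = 0)"

end

class complex_lie_algebra = real_vector +
  fixes scaleC :: "complex \<Rightarrow> 'a \<Rightarrow> 'a" (infixr "*\<^sub>C" 75)
    and lie_bracket :: "'a \<Rightarrow> 'a \<Rightarrow> 'a"
  assumes scaleR_scaleC: "r *\<^sub>R x = complex_of_real r *\<^sub>C x"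
    and scaleC_add_right: "c *\<^sub>C (x + y) = c *\<^sub>C x + c *\<^sub>C y"
    and scaleC_add_left: "(c + d) *\<^sub>C x = c *\<^sub>C x + d *\<^sub>C x"
    and scaleC_scaleC: "c *\<^sub>C d *\<^sub>C x = (c * d) *\<^sub>C x"
    and scaleC_one: "1 *\<^sub>C x = x"
    and lie_bracket_add_left: "lie_bracket (x + y) z = lie_bracket x z + lie_bracket y z"
    and lie_bracket_add_right: "lie_bracket x (y + z) = lie_bracket x y + lie_bracket x z"
    and lie_bracket_scaleC_left: "lie_bracket (c *\<^sub>C x) y = c *\<^sub>C lie_bracket x y"
    and lie_bracket_scaleC_right: "lie_bracket x (c *\<^sub>C y) = c *\<^sub>C lie_bracket x y"
    and lie_bracket_self: "lie_bracket x x = 0"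
    and lie_bracket_jacobi: "lie_bracket x (lie_bracket y z) + lie_bracket y (lie_bracket z x)
      + lie_bracket z (lie_bracket x y) = 0"

text \<open>The prefix \<open>cx\<close> marks the notions over the complex field, \<open>re\<close> those over the real field.\<close>

global_interpretation cx: lie_algebra
    "scaleC :: complex \<Rightarrow> 'a::complex_lie_algebra \<Rightarrow> 'a" lie_bracket
  by unfold_locales
    (simp_all add: scaleC_add_right scaleC_add_left scaleC_scaleC scaleC_one
      lie_bracket_add_left lie_bracket_add_right lie_bracket_scaleC_left
      lie_bracket_scaleC_right lie_bracket_self lie_bracket_jacobi)

global_interpretation re: lie_algebra
    "scaleR :: real \<Rightarrow> 'a::complex_lie_algebra \<Rightarrow> 'a" lie_bracket
  by unfold_locales
    (simp_all add: scaleR_scaleC lie_bracket_add_left lie_bracket_add_right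
      lie_bracket_scaleC_left lie_bracket_scaleC_right lie_bracket_self lie_bracket_jacobi)

definition complex_finite_dimensional :: "'a::complex_lie_algebra itself \<Rightarrow> bool" where
  "complex_finite_dimensional _ \<longleftrightarrow> (\<exists>S :: 'a set. finite S \<and> cx.span S = UNIV)"

text \<open>Signature of a symmetric real bilinear form, read off from an orthogonal basis of \<open>L\<close>.\<close>

definition has_signature ::
    "'a::real_vector set \<Rightarrow> ('a \<Rightarrow> 'a \<Rightarrow> real) \<Rightarrow> nat \<Rightarrow> nat \<Rightarrow> bool" where
  "has_signature L B p q \<longleftrightarrow>
     (\<exists>E. finite E \<and> independent E \<and> span E = L \<and>
       (\<forall>x\<in>E. \<forall>y\<in>E. x \<noteq> y \<longrightarrow> B x y = 0) \<and>
       card {x \<in> E. B x x > 0} = p \<and> card {x \<in> E. B x x < 0} = q)"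

text \<open>
  In the following definitions \<open>L\<close> is a complex subalgebra and only the restriction of \<open>B\<close> to
  \<open>L\<close> matters. A real form of signature \<open>(d, d)\<close> on a space of real dimension \<open>2 d\<close> is
  automatically non-degenerate. The condition on the dimension of a Lagrangian subalgebra compares
  a real with a complex dimension, also in the complex case.
\<close>

definition real_manin_form ::
    "'a::complex_lie_algebra set \<Rightarrow> ('a \<Rightarrow> 'a \<Rightarrow> real) \<Rightarrow> bool" where
  "real_manin_form L B \<longleftrightarrow>
     re.symmetric_invariant_form_on L B \<and> has_signature L B (cx.dim L) (cx.dim L)"

definition complex_manin_form ::
    "'a::complex_lie_algebra set \<Rightarrow> ('a \<Rightarrow> 'a \<Rightarrow> complex) \<Rightarrow> bool" where
  "complex_manin_form L B \<longleftrightarrow> cx.symmetric_invariant_form_on L B \<and> cx.nondegenerate_on L B"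

definition real_lagrangian ::
    "'a::complex_lie_algebra set \<Rightarrow> ('a \<Rightarrow> 'a \<Rightarrow> real) \<Rightarrow> 'a set \<Rightarrow> bool" where
  "real_lagrangian L B i \<longleftrightarrow>
     re.lie_subalgebra i \<and> i \<subseteq> L \<and> re.isotropic B i \<and> dim i = cx.dim L"

definition complex_lagrangian ::
    "'a::complex_lie_algebra set \<Rightarrow> ('a \<Rightarrow> 'a \<Rightarrow> complex) \<Rightarrow> 'a set \<Rightarrow> bool" where
  "complex_lagrangian L B i \<longleftrightarrow>
     cx.lie_subalgebra i \<and> i \<subseteq> L \<and> cx.isotropic B i \<and> dim i = cx.dim L"

definition real_manin_triple ::
    "'a::complex_lie_algebra set \<Rightarrow> ('a \<Rightarrow> 'a \<Rightarrow> real) \<Rightarrow> 'a set \<Rightarrow> 'a set \<Rightarrow> bool" where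
  "real_manin_triple L B i i' \<longleftrightarrow> real_manin_form L B \<and>
     re.lie_subalgebra i \<and> re.lie_subalgebra i' \<and>
     re.isotropic B i \<and> re.isotropic B i' \<and> is_direct_sum L i i'"

definition complex_manin_triple ::
    "'a::complex_lie_algebra set \<Rightarrow> ('a \<Rightarrow> 'a \<Rightarrow> complex) \<Rightarrow> 'a set \<Rightarrow> 'a set \<Rightarrow> bool" where
  "complex_manin_triple L B i i' \<longleftrightarrow> complex_manin_form L B \<and>
     cx.lie_subalgebra i \<and> cx.lie_subalgebra i' \<and>
     cx.isotropic B i \<and> cx.isotropic B i' \<and> is_direct_sum L i i'"

end

theory Submission
  imports Defs "HOL-Computational_Algebra.Fundamental_Theorem_Algebra"
begin

text \<open>
  Write \<open>h\<close> for the Cartan subalgebra \<open>j0\<close>. The argument takes place in \<open>p \<inter> p'\<close>. As the two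
  Borel subalgebras meet in \<open>h\<close>, one has \<open>n \<inter> n' = 0\<close>, and sorting weight vectors gives
  \<open>p \<inter> p' = (l \<inter> l') \<oplus> (n \<inter> l') \<oplus> (l \<inter> n')\<close> (\<open>p_inter_p'_decomp\<close>). An invariant form makes
  \<open>n\<close> orthogonal to \<open>p\<close> (\<open>nilradical_orthogonal\<close>), and a Lagrangian subspace contains everything
  orthogonal to it; hence \<open>n \<subseteq> i \<subseteq> p\<close> and \<open>n' \<subseteq> i' \<subseteq> p'\<close>. If \<open>x \<in> i \<inter> i'\<close> has the components \<open>a\<close>,
  \<open>c\<close>, \<open>d\<close>, then \<open>a + d = x - c \<in> i\<close> and \<open>a + c = x - d \<in> i'\<close>, so \<open>a\<close> lies in \<open>i1 \<inter> i1'\<close>; and if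
  \<open>a = 0\<close>, then \<open>d\<close> and \<open>c\<close> lie in the intersections of condition (ii) b). So (ii) implies
  \<open>i \<inter> i' = 0\<close>, which is enough for a direct sum by dimensions. Conversely, the components in
  \<open>l \<inter> l'\<close> of the two summands of an element of \<open>l \<inter> l'\<close> exhibit \<open>l \<inter> l'\<close> as \<open>i1 \<oplus> i1'\<close>
  (\<open>direct_sum_iff\<close>).

  It remains to see that the form restricts to a Manin form on \<open>l \<inter> l'\<close>. It is nondegenerate there
  because the roots of \<open>l\<close> and of \<open>l'\<close> come in opposite pairs
  (\<open>nondegenerate_on_levi_intersection\<close>), and on a sum of two isotropic subspaces nondegeneracy
  already determines the signature (\<open>hyperbolic_basis\<close>). A complex form is treated through its
  real part.

  The structure theory behind this is that \<open>h\<close> is commutative and diagonalizable, that root spaces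
  are lines, and that a reductive subalgebra containing \<open>h\<close> has symmetric roots. All of it comes
  from one criterion for the nilpotency of \<open>ad x\<close> (\<open>ad_nilpotent_criterion\<close>): if \<open>D\<close> multiplies the
  generalized eigenspace of \<open>ad x\<close> for \<open>c\<close> by the complex conjugate of \<open>c\<close>, then the trace of
  \<open>ad x \<circ> D\<close> is the sum of \<open>\<bar>c\<bar>\<^sup>2\<close> over the eigenvalues, and \<open>D\<close> is a derivation, so that for
  \<open>x = [a, b]\<close> the trace can also be computed as that of \<open>- ad a \<circ> ad (D b)\<close>. Together with Engel's
  theorem the criterion gives Cartan's criterion (\<open>trace_form_radical_central\<close>), the commutativity
  and diagonalizability of \<open>h\<close>, and the facts about \<open>sl\<^sub>2\<close> that are needed for
  \<open>root_space_one_dimensional\<close>. That lemma shows that a root space which meets \<open>n\<close> lies in \<open>n\<close>,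
  which makes the projection along \<open>n\<close> explicit (\<open>weight_proj_levi\<close>).
\<close>

section \<open>Traces and generalized eigenspaces\<close>

text \<open>
  Modulo \<open>X - c\<close> the polynomial \<open>q\<close> is the constant \<open>q(c)\<close>, so \<open>1 - q / q(c)\<close> is a multiple of
  \<open>X - c\<close>; its \<open>k\<close>-th power is congruent to \<open>1\<close> modulo \<open>q\<close>.
\<close>

lemma bezout_linear_power:
  fixes q :: "'k::field poly"
  assumes "poly q c \<noteq> 0"
  shows "\<exists>a b. a * [:-c, 1:] ^ k + b * q = 1"
proof -
  define d where "d = poly q c"
  have "poly (q - [:d:]) c = 0" by (simp add: d_def)
  then obtain r where r: "q - [:d:] = [:-c, 1:] * r"
    unfolding poly_eq_0_iff_dvd by (elim dvdE)
  define u where "u = smult (1/d) q"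
  have d0: "d \<noteq> 0" using assms by (simp add: d_def)
  have q: "q = [:-c, 1:] * r + [:d:]" using r by (simp add: algebra_simps)
  have u: "u = [:-c, 1:] * smult (1/d) r + 1"
    unfolding u_def q using d0 by (simp add: smult_add_right one_pCons)
  have "1 - u = [:-c, 1:] * (- smult (1/d) r)" unfolding u by simp
  then have 1: "(1 - u) ^ k = (- smult (1/d) r) ^ k * [:-c, 1:] ^ k"
    by (metis power_mult_distrib mult.commute)
  have "1 - (1 - u) ^ k = (1 - (1 - u)) * (\<Sum>i<k. (1 - u) ^ i)"
    by (rule one_diff_power_eq)
  also have "\<dots> = smult (1/d) (\<Sum>i<k. (1 - u) ^ i) * q" by (simp add: u_def mult.commute)
  finally have "(1 - u) ^ k + smult (1/d) (\<Sum>i<k. (1 - u) ^ i) * q = 1"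
    by (simp add: algebra_simps)
  then show ?thesis unfolding 1 by blast
qed

locale complex_space = finite_dimensional_vector_space scale Basis
  for scale :: "complex \<Rightarrow> 'a::ab_group_add \<Rightarrow> 'a" (infixr "*s" 75) and Basis :: "'a set"
begin

sublocale lp: vector_space_pair scale scale ..

abbreviation lin :: "('a \<Rightarrow> 'a) \<Rightarrow> bool" where
  "lin f \<equiv> Vector_Spaces.linear scale scale f"

lemma linI:
  assumes "\<And>x y. f (x + y) = f x + f y" "\<And>c x. f (c *s x) = c *s f x"
  shows "lin f"
  using assms vector_space_axioms by (simp add: Vector_Spaces.linear_iff)

lemma lin_comp: "lin f \<Longrightarrow> lin g \<Longrightarrow> lin (\<lambda>x. f (g x))"
  by (rule linI) (simp_all add: lp.linear_add lp.linear_scale)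

lemma lin_diff: "lin f \<Longrightarrow> lin g \<Longrightarrow> lin (\<lambda>x. f x - g x)"
  by (rule linI) (simp_all add: lp.linear_add lp.linear_scale scale_right_diff_distrib)

lemma lin_funpow: "lin f \<Longrightarrow> lin (f ^^ k)"
proof (induction k)
  case 0 show ?case by (auto intro: linI)
next
  case (Suc k)
  then have "lin (\<lambda>x. f ((f ^^ k) x))" using lin_comp[of f "f ^^ k"] by simp
  then show ?case by (simp add: o_def)
qed

lemma projection_exists:
  assumes "subspace W"
  shows "\<exists>P. lin P \<and> (\<forall>x. P x \<in> W) \<and> (\<forall>x\<in>W. P x = x)"
proof -
  have "lin (\<lambda>x. x)" by (rule linI) auto
  from lp.linear_exists_left_inverse_on[OF this assms] show ?thesis by auto
qed

definition trace :: "('a \<Rightarrow> 'a) \<Rightarrow> complex" where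
  "trace f = (\<Sum>b\<in>Basis. representation Basis (f b) b)"

lemma representation_lin:
  assumes "lin f" and E: "independent E" "span E = UNIV"
  shows "representation E (f v) e =
    (\<Sum>c\<in>Basis. representation Basis v c * representation E (f c) e)"
proof -
  have "v = (\<Sum>c\<in>Basis. representation Basis v c *s c)"
    by (rule sum_representation_eq[symmetric])
       (simp_all add: independent_Basis span_Basis finite_Basis)
  then have "f v = f (\<Sum>c\<in>Basis. representation Basis v c *s c)" by simp
  also have "\<dots> = (\<Sum>c\<in>Basis. representation Basis v c *s f c)"
    by (simp add: lp.linear_sum[OF assms(1)] lp.linear_scale[OF assms(1)])
  finally have "representation E (f v) = representation E \<dots>" by simp
  then show ?thesis
    by (simp add: representation_sum[OF E(1)] representation_scale[OF E(1)] E(2))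
qed

lemma trace_add: "trace (\<lambda>x. f x + g x) = trace f + trace g"
  by (simp add: trace_def representation_add independent_Basis span_Basis sum.distrib)

lemma trace_diff: "trace (\<lambda>x. f x - g x) = trace f - trace g"
  by (simp add: trace_def representation_diff independent_Basis span_Basis sum_subtractf)

lemma trace_scale: "trace (\<lambda>x. c *s f x) = c * trace f"
  by (simp add: trace_def representation_scale independent_Basis span_Basis sum_distrib_left)

lemma trace_zero: "trace (\<lambda>x. 0) = 0"
  by (simp add: trace_def representation_zero)

lemma trace_comm:
  assumes "lin f" "lin g"
  shows "trace (\<lambda>x. f (g x)) = trace (\<lambda>x. g (f x))"
proof -
  let ?r = "representation Basis"
  have "trace (\<lambda>x. f (g x)) = (\<Sum>b\<in>Basis. \<Sum>c\<in>Basis. ?r (g b) c * ?r (f c) b)"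
    unfolding trace_def
    by (intro sum.cong refl representation_lin assms independent_Basis span_Basis)
  also have "\<dots> = (\<Sum>c\<in>Basis. \<Sum>b\<in>Basis. ?r (f c) b * ?r (g b) c)"
    by (subst sum.swap) (simp add: mult.commute)
  also have "\<dots> = trace (\<lambda>x. g (f x))"
    unfolding trace_def
    by (intro sum.cong refl representation_lin[symmetric] assms independent_Basis span_Basis)
  finally show ?thesis .
qed

text \<open>This allows traces to be computed in a basis of generalized eigenvectors.\<close>

lemma trace_eq_sum_basis:
  assumes "lin f" and E: "independent E" "span E = UNIV"
  shows "trace f = (\<Sum>e\<in>E. representation E (f e) e)"
proof -
  have finE: "finite E" using E(1) by (rule finiteI_independent)
  let ?r = "representation Basis" and ?s = "representation E"
  have id: "lin (\<lambda>x. x)" by (rule linI) auto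
  have "(\<Sum>e\<in>E. ?s (f e) e) = (\<Sum>e\<in>E. \<Sum>b\<in>Basis. ?r e b * ?s (f b) e)"
    by (intro sum.cong refl representation_lin assms)
  also have "\<dots> = (\<Sum>b\<in>Basis. \<Sum>e\<in>E. ?s (f b) e * ?r e b)"
    by (subst sum.swap) (simp add: mult.commute)
  also have "\<dots> = (\<Sum>b\<in>Basis. ?r (f b) b)"
  proof (rule sum.cong[OF refl])
    fix b assume "b \<in> Basis"
    have "f b = (\<Sum>e\<in>E. ?s (f b) e *s e)"
      by (rule sum_representation_eq[symmetric]) (simp_all add: E finE)
    then have "?r (f b) b = ?r (\<Sum>e\<in>E. ?s (f b) e *s e) b" by simp
    also have "\<dots> = (\<Sum>e\<in>E. ?s (f b) e * ?r e b)"
      by (simp add: representation_sum[OF independent_Basis] span_Basis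
          representation_scale[OF independent_Basis])
    finally show "(\<Sum>e\<in>E. ?s (f b) e * ?r e b) = ?r (f b) b" by simp
  qed
  finally show ?thesis by (simp add: trace_def)
qed

definition nilspace :: "('a \<Rightarrow> 'a) \<Rightarrow> 'a set" where
  "nilspace f = {v. \<exists>k. (f ^^ k) v = 0}"

lemma funpow_zero_mono: "lin f \<Longrightarrow> (f ^^ k) v = 0 \<Longrightarrow> k \<le> m \<Longrightarrow> (f ^^ m) v = 0"
proof -
  assume f: "lin f" and "(f ^^ k) v = 0" "k \<le> m"
  then have "(f ^^ m) v = (f ^^ (m - k)) ((f ^^ k) v)"
    by (metis comp_apply funpow_add le_add_diff_inverse2)
  with \<open>(f ^^ k) v = 0\<close> show ?thesis using lin_funpow[OF f] by (simp add: lp.linear_0)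
qed

lemma subspace_nilspace: assumes "lin f" shows "subspace (nilspace f)"
proof (rule subspaceI)
  show "0 \<in> nilspace f" unfolding nilspace_def by (auto intro: exI[of _ 0])
next
  fix x y assume "x \<in> nilspace f" "y \<in> nilspace f"
  then obtain k m where "(f ^^ k) x = 0" "(f ^^ m) y = 0" unfolding nilspace_def by auto
  then have "(f ^^ (max k m)) x = 0" "(f ^^ (max k m)) y = 0"
    using funpow_zero_mono[OF assms] by auto
  then have "(f ^^ (max k m)) (x + y) = 0" using lin_funpow[OF assms] by (simp add: lp.linear_add)
  then show "x + y \<in> nilspace f" unfolding nilspace_def by blast
next
  fix c x assume "x \<in> nilspace f"
  then obtain k where "(f ^^ k) x = 0" unfolding nilspace_def by auto
  then have "(f ^^ k) (c *s x) = 0" using lin_funpow[OF assms] by (simp add: lp.linear_scale)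
  then show "c *s x \<in> nilspace f" unfolding nilspace_def by blast
qed

lemma nilspace_uniform:
  assumes f: "lin f" and nil: "nilspace f = UNIV"
  shows "\<exists>K. \<forall>v. (f ^^ K) v = 0"
proof -
  have "\<forall>b. \<exists>k. (f ^^ k) b = 0" using nil unfolding nilspace_def by auto
  then obtain k where k: "\<And>b. (f ^^ k b) b = 0" by metis
  define K where "K = Max (insert 0 (k ` Basis))"
  have le: "k b \<le> K" if "b \<in> Basis" for b
    unfolding K_def using that finite_Basis by (intro Max_ge) auto
  have "(f ^^ K) v = 0" for v
  proof (rule lp.linear_eq_0_on_span[OF lin_funpow[OF f]])
    show "v \<in> span Basis" by (simp add: span_Basis)
    show "(f ^^ K) b = 0" if "b \<in> Basis" for b
      using funpow_zero_mono[OF f k le[OF that]] .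
  qed
  then show ?thesis by blast
qed

text \<open>
  If \<open>P\<close> projects onto the range of \<open>N ^^ j\<close>, then cyclicity of the trace lets one push \<open>P\<close>
  through \<open>N\<close>, which replaces \<open>j\<close> by \<open>j + 1\<close>; in the end the range is trivial.
\<close>

lemma trace_nilpotent:
  assumes N: "lin N" and nil: "nilspace N = UNIV"
  shows "trace N = 0"
proof -
  obtain K where K: "\<And>v. (N ^^ K) v = 0" using nilspace_uniform[OF assms] by blast
  let ?R = "\<lambda>j. range (N ^^ j)"
  have sub: "subspace (?R j)" for j
    using lp.linear_subspace_image[OF lin_funpow[OF N]] subspace_UNIV by blast
  have "\<exists>P. lin P \<and> (\<forall>x. P x \<in> ?R j) \<and> trace N = trace (\<lambda>x. N (P x)) \<and> (\<forall>x\<in>?R j. P x = x)" for j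
  proof (induction j)
    case 0
    show ?case by (rule exI[of _ "\<lambda>x. x"]) (auto intro: linI)
  next
    case (Suc j)
    then obtain P where P: "lin P" "\<And>x. P x \<in> ?R j" "trace N = trace (\<lambda>x. N (P x))"
      "\<And>x. x \<in> ?R j \<Longrightarrow> P x = x" by blast
    obtain Q where Q: "lin Q" "\<And>x. Q x \<in> ?R (Suc j)" "\<And>x. x \<in> ?R (Suc j) \<Longrightarrow> Q x = x"
      using projection_exists[OF sub[of "Suc j"]] by blast
    have "N (P x) \<in> ?R (Suc j)" for x
    proof -
      obtain y where "P x = (N ^^ j) y" using P(2)[of x] by auto
      then have "N (P x) = (N ^^ Suc j) y" by simp
      then show ?thesis by (rule range_eqI)
    qed
    then have "trace N = trace (\<lambda>x. Q (N (P x)))" using P(3) Q(3) by simp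
    also have "\<dots> = trace (\<lambda>x. N (P (Q x)))" by (rule trace_comm[OF Q(1) lin_comp[OF N P(1)]])
    also have "(\<lambda>x. N (P (Q x))) = (\<lambda>x. N (Q x))"
    proof
      fix x
      obtain y where "Q x = (N ^^ Suc j) y" using Q(2)[of x] by auto
      then have "Q x = (N ^^ j) (N y)" by (simp only: funpow_Suc_right o_apply)
      then show "N (P (Q x)) = N (Q x)" using P(4) by simp
    qed
    finally show ?case using Q by blast
  qed
  from this[of K] obtain P where "\<And>x. P x \<in> ?R K" "trace N = trace (\<lambda>x. N (P x))" by blast
  moreover have "P x = 0" for x using calculation(1)[of x] K by auto
  ultimately show ?thesis using lp.linear_0[OF N] by (simp add: trace_zero)
qed

lemma nilspace_comp_commuting:
  assumes f: "lin f" and g: "lin g" and comm: "\<And>x. f (g x) = g (f x)" and nil: "nilspace f = UNIV"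
  shows "nilspace (\<lambda>x. f (g x)) = UNIV"
proof -
  have c: "(f ^^ k) (g v) = g ((f ^^ k) v)" for k v by (induction k) (simp_all add: comm)
  have pw: "((\<lambda>x. f (g x)) ^^ k) v = (g ^^ k) ((f ^^ k) v)" for k v
  proof (induction k arbitrary: v)
    case (Suc k)
    have "((\<lambda>x. f (g x)) ^^ Suc k) v = ((\<lambda>x. f (g x)) ^^ k) (f (g v))"
      by (simp only: funpow_Suc_right o_apply)
    also have "\<dots> = (g ^^ k) ((f ^^ k) (g (f v)))" using Suc comm by simp
    also have "\<dots> = (g ^^ k) (g ((f ^^ k) (f v)))" by (simp only: c)
    also have "\<dots> = (g ^^ Suc k) ((f ^^ Suc k) v)" by (simp only: funpow_Suc_right o_apply)
    finally show ?case .
  qed simp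
  have "\<exists>k. ((\<lambda>x. f (g x)) ^^ k) v = 0" for v
  proof -
    obtain k where "(f ^^ k) v = 0" using nil unfolding nilspace_def by auto
    then show ?thesis unfolding pw using lp.linear_0[OF lin_funpow[OF g]] by metis
  qed
  then show ?thesis unfolding nilspace_def by blast
qed

definition poly_op :: "('a \<Rightarrow> 'a) \<Rightarrow> complex poly \<Rightarrow> 'a \<Rightarrow> 'a" where
  "poly_op A p v = (\<Sum>i\<le>degree p. coeff p i *s (A ^^ i) v)"

lemma poly_op_upto:
  assumes "degree p \<le> n" shows "poly_op A p v = (\<Sum>i\<le>n. coeff p i *s (A ^^ i) v)"
  unfolding poly_op_def using assms
  by (intro sum.mono_neutral_left) (auto simp: coeff_eq_0)

lemma poly_op_add: "poly_op A (p + q) v = poly_op A p v + poly_op A q v"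
proof -
  let ?n = "max (degree p) (degree q)"
  have "degree (p + q) \<le> ?n" by (rule degree_add_le) auto
  then show ?thesis
    by (simp add: poly_op_upto[of _ ?n] scale_left_distrib sum.distrib)
qed

lemma poly_op_smult: "poly_op A (smult c p) v = c *s poly_op A p v"
proof -
  have "degree (smult c p) \<le> degree p" by (rule degree_smult_le)
  then show ?thesis by (simp add: poly_op_upto[of _ "degree p"] scale_sum_right)
qed

lemma poly_op_0 [simp]: "poly_op A 0 v = 0" by (simp add: poly_op_def)

lemma poly_op_1 [simp]: "poly_op A 1 v = v" by (simp add: poly_op_def)

lemma poly_op_pCons:
  assumes "lin A" shows "poly_op A (pCons a p) v = a *s v + A (poly_op A p v)"
proof -
  have "degree (pCons a p) \<le> Suc (degree p)" by (rule degree_pCons_le)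
  then have "poly_op A (pCons a p) v = (\<Sum>i\<le>Suc (degree p). coeff (pCons a p) i *s (A ^^ i) v)"
    by (rule poly_op_upto)
  also have "\<dots> = a *s v + (\<Sum>i\<le>degree p. coeff p i *s A ((A ^^ i) v))"
    by (simp only: sum.atMost_Suc_shift) simp
  finally show ?thesis
    by (simp add: poly_op_def lp.linear_sum[OF assms] lp.linear_scale[OF assms])
qed

lemma lin_poly_op: "lin A \<Longrightarrow> lin (poly_op A p)"
proof (induction p)
  case 0 then show ?case by (auto intro: linI)
next
  case (pCons a p)
  then have "lin (poly_op A p)" by blast
  then show ?case using pCons(3)
    by (intro linI) (simp_all add: poly_op_pCons lp.linear_add lp.linear_scale algebra_simps)
qed

lemma poly_op_mult: "lin A \<Longrightarrow> poly_op A (p * q) v = poly_op A p (poly_op A q v)"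
  by (induction p) (simp_all add: mult_pCons_left poly_op_add poly_op_smult poly_op_pCons)

lemma poly_op_in_subspace:
  assumes "lin A" "subspace W" "\<And>x. x \<in> W \<Longrightarrow> A x \<in> W" "v \<in> W"
  shows "poly_op A p v \<in> W"
  by (induction p) (simp_all add: assms poly_op_pCons subspace_0 subspace_add subspace_scale)

lemma annihilating_poly: 
  assumes A: "lin A" shows "\<exists>p. p \<noteq> 0 \<and> poly_op A p v = 0"
proof -
  define n where "n = card Basis"
  \<comment> \<open>A linear relation between the vectors \<open>v, A v, \<dots>, A\<^sup>n v\<close>; the second case is that two of them
    coincide.\<close>
  define f where "f i = (A ^^ i) v" for i
  have "\<exists>u. (\<exists>i\<le>n. u i \<noteq> 0) \<and> (\<Sum>i\<le>n. u i *s f i) = 0"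
  proof (cases "inj_on f {..n}")
    case True
    have "dim (f ` {..n}) < card (f ` {..n})"
      using dim_subset_UNIV[of "f ` {..n}"] card_image[OF True] by (simp add: n_def dimension_def)
    then have "dependent (f ` {..n})" using dim_eq_card_independent by fastforce
    then obtain w x where "x \<in> f ` {..n}" "w x \<noteq> 0" "(\<Sum>x\<in>f ` {..n}. w x *s x) = 0"
      by (auto simp: dependent_finite)
    then show ?thesis using sum.reindex[OF True, of "\<lambda>x. w x *s x"]
      by (intro exI[of _ "\<lambda>i. w (f i)"]) auto
  next
    case False
    then obtain i j where ij: "i \<le> n" "j \<le> n" "i \<noteq> j" "f i = f j" by (auto simp: inj_on_def)
    let ?u = "\<lambda>k. if k = i then 1 else if k = j then -1 else (0::complex)"
    have "(\<Sum>k\<le>n. ?u k *s f k) = (\<Sum>k\<in>{i,j}. ?u k *s f k)"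
      using ij by (intro sum.mono_neutral_right) auto
    also have "\<dots> = 0" using ij by simp
    finally show ?thesis using ij by (intro exI[of _ ?u]) auto
  qed
  then obtain u i where u: "i \<le> n" "u i \<noteq> 0" "(\<Sum>i\<le>n. u i *s f i) = 0" by blast
  define p where "p = (\<Sum>i\<le>n. monom (u i) i)"
  have cp: "coeff p k = (if k \<le> n then u k else 0)" for k
    by (simp add: p_def coeff_sum)
  have "degree p \<le> n" by (rule degree_le) (simp add: cp)
  then have "poly_op A p v = 0" using u(3) by (simp add: poly_op_upto cp f_def)
  moreover have "p \<noteq> 0" using u cp[of i] by auto
  ultimately show ?thesis by blast
qed

definition gen_eigenspace :: "('a \<Rightarrow> 'a) \<Rightarrow> complex \<Rightarrow> 'a set" where
  "gen_eigenspace A c = nilspace (\<lambda>v. A v - c *s v)"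

lemma lin_shift: "lin A \<Longrightarrow> lin (\<lambda>v. A v - c *s v)"
  by (rule lin_diff, assumption, rule linI) (simp_all add: scale_right_distrib scale_left_commute)

lemma subspace_gen_eigenspace: "lin A \<Longrightarrow> subspace (gen_eigenspace A c)"
  unfolding gen_eigenspace_def by (intro subspace_nilspace lin_shift)

lemma poly_op_linear_power:
  assumes "lin A" shows "poly_op A ([:-c, 1:] ^ k) v = ((\<lambda>v. A v - c *s v) ^^ k) v"
  by (induction k) (simp_all add: poly_op_mult[OF assms] poly_op_pCons[OF assms] lp.linear_0[OF assms]
      del: mult_pCons_left)

lemma gen_eigenspace_iff:
  "lin A \<Longrightarrow> v \<in> gen_eigenspace A c \<longleftrightarrow> (\<exists>k. poly_op A ([:-c, 1:] ^ k) v = 0)"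
  by (simp add: gen_eigenspace_def nilspace_def poly_op_linear_power)

lemma gen_eigenspace_image: 
  assumes "lin A" "v \<in> gen_eigenspace A c" shows "A v \<in> gen_eigenspace A c"
proof -
  obtain k where "poly_op A ([:-c, 1:] ^ k) v = 0" using assms gen_eigenspace_iff by blast
  moreover have "A v = poly_op A [:0, 1:] v" by (simp add: poly_op_pCons[OF assms(1)] lp.linear_0[OF assms(1)])
  ultimately have "poly_op A ([:-c, 1:] ^ k) (A v) = 0"
    by (metis assms(1) lp.linear_0 lin_poly_op mult.commute poly_op_mult)
  then show ?thesis using assms gen_eigenspace_iff by blast
qed

text \<open>
  Independence of distinct generalized eigenspaces, in the form in which it is used: \<open>q\<close> will be a
  polynomial that kills vectors of other generalized eigenspaces.
\<close>

lemma gen_eigenspace_coprime: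
  assumes A: "lin A" and v: "v \<in> gen_eigenspace A c" and q: "poly_op A q v = 0" "poly q c \<noteq> 0"
  shows "v = 0"
proof -
  obtain k where k: "poly_op A ([:-c, 1:] ^ k) v = 0" using A v gen_eigenspace_iff by blast
  obtain a b where ab: "a * [:-c, 1:] ^ k + b * q = 1" using bezout_linear_power[OF q(2)] by blast
  have "v = poly_op A (a * [:-c, 1:] ^ k + b * q) v" unfolding ab by simp
  also have "\<dots> = 0" 
    by (simp add: poly_op_add poly_op_mult[OF A] k q lp.linear_0[OF lin_poly_op[OF A]] del: mult_pCons_left)
  finally show ?thesis .
qed

text \<open>
  The factors of an annihilating polynomial of a vector of \<open>W\<close> are split off one by one with
  Bezout's identity; all pieces stay in \<open>W\<close>.
\<close>

lemma stable_subspace_gen_eigenspaces: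
  assumes A: "lin A" and W: "subspace W" "\<And>x. x \<in> W \<Longrightarrow> A x \<in> W"
  shows "W \<subseteq> span (W \<inter> (\<Union>c. gen_eigenspace A c))"
proof -
  have "v \<in> span (W \<inter> (\<Union>c. gen_eigenspace A c))"
    if "v \<in> W" "p \<noteq> 0" "poly_op A p v = 0" for p v
    using that
  proof (induction "degree p" arbitrary: p v rule: less_induct)
    case less
    show ?case
    proof (cases "degree p = 0")
      case True
      then obtain a where "p = [:a:]" by (rule degree_eq_zeroE)
      then have "v = 0" using less by (simp add: poly_op_def)
      then show ?thesis by (simp add: span_zero)
    next
      case False
      then have "\<not> constant (poly p)" by (simp add: constant_degree)
      then obtain c where c: "poly p c = 0" using fundamental_theorem_of_algebra by blast
      define m where "m = [:-c, 1:] ^ order c p"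
      obtain q where q: "p = m * q" "\<not> [:-c, 1:] dvd q"
        using order_decomp[OF less(3)] unfolding m_def by blast
      have qc: "poly q c \<noteq> 0" using q(2) by (simp add: poly_eq_0_iff_dvd)
      obtain a b where ab: "a * m + b * q = 1"
        unfolding m_def using bezout_linear_power[OF qc] by blast
      define v1 where "v1 = poly_op A (a * m) v"
      define v2 where "v2 = poly_op A (b * q) v"
      have v: "v = v1 + v2" unfolding v1_def v2_def using ab by (metis poly_op_1 poly_op_add)
      have inW: "v1 \<in> W" "v2 \<in> W" unfolding v1_def v2_def
        using poly_op_in_subspace[OF A W less(2)] by auto
      have kill: "poly_op A (r * p) v = 0" for r
        by (simp add: poly_op_mult[OF A] less lp.linear_0[OF lin_poly_op[OF A]])
      have "poly_op A m v2 = poly_op A (b * p) v" unfolding v2_def q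
        by (simp only: poly_op_mult[OF A, symmetric] ac_simps)
      then have "v2 \<in> gen_eigenspace A c" using kill A gen_eigenspace_iff m_def by auto
      then have 2: "v2 \<in> span (W \<inter> (\<Union>c. gen_eigenspace A c))"
        using inW by (intro span_base) blast
      have "poly_op A q v1 = poly_op A (a * p) v" unfolding v1_def q
        by (simp only: poly_op_mult[OF A, symmetric] ac_simps)
      then have q0: "poly_op A q v1 = 0" using kill by simp
      have "q \<noteq> 0" using q(1) less(3) by auto
      moreover have "m \<noteq> 0" by (simp add: m_def)
      ultimately have "degree p = degree m + degree q" unfolding q by (intro degree_mult_eq)
      moreover have "degree m \<noteq> 0" 
        using c less(3) by (simp add: m_def degree_power_eq order_root)
      ultimately have "degree q < degree p" by simp
      from less(1)[OF this inW(1) \<open>q \<noteq> 0\<close> q0] show ?thesis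
        unfolding v using 2 by (intro span_add)
    qed
  qed
  then show ?thesis using annihilating_poly[OF A] by blast
qed

lemma span_gen_eigenspaces:
  assumes "lin A" shows "span (\<Union>c. gen_eigenspace A c) = UNIV"
  using stable_subspace_gen_eigenspaces[OF assms, of UNIV] by auto

lemma gen_eigenbasis:
  assumes A: "lin A"
  shows "\<exists>E c. independent E \<and> span E = UNIV \<and> finite E \<and> (\<forall>e\<in>E. e \<in> gen_eigenspace A (c e))"
proof -
  obtain E where E: "E \<subseteq> (\<Union>c. gen_eigenspace A c)" "independent E" "(\<Union>c. gen_eigenspace A c) \<subseteq> span E"
    by (rule maximal_independent_subset)
  have "span E = UNIV" using span_gen_eigenspaces[OF A] span_minimal[OF E(3)] by auto
  moreover have "\<forall>e\<in>E. \<exists>c. e \<in> gen_eigenspace A c" using E(1) by blast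
  then obtain c where "\<forall>e\<in>E. e \<in> gen_eigenspace A (c e)" by metis
  ultimately show ?thesis using E(2) finiteI_independent by blast
qed

text \<open>
  The operator that multiplies each generalized eigenspace of \<open>A\<close> by a prescribed scalar. For
  \<open>\<phi> = id\<close> it is the semisimple part of \<open>A\<close>, for \<open>\<phi> = cnj\<close> its complex conjugate.
\<close>

lemma eigenvalue_calculus:
  assumes A: "lin A"
  shows "\<exists>D. lin D \<and> (\<forall>c. \<forall>v\<in>gen_eigenspace A c. D v = \<phi> c *s v)"
proof -
  obtain E ev where E: "independent E" "span E = UNIV" "finite E"
    and ev: "\<And>e. e \<in> E \<Longrightarrow> e \<in> gen_eigenspace A (ev e)"
    using gen_eigenbasis[OF A] by blast
  define D where "D = lp.construct E (\<lambda>e. \<phi> (ev e) *s e)"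
  have linD: "lin D" unfolding D_def by (rule lp.linear_construct[OF E(1)])
  have De: "D e = \<phi> (ev e) *s e" if "e \<in> E" for e
    unfolding D_def by (rule lp.construct_basis[OF E(1) that])
  have "D v = \<phi> c *s v" if v: "v \<in> gen_eigenspace A c" for c v
  proof -
    define r where "r = representation E v"
    define u where "u = (\<Sum>e\<in>{e\<in>E. ev e = c}. r e *s e)"
    define w where "w = (\<Sum>e\<in>{e\<in>E. ev e \<noteq> c}. r e *s e)"
    have "v = (\<Sum>e\<in>E. r e *s e)" unfolding r_def
      by (rule sum_representation_eq[symmetric]) (simp_all add: E)
    also have "\<dots> = u + w" unfolding u_def w_def
      by (subst sum.union_disjoint[symmetric]) (auto intro!: sum.cong simp: E)
    finally have vuw: "v = u + w" .
    \<comment> \<open>The part \<open>w\<close> of \<open>v\<close> from other eigenvalues lies in the eigenspace of \<open>c\<close>, but is killed by \<open>q\<close>.\<close>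
    have u: "u \<in> gen_eigenspace A c" unfolding u_def
      using ev subspace_gen_eigenspace[OF A]
      by (intro subspace_sum subspace_scale) auto
    have "w = v - u" by (simp add: vuw)
    then have wc: "w \<in> gen_eigenspace A c"
      using u v subspace_gen_eigenspace[OF A] by (simp add: subspace_diff)
    have "\<forall>e\<in>E. \<exists>k. poly_op A ([:- ev e, 1:] ^ k) e = 0"
      using ev gen_eigenspace_iff[OF A] by blast
    then obtain k where k: "\<And>e. e \<in> E \<Longrightarrow> poly_op A ([:- ev e, 1:] ^ k e) e = 0" by metis
    define q where "q = (\<Prod>e\<in>{e\<in>E. ev e \<noteq> c}. [:- ev e, 1:] ^ k e)"
    have "poly_op A q e = 0" if "e \<in> {e\<in>E. ev e \<noteq> c}" for e
    proof -
      have "q = (\<Prod>e\<in>{e\<in>E. ev e \<noteq> c} - {e}. [:- ev e, 1:] ^ k e) * [:- ev e, 1:] ^ k e"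
        unfolding q_def by (subst prod.remove[OF _ that]) (simp_all add: E mult.commute)
      then show ?thesis using that k[of e] lp.linear_0[OF lin_poly_op[OF A]]
        by (simp add: poly_op_mult[OF A] del: mult_pCons_left)
    qed
    then have "poly_op A q w = 0" unfolding w_def
      by (simp add: lp.linear_sum[OF lin_poly_op[OF A]] lp.linear_scale[OF lin_poly_op[OF A]])
    moreover have "poly q c \<noteq> 0" unfolding q_def by (simp add: poly_prod poly_power E)
    ultimately have "w = 0" using gen_eigenspace_coprime[OF A wc] by blast
    then have "D v = D u" using vuw by simp
    also have "\<dots> = (\<Sum>e\<in>{e\<in>E. ev e = c}. r e *s (\<phi> c *s e))" unfolding u_def
      by (simp add: lp.linear_sum[OF linD] lp.linear_scale[OF linD] De)
    also have "\<dots> = \<phi> c *s u" unfolding u_def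
      by (simp add: scale_sum_right scale_left_commute mult.commute)
    finally show ?thesis using vuw \<open>w = 0\<close> by simp
  qed
  then show ?thesis using linD by blast
qed

lemma lin_eq_on_gen_eigenspaces:
  assumes A: "lin A" and "lin f" "lin g" "\<And>c v. v \<in> gen_eigenspace A c \<Longrightarrow> f v = g v"
  shows "f v = g v"
proof (rule lp.linear_eq_on[OF assms(2,3)])
  show "v \<in> span (\<Union>c. gen_eigenspace A c)" using span_gen_eigenspaces[OF A] by simp
qed (use assms in auto)

lemma subspace_UN_gen_eigenspaces:
  assumes A: "lin A" and "subspace W" "\<And>c. gen_eigenspace A c \<subseteq> W"
  shows "W = UNIV"
  using span_minimal[of "\<Union>c. gen_eigenspace A c" W] assms span_gen_eigenspaces[OF A] by auto

text \<open>
  On the generalized eigenspace for \<open>c\<close> the operator \<open>A - S\<close> agrees with \<open>A - c\<close>.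
\<close>

lemma nilpotent_part:
  assumes A: "lin A" and S: "lin S" "\<And>c v. v \<in> gen_eigenspace A c \<Longrightarrow> S v = c *s v"
  shows "nilspace (\<lambda>x. A x - S x) = UNIV"
proof (rule subspace_UN_gen_eigenspaces[OF A])
  show "subspace (nilspace (\<lambda>x. A x - S x))" by (rule subspace_nilspace[OF lin_diff[OF A S(1)]])
  show "gen_eigenspace A c \<subseteq> nilspace (\<lambda>x. A x - S x)" for c
  proof
    fix v assume v: "v \<in> gen_eigenspace A c"
    have "((\<lambda>x. A x - S x) ^^ k) v = ((\<lambda>x. A x - c *s x) ^^ k) v 
       \<and> ((\<lambda>x. A x - S x) ^^ k) v \<in> gen_eigenspace A c" for k
    proof (induction k)
      case (Suc k)
      let ?y = "((\<lambda>x. A x - S x) ^^ k) v"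
      have y: "?y \<in> gen_eigenspace A c" using Suc by blast
      have "A ?y - c *s ?y \<in> gen_eigenspace A c"
        by (intro subspace_diff subspace_scale subspace_gen_eigenspace A gen_eigenspace_image y)
      then show ?case using Suc S(2)[OF y] by auto
    qed (use v in simp)
    then show "v \<in> nilspace (\<lambda>x. A x - S x)"
      using v unfolding gen_eigenspace_def nilspace_def by auto
  qed
qed

lemma eigenvalue_calculus_commute:
  assumes A: "lin A" and D: "lin D" "\<And>c v. v \<in> gen_eigenspace A c \<Longrightarrow> D v = \<phi> c *s v"
  shows "D (A v) = A (D v)"
proof (rule lin_eq_on_gen_eigenspaces[OF A, where f = "\<lambda>v. D (A v)" and g = "\<lambda>v. A (D v)"])
  show "lin (\<lambda>v. D (A v))" by (rule lin_comp[OF D(1) A])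
  show "lin (\<lambda>v. A (D v))" by (rule lin_comp[OF A D(1)])
  show "D (A v) = A (D v)" if "v \<in> gen_eigenspace A c" for c v
    using gen_eigenspace_image[OF A that] that by (simp add: D lp.linear_scale[OF A])
qed

text \<open>
  With \<open>D\<close> the complex conjugate of the semisimple part of \<open>A\<close>, the trace of \<open>A \<circ> D\<close> is the sum of
  \<open>\<bar>c\<bar>\<^sup>2\<close> over the eigenvalues \<open>c\<close> of \<open>A\<close>, counted with multiplicity. This detects nilpotency.
\<close>

lemma nilpotent_if_trace_conj_zero:
  assumes A: "lin A" and D: "lin D" "\<And>c v. v \<in> gen_eigenspace A c \<Longrightarrow> D v = cnj c *s v"
    and tr: "trace (\<lambda>x. A (D x)) = 0"
  shows "nilspace A = UNIV"
proof -
  obtain S where S: "lin S" "\<And>c v. v \<in> gen_eigenspace A c \<Longrightarrow> S v = c *s v"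
    using eigenvalue_calculus[OF A, of "\<lambda>c. c"] by blast
  obtain E ev where E: "independent E" "span E = UNIV" "finite E"
    and ev: "\<And>e. e \<in> E \<Longrightarrow> e \<in> gen_eigenspace A (ev e)"
    using gen_eigenbasis[OF A] by blast
  let ?N = "\<lambda>x. A x - S x"
  have linN: "lin ?N" by (rule lin_diff[OF A S(1)])
  have SD: "D (S v) = S (D v)" for v
  proof (rule lin_eq_on_gen_eigenspaces[OF A, where f = "\<lambda>v. D (S v)" and g = "\<lambda>v. S (D v)"])
    show "lin (\<lambda>v. D (S v))" by (rule lin_comp[OF D(1) S(1)])
    show "lin (\<lambda>v. S (D v))" by (rule lin_comp[OF S(1) D(1)])
    show "D (S v) = S (D v)" if "v \<in> gen_eigenspace A c" for c v
      using that by (simp add: D S lp.linear_scale[OF S(1)] lp.linear_scale[OF D(1)] mult.commute)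
  qed
  have comm: "?N (D v) = D (?N v)" for v
    using SD eigenvalue_calculus_commute[OF A D] by (simp add: lp.linear_diff[OF D(1)])
  have "nilspace (\<lambda>x. ?N (D x)) = UNIV"
    using nilspace_comp_commuting[OF linN D(1)] comm nilpotent_part[OF A S] by blast
  then have "trace (\<lambda>x. ?N (D x)) = 0"
    by (rule trace_nilpotent[OF lin_comp[OF linN D(1)]])
  then have "trace (\<lambda>x. S (D x)) = 0" using tr by (simp add: trace_diff)
  moreover have "trace (\<lambda>x. S (D x)) = (\<Sum>e\<in>E. representation E (S (D e)) e)"
    by (rule trace_eq_sum_basis[OF lin_comp[OF S(1) D(1)] E(1,2)])
  moreover have "representation E (S (D e)) e = of_real ((cmod (ev e))\<^sup>2)" if "e \<in> E" for e
  proof -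
    have "S (D e) = (ev e * cnj (ev e)) *s e"
      using ev[OF that] by (simp add: D S lp.linear_scale[OF S(1)] mult.commute)
    also have "ev e * cnj (ev e) = of_real ((cmod (ev e))\<^sup>2)" by (rule complex_norm_square[symmetric])
    finally show ?thesis
      using that E by (simp add: representation_scale representation_basis)
  qed
  ultimately have "(\<Sum>e\<in>E. complex_of_real ((cmod (ev e))\<^sup>2)) = 0" by simp
  then have "(\<Sum>e\<in>E. (cmod (ev e))\<^sup>2) = 0" by (metis of_real_eq_0_iff of_real_sum)
  then have "\<And>e. e \<in> E \<Longrightarrow> ev e = 0" using E(3) by (simp add: sum_nonneg_eq_0_iff)
  then have "E \<subseteq> gen_eigenspace A 0" using ev by force
  then have "span E \<subseteq> gen_eigenspace A 0" using subspace_gen_eigenspace[OF A] by (intro span_minimal)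
  then show ?thesis using E(2) unfolding gen_eigenspace_def by auto
qed

text \<open>
  \<open>A\<close> is invertible on a generalized eigenspace with nonzero eigenvalue.
\<close>

lemma gen_eigenspace_in_range:
  assumes A: "lin A" and v: "v \<in> gen_eigenspace A c" and "c \<noteq> 0"
  shows "\<exists>u. v = A u"
proof -
  let ?f = "\<lambda>v. A v - c *s v"
  have "(?f ^^ k) v = 0 \<Longrightarrow> \<exists>u. v = A u" for k
  proof (induction k arbitrary: v)
    case 0 then show ?case using lp.linear_0[OF A] by (intro exI[of _ 0]) simp
  next
    case (Suc k)
    then have "(?f ^^ k) (?f v) = 0" by (simp only: funpow_Suc_right o_apply)
    from Suc.IH[OF this] obtain u where u: "?f v = A u" by blast
    have "v = (1/c) *s (A v - ?f v)" using assms by simp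
    also have "\<dots> = A ((1/c) *s (v - u))"
      unfolding u by (simp add: lp.linear_scale[OF A] lp.linear_diff[OF A])
    finally show ?case by blast
  qed
  then show ?thesis using v unfolding gen_eigenspace_def nilspace_def by blast
qed

end

section \<open>Nilpotent elements and the trace form\<close>

context lie_algebra
begin

lemma bracket_zero [simp]: "bracket 0 y = 0" "bracket x 0 = 0"
  using bracket_add_left[of 0 0 y] bracket_add_right[of x 0 0] by simp_all

lemma bracket_antisym: "bracket x y = - bracket y x"
proof -
  have "bracket (x + y) (x + y) = 0" by (rule bracket_self)
  then have "bracket x y + bracket y x = 0"
    unfolding bracket_add_left bracket_add_right by (simp add: bracket_self add.commute)
  then show ?thesis by (rule eq_neg_iff_add_eq_0[THEN iffD2])
qed

lemma bracket_minus_left: "bracket (- x) y = - bracket x y"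
  by (metis add.right_inverse bracket_add_left bracket_zero(1) minus_unique)

lemma bracket_minus_right: "bracket x (- y) = - bracket x y"
  by (metis bracket_antisym bracket_minus_left)

lemma bracket_diff_left: "bracket (x - y) z = bracket x z - bracket y z"
  by (simp only: diff_conv_add_uminus bracket_add_left bracket_minus_left)

lemma bracket_diff_right: "bracket x (y - z) = bracket x y - bracket x z"
  by (simp only: diff_conv_add_uminus bracket_add_right bracket_minus_right)

lemma bracket_bracket: "bracket (bracket a b) v = bracket a (bracket b v) - bracket b (bracket a v)"
proof -
  have "bracket a (bracket b v) + bracket b (bracket v a) + bracket v (bracket a b) = 0"
    by (rule jacobi)
  moreover have "bracket b (bracket v a) = - bracket b (bracket a v)"
    by (metis bracket_antisym bracket_minus_right)
  moreover have "bracket v (bracket a b) = - bracket (bracket a b) v" by (rule bracket_antisym)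
  ultimately show ?thesis by (simp add: algebra_simps)
qed

lemma ad_derivation: "bracket x (bracket u v) = bracket (bracket x u) v + bracket u (bracket x v)"
  by (simp add: bracket_bracket)

lemmas bracket_simps = bracket_add_left bracket_add_right bracket_scale_left bracket_scale_right
  bracket_diff_left bracket_diff_right bracket_minus_left bracket_minus_right

lemma span_bracket_in:
  assumes "subspace T" "y \<in> span S" "\<And>s. s \<in> S \<Longrightarrow> bracket x s \<in> T"
  shows "bracket x y \<in> T"
  using assms(2)
proof (induction rule: span_induct_alt)
  case base then show ?case using subspace_0[OF assms(1)] by simp
next
  case (step c s y)
  then show ?case
    using assms(1,3) by (simp add: bracket_simps subspace_add subspace_scale)
qed

lemma subspace_commutator: "subspace (commutator A C)"
  by (simp add: commutator_def)

lemma bracket_in_commutator: "a \<in> A \<Longrightarrow> c \<in> C \<Longrightarrow> bracket a c \<in> commutator A C"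
  unfolding commutator_def by (intro span_base) blast

lemma commutator_subset:
  "subspace T \<Longrightarrow> (\<And>a c. a \<in> A \<Longrightarrow> c \<in> C \<Longrightarrow> bracket a c \<in> T) \<Longrightarrow> commutator A C \<subseteq> T"
  unfolding commutator_def by (intro span_minimal) blast+

lemma commutator_mono: "A \<subseteq> A' \<Longrightarrow> C \<subseteq> C' \<Longrightarrow> commutator A C \<subseteq> commutator A' C'"
  by (rule commutator_subset[OF subspace_commutator]) (auto intro: bracket_in_commutator)

lemma lie_subalgebraD:
  assumes "lie_subalgebra L"
  shows "subspace L" "x \<in> L \<Longrightarrow> y \<in> L \<Longrightarrow> bracket x y \<in> L"
  using assms unfolding lie_subalgebra_def by auto

text \<open>By the modular law, an invariant complement in the ambient algebra meets \<open>L\<close> in a complement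
  inside \<open>L\<close>.\<close>

lemma reductive_complement:
  assumes red: "reductive_in_ambient L" and L: "lie_subalgebra L"
    and I: "subspace I" "I \<subseteq> L" "\<And>x y. x \<in> L \<Longrightarrow> y \<in> I \<Longrightarrow> bracket x y \<in> I"
  shows "\<exists>J. subspace J \<and> J \<subseteq> L \<and> (\<forall>x\<in>L. \<forall>y\<in>J. bracket x y \<in> J) \<and>
     (\<forall>x\<in>L. \<exists>a\<in>I. \<exists>b\<in>J. x = a + b) \<and> I \<inter> J = {0}"
proof -
  obtain W where W: "subspace W" "\<forall>x\<in>L. \<forall>y\<in>W. bracket x y \<in> W" "is_direct_sum UNIV I W"
    using red I unfolding reductive_in_ambient_def by blast
  have "\<exists>a\<in>I. \<exists>b\<in>W \<inter> L. x = a + b" if "x \<in> L" for x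
  proof -
    have "x \<in> {a + c |a c. a \<in> I \<and> c \<in> W}" using W(3) unfolding is_direct_sum_def by blast
    then obtain a b where ab: "x = a + b" "a \<in> I" "b \<in> W" by blast
    then have "b = x - a" by simp
    then have "b \<in> L" using that ab I lie_subalgebraD[OF L] subspace_diff by blast
    then show ?thesis using ab by blast
  qed
  moreover have "I \<inter> (W \<inter> L) = {0}"
    using W(3) I(2) unfolding is_direct_sum_def by blast
  moreover have "subspace (W \<inter> L)" using W L by (intro subspace_inter) (auto simp: lie_subalgebra_def)
  ultimately show ?thesis using W(2) lie_subalgebraD(2)[OF L]
    by (intro exI[of _ "W \<inter> L"]) blast
qed

text \<open>
  The center has a complementary ideal, and that ideal contains all brackets.
\<close>

lemma center_inter_derived:
  assumes red: "reductive_in_ambient UNIV" and z: "z \<in> commutator UNIV UNIV" "\<And>y. bracket z y = 0"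
  shows "z = 0"
proof -
  let ?Z = "{z. \<forall>y. bracket z y = 0}"
  have "subspace ?Z" by (rule subspaceI) (auto simp: bracket_simps)
  moreover have "lie_subalgebra UNIV" by (simp add: lie_subalgebra_def)
  moreover have "bracket x y \<in> ?Z" if "y \<in> ?Z" for x y
    using that bracket_antisym[of x y] by simp
  ultimately obtain J where J: "subspace J" "\<forall>x y. y \<in> J \<longrightarrow> bracket x y \<in> J"
      "\<forall>x. \<exists>a\<in>?Z. \<exists>b\<in>J. x = a + b" "?Z \<inter> J = {0}"
    using reductive_complement[OF red, of ?Z] by auto
  have "commutator UNIV UNIV \<subseteq> J"
  proof (rule commutator_subset[OF J(1)])
    fix x y
    obtain a b where ab: "a \<in> ?Z" "b \<in> J" "y = a + b" using J(3) by blast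
    have "bracket x y = bracket x b" 
      using ab bracket_antisym[of x a] by (simp add: bracket_simps)
    then show "bracket x y \<in> J" using J(2) ab by simp
  qed
  then show ?thesis using z J(4) by blast
qed

end

locale complex_lie = complex_space scale Basis + lie_algebra scale bracket
  for scale :: "complex \<Rightarrow> 'a::ab_group_add \<Rightarrow> 'a" (infixr "*s" 75)
    and Basis :: "'a set" and bracket :: "'a \<Rightarrow> 'a \<Rightarrow> 'a"
begin

lemma lin_ad: "lin (bracket x)"
  by (rule linI) (simp_all add: bracket_simps)

text \<open>
  Leibniz's rule: \<open>(ad x - (c + d)) [u, v] = [(ad x - c) u, v] + [u, (ad x - d) v]\<close>.
\<close>

lemma gen_eigenspace_bracket:
  assumes u: "u \<in> gen_eigenspace (bracket x) c" and v: "v \<in> gen_eigenspace (bracket x) d"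
  shows "bracket u v \<in> gen_eigenspace (bracket x) (c + d)"
proof -
  let ?f = "\<lambda>c v. bracket x v - c *s v"
  have "(?f c ^^ k) u = 0 \<Longrightarrow> (?f d ^^ m) v = 0 \<Longrightarrow> (?f (c + d) ^^ (k + m)) (bracket u v) = 0"
    for k m u v
  proof (induction "k + m" arbitrary: k m u v)
    case 0
    then show ?case by simp
  next
    case (Suc n)
    have lin: "lin (?f (c + d) ^^ n)" by (intro lin_funpow lin_shift lin_ad)
    have e: "?f (c + d) (bracket u v) = bracket (?f c u) v + bracket u (?f d v)"
      unfolding ad_derivation[of x u v] by (simp add: bracket_simps scale_left_distrib)
    have 1: "(?f (c + d) ^^ n) (bracket (?f c u) v) = 0"
    proof (cases k)
      case 0
      then have "u = 0" using Suc by simp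
      then show ?thesis using lp.linear_0[OF lin] by simp
    next
      case (Suc k')
      then have "(?f c ^^ k') (?f c u) = 0" using Suc.prems(1) by (simp only: funpow_Suc_right o_apply)
      then show ?thesis using Suc.hyps(1)[of k' m] Suc.hyps(2) Suc Suc.prems by simp
    qed
    have 2: "(?f (c + d) ^^ n) (bracket u (?f d v)) = 0"
    proof (cases m)
      case 0
      then have "v = 0" using Suc by simp
      then show ?thesis using lp.linear_0[OF lin] by simp
    next
      case (Suc m')
      then have "(?f d ^^ m') (?f d v) = 0" using Suc.prems(2) by (simp only: funpow_Suc_right o_apply)
      then show ?thesis using Suc.hyps(1)[of k m'] Suc.hyps(2) Suc Suc.prems by simp
    qed
    have "(?f (c + d) ^^ (k + m)) (bracket u v) = (?f (c + d) ^^ n) (?f (c + d) (bracket u v))"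
      unfolding Suc.hyps(2)[symmetric] by (simp only: funpow_Suc_right o_apply)
    also have "\<dots> = 0" unfolding e by (simp only: lp.linear_add[OF lin] 1 2) simp
    finally show ?case .
  qed
  then show ?thesis using u v unfolding gen_eigenspace_def nilspace_def by blast
qed

text \<open>Because the generalized eigenspaces of \<open>ad x\<close> form a grading, the operators of the
  eigenvalue calculus of \<open>ad x\<close> are derivations when \<open>\<phi>\<close> is additive.\<close>

lemma eigenvalue_calculus_derivation:
  assumes D: "lin D" "\<And>c v. v \<in> gen_eigenspace (bracket x) c \<Longrightarrow> D v = \<phi> c *s v"
    and add: "\<And>c d. \<phi> (c + d) = \<phi> c + \<phi> d"
  shows "D (bracket u v) = bracket (D u) v + bracket u (D v)"
proof -
  note A = lin_ad[of x]
  have lin_plus: "lin (\<lambda>v. f v + g v)" if "lin f" "lin g" for f g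
    using that by (intro linI) (simp_all add: lp.linear_add lp.linear_scale scale_right_distrib)
  have lin_ad': "lin (\<lambda>v. bracket v y)" for y by (rule linI) (simp_all add: bracket_simps)
  have "D (bracket u v) = bracket (D u) v + bracket u (D v)" 
    if u: "u \<in> gen_eigenspace (bracket x) c" for u v c
  proof (rule lin_eq_on_gen_eigenspaces[OF A, where f = "\<lambda>v. D (bracket u v)"
        and g = "\<lambda>v. bracket (D u) v + bracket u (D v)"])
    show "lin (\<lambda>v. D (bracket u v))" by (rule lin_comp[OF D(1) lin_ad])
    show "lin (\<lambda>v. bracket (D u) v + bracket u (D v))"
      by (rule lin_plus[OF lin_ad lin_comp[OF lin_ad D(1)]])
    show "D (bracket u v) = bracket (D u) v + bracket u (D v)"
      if v: "v \<in> gen_eigenspace (bracket x) d" for d v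
      using D(2)[OF gen_eigenspace_bracket[OF u v]] D(2)[OF u] D(2)[OF v]
      by (simp add: add scale_left_distrib bracket_simps)
  qed
  note 1 = this
  show ?thesis
  proof (rule lin_eq_on_gen_eigenspaces[OF A, where f = "\<lambda>u. D (bracket u v)"
        and g = "\<lambda>u. bracket (D u) v + bracket u (D v)"])
    show "lin (\<lambda>u. D (bracket u v))" by (rule lin_comp[OF D(1) lin_ad'])
    show "lin (\<lambda>u. bracket (D u) v + bracket u (D v))"
      by (rule lin_plus[OF lin_comp[OF lin_ad' D(1)] lin_ad'])
  qed (rule 1)
qed

text \<open>
  The trace is always taken over the whole algebra, also when the form is restricted to a
  subalgebra \<open>l\<close>; then it is the trace form of the representation of \<open>l\<close> on the ambient algebra, and
  not the Killing form of \<open>l\<close>.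
\<close>

definition killing :: "'a \<Rightarrow> 'a \<Rightarrow> complex" where
  "killing x y = trace (\<lambda>v. bracket x (bracket y v))"

lemma killing_comm: "killing x y = killing y x"
  unfolding killing_def by (rule trace_comm[OF lin_ad lin_ad])

lemma killing_add_right: "killing x (y + z) = killing x y + killing x z"
  by (simp add: killing_def bracket_simps trace_add)

lemma killing_scale_right: "killing x (c *s y) = c * killing x y"
  by (simp add: killing_def bracket_simps trace_scale)

lemma killing_add_left: "killing (x + y) z = killing x z + killing y z"
  by (simp add: killing_def bracket_simps trace_add)

lemma killing_scale_left: "killing (c *s x) y = c * killing x y"
  by (simp add: killing_def bracket_simps trace_scale)

lemma killing_zero [simp]: "killing x 0 = 0" "killing 0 x = 0"
  by (simp_all add: killing_def trace_zero)

lemma killing_diff_left: "killing (x - y) z = killing x z - killing y z"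
  by (simp add: killing_def bracket_simps trace_diff)

lemma killing_invariant: "killing (bracket x y) z = - killing y (bracket x z)"
proof -
  have "trace (\<lambda>v. bracket x (bracket y (bracket z v))) = trace (\<lambda>v. bracket y (bracket z (bracket x v)))"
    by (rule trace_comm[OF lin_ad lin_comp[OF lin_ad lin_ad]])
  then show ?thesis by (simp add: killing_def bracket_bracket bracket_simps trace_diff)
qed

lemma killing_span_zero:
  assumes "y \<in> span S" "\<And>s. s \<in> S \<Longrightarrow> killing x s = 0"
  shows "killing x y = 0"
  using assms(1) by (induction rule: span_induct_alt)
    (simp_all add: assms(2) killing_add_right killing_scale_right)

text \<open>The product of a nilpotent operator and one that commutes with it is nilpotent.\<close>

lemma killing_nilpotent_commuting:
  assumes "nilspace (bracket n) = UNIV" "bracket n y = 0"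
  shows "killing n y = 0"
proof -
  have "bracket n (bracket y v) = bracket y (bracket n v)" for v
    using bracket_bracket[of n y v] assms(2) by simp
  then have "nilspace (\<lambda>v. bracket n (bracket y v)) = UNIV"
    by (rule nilspace_comp_commuting[OF lin_ad lin_ad _ assms(1)])
  then show ?thesis unfolding killing_def
    by (rule trace_nilpotent[OF lin_comp[OF lin_ad lin_ad]])
qed

text \<open>
  Let \<open>D\<close> be the complex conjugate of the semisimple part of \<open>ad x\<close>; it is a derivation. If \<open>x\<close> is
  a sum of brackets \<open>[a, b]\<close>, then cyclicity turns the trace of \<open>ad x \<circ> D\<close> into a sum of terms
  \<open>tr (ad a \<circ> ad (D b))\<close>. So \<open>x\<close> is nilpotent as soon as these vanish. This single criterion gives
  Cartan's criterion, the commutativity of Cartan subalgebras, \<open>\<alpha> ([e, f]) \<noteq> 0\<close> for paired root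
  vectors, and the nilpotency of root vectors.
\<close>

lemma ad_nilpotent_criterion:
  assumes x: "x \<in> commutator P Q"
    and D: "lin D" "\<And>c v. v \<in> gen_eigenspace (bracket x) c \<Longrightarrow> D v = cnj c *s v"
    and tr: "\<And>a b. a \<in> P \<Longrightarrow> b \<in> Q \<Longrightarrow> killing a (D b) = 0"
  shows "nilspace (bracket x) = UNIV"
proof (rule nilpotent_if_trace_conj_zero[OF lin_ad D])
  have der: "D (bracket u v) = bracket (D u) v + bracket u (D v)" for u v
    by (rule eigenvalue_calculus_derivation[where x = x and \<phi> = cnj, OF D]) auto
  have "trace (\<lambda>v. bracket y (D v)) = 0" if "y \<in> commutator P Q" for y
    using that unfolding commutator_def
  proof (induction rule: span_induct_alt)
    case base then show ?case by (simp add: trace_zero)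
  next
    case (step c s y)
    then obtain a b where ab: "s = bracket a b" "a \<in> P" "b \<in> Q" by blast
    have "trace (\<lambda>v. bracket b (bracket a (D v))) = trace (\<lambda>v. bracket a (D (bracket b v)))"
      by (rule trace_comm[OF lin_ad lin_comp[OF lin_ad D(1)]])
    also have "\<dots> = trace (\<lambda>v. bracket a (bracket (D b) v) + bracket a (bracket b (D v)))"
      by (simp add: der bracket_simps)
    also have "\<dots> = trace (\<lambda>v. bracket a (bracket b (D v)))"
      using tr[OF ab(2,3)] by (simp add: trace_add killing_def)
    finally have "trace (\<lambda>v. bracket s (D v)) = 0"
      by (simp add: ab bracket_bracket trace_diff)
    then show ?case using step by (simp add: bracket_simps trace_add trace_scale)
  qed
  then show "trace (\<lambda>v. bracket x (D v)) = 0" using x by blast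
qed

lemma conj_part_exists:
  "\<exists>D. lin D \<and> (\<forall>c. \<forall>v\<in>gen_eigenspace (bracket x) c. D v = cnj c *s v)"
  by (rule eigenvalue_calculus[OF lin_ad])

lemma dim_psubset_subspace:
  assumes "subspace S" "subspace T" "S \<subset> T" shows "dim S < dim T"
  using dim_psubset[of S T] assms by (simp add: span_eq_iff[THEN iffD2])

lemma stable_extension:
  assumes U: "subspace U" "\<And>y u. y \<in> L \<Longrightarrow> u \<in> U \<Longrightarrow> bracket y u \<in> U"
    and w: "\<And>y. y \<in> L \<Longrightarrow> bracket y w \<in> U"
  shows "y \<in> L \<Longrightarrow> v \<in> span (insert w U) \<Longrightarrow> bracket y v \<in> U"
  by (rule span_bracket_in[OF U(1), of _ "insert w U"]) (use U(2) w in auto)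

text \<open>
  Engel's theorem, in the form of a fixed vector of \<open>W / U\<close>. The induction enlarges a maximal proper
  subalgebra \<open>K\<close> of \<open>L\<close> by an element \<open>x\<close> that normalizes it, which is a fixed vector of \<open>L / K\<close>.
\<close>

lemma engel:
  assumes "lie_subalgebra L" "subspace W" "subspace U" "U \<subset> W"
    and "\<And>x w. x \<in> L \<Longrightarrow> w \<in> W \<Longrightarrow> bracket x w \<in> W"
    and "\<And>x u. x \<in> L \<Longrightarrow> u \<in> U \<Longrightarrow> bracket x u \<in> U"
    and "\<And>x. x \<in> L \<Longrightarrow> W \<subseteq> nilspace (bracket x)"
    and "\<And>x. x \<in> L \<Longrightarrow> L \<subseteq> nilspace (bracket x)"
  shows "\<exists>w\<in>W - U. \<forall>x\<in>L. bracket x w \<in> U"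
  using assms
proof (induction "dim L" arbitrary: L W U rule: less_induct)
  case less
  note L = lie_subalgebraD[OF less.prems(1)]
  show ?case
  proof (cases "L = {0}")
    case True
    then show ?thesis using less.prems(3,4) subspace_0 by auto
  next
    case False
    let ?Q = "\<lambda>K. lie_subalgebra K \<and> K \<subset> L"
    have "?Q {0}" using False L(1) subspace_0[OF L(1)] by (auto simp: lie_subalgebra_def)
    moreover have "\<forall>K. ?Q K \<longrightarrow> dim K < Suc (dim L)" using dim_subset by (auto simp: less_Suc_eq_le)
    ultimately obtain K where K: "?Q K" "\<And>K'. ?Q K' \<Longrightarrow> dim K' \<le> dim K"
      using ex_has_greatest_nat[of ?Q "{0}" dim "Suc (dim L)"] by blast
    note Ks = lie_subalgebraD[OF conjunct1[OF K(1)]]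
    have KL: "K \<subseteq> L" using K(1) by blast
    have dimK: "dim K < dim L" using K(1) L(1) Ks(1) by (intro dim_psubset_subspace) auto
    have "\<exists>x\<in>L - K. \<forall>k\<in>K. bracket k x \<in> K"
    proof (rule less.hyps[OF dimK])
      show "lie_subalgebra K" "subspace L" "subspace K" "K \<subset> L" using K(1) L Ks by auto
      show "bracket y w \<in> L" if "y \<in> K" "w \<in> L" for y w using that KL L(2) by blast
      show "bracket y u \<in> K" if "y \<in> K" "u \<in> K" for y u using that by (rule Ks(2))
      show "L \<subseteq> nilspace (bracket y)" if "y \<in> K" for y using that KL less.prems(8) by blast
      then show "K \<subseteq> nilspace (bracket y)" if "y \<in> K" for y using that KL by blast
    qed
    then obtain x where x: "x \<in> L" "x \<notin> K" "\<And>k. k \<in> K \<Longrightarrow> bracket k x \<in> K" by blast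
    let ?K' = "span (insert x K)"
    have K'L: "?K' \<subseteq> L" using x KL L(1) by (intro span_minimal) auto
    have "bracket y v \<in> ?K'" if "y \<in> ?K'" "v \<in> ?K'" for y v
    proof -
      have k: "bracket k v \<in> K" if "k \<in> K" for k
        by (rule stable_extension[OF Ks(1,2) x(3) that \<open>v \<in> ?K'\<close>])
      have "bracket x k \<in> K" if "k \<in> K" for k
        using x(3)[OF that] bracket_antisym[of x k] subspace_neg[OF Ks(1)] by simp
      then have xv: "bracket x v \<in> K"
        by (intro span_bracket_in[OF Ks(1) that(2)]) (auto simp: bracket_self subspace_0[OF Ks(1)])
      have "bracket v y \<in> K"
        using k xv bracket_antisym[of v] subspace_neg[OF Ks(1)]
        by (intro span_bracket_in[OF Ks(1) that(1)]) auto
      then have "bracket y v \<in> K" using bracket_antisym[of y v] subspace_neg[OF Ks(1)] by simp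
      then show ?thesis by (simp add: span_base)
    qed
    then have K'sub: "lie_subalgebra ?K'" by (simp add: lie_subalgebra_def)
    have KK': "K \<subset> ?K'" using x(2) span_superset by blast
    have "?K' = L"
    proof (rule ccontr)
      assume "?K' \<noteq> L"
      then have "dim ?K' \<le> dim K" using K(2) K'sub K'L by blast
      moreover have "dim K < dim ?K'" by (rule dim_psubset_subspace[OF Ks(1) subspace_span KK'])
      ultimately show False by simp
    qed
    have "\<exists>w\<in>W - U. \<forall>k\<in>K. bracket k w \<in> U"
    proof (rule less.hyps[OF dimK])
      show "lie_subalgebra K" "subspace W" "subspace U" "U \<subset> W" using K(1) less.prems by auto
      show "bracket y w \<in> W" if "y \<in> K" "w \<in> W" for y w using that KL less.prems(5) by blast
      show "bracket y u \<in> U" if "y \<in> K" "u \<in> U" for y u using that KL less.prems(6) by blast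
      show "W \<subseteq> nilspace (bracket y)" if "y \<in> K" for y using that KL less.prems(7) by blast
      show "K \<subseteq> nilspace (bracket y)" if "y \<in> K" for y using that KL less.prems(8) by blast
    qed
    then obtain w0 where w0: "w0 \<in> W" "w0 \<notin> U" "\<And>k. k \<in> K \<Longrightarrow> bracket k w0 \<in> U" by blast
    have wm: "(bracket x ^^ m) w0 \<in> W \<and> (\<forall>k\<in>K. bracket k ((bracket x ^^ m) w0) \<in> U)" for m
    proof (induction m)
      case 0 then show ?case using w0 by simp
    next
      case (Suc m)
      let ?w = "(bracket x ^^ m) w0"
      have "bracket k (bracket x ?w) \<in> U" if k: "k \<in> K" for k
      proof -
        have "bracket k (bracket x ?w) = bracket (bracket k x) ?w + bracket x (bracket k ?w)"
          by (rule ad_derivation)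
        also have "\<dots> \<in> U" 
          using Suc x(3)[OF k] k less.prems(6)[OF x(1)] less.prems(3) by (intro subspace_add) blast+
        finally show ?thesis .
      qed
      then show ?case using Suc less.prems(5)[OF x(1)] by auto
    qed
    \<comment> \<open>The last iterate of \<open>w0\<close> under \<open>ad x\<close> outside \<open>U\<close> is fixed by \<open>K\<close> and by \<open>x\<close>.\<close>
    obtain M where "(bracket x ^^ M) w0 = 0"
      using less.prems(7)[OF x(1)] w0(1) unfolding nilspace_def by auto
    then have ex: "\<exists>m. (bracket x ^^ m) w0 \<in> U" using subspace_0[OF less.prems(3)] by metis
    define m where "m = (LEAST m. (bracket x ^^ m) w0 \<in> U)"
    have mU: "(bracket x ^^ m) w0 \<in> U" unfolding m_def using ex by (rule LeastI_ex)
    then have "m \<noteq> 0" using w0(2) by (metis funpow_0)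
    then obtain j where j: "m = Suc j" by (cases m) auto
    let ?w = "(bracket x ^^ j) w0"
    have "?w \<notin> U" using not_less_Least[of j "\<lambda>m. (bracket x ^^ m) w0 \<in> U"] j m_def by auto
    moreover have "bracket x ?w \<in> U" using mU j by simp
    moreover have "bracket y ?w \<in> U" if "y \<in> L" for y
    proof -
      have "bracket ?w y \<in> U"
      proof (rule span_bracket_in[OF less.prems(3)])
        show "y \<in> span (insert x K)" using \<open>?K' = L\<close> that by simp
        show "bracket ?w s \<in> U" if "s \<in> insert x K" for s
          using that wm \<open>bracket x ?w \<in> U\<close> bracket_antisym[of ?w s] subspace_neg[OF less.prems(3)] by auto
      qed
      then show ?thesis using bracket_antisym[of y ?w] subspace_neg[OF less.prems(3)] by simp
    qed
    ultimately show ?thesis using wm by blast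
  qed
qed

text \<open>
  Engel's theorem for a maximal proper submodule \<open>U\<close> of \<open>s\<close> gives \<open>[s, s] \<subseteq> U\<close>.
\<close>

lemma nilpotent_not_perfect:
  assumes s: "lie_subalgebra s" and nil: "\<And>x. x \<in> s \<Longrightarrow> s \<subseteq> nilspace (bracket x)" and "s \<noteq> {0}"
  shows "commutator s s \<subset> s"
proof -
  note ss = lie_subalgebraD[OF s]
  let ?Q = "\<lambda>U. subspace U \<and> (\<forall>y\<in>s. \<forall>u\<in>U. bracket y u \<in> U) \<and> U \<subset> s"
  have "?Q {0}" using assms(3) subspace_0[OF ss(1)] by auto
  moreover have "\<forall>U. ?Q U \<longrightarrow> dim U < Suc (dim s)" using dim_subset by (auto simp: less_Suc_eq_le)
  ultimately obtain U where U: "?Q U" "\<And>U'. ?Q U' \<Longrightarrow> dim U' \<le> dim U"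
    using ex_has_greatest_nat[of ?Q "{0}" dim "Suc (dim s)"] by blast
  have "\<exists>w\<in>s - U. \<forall>x\<in>s. bracket x w \<in> U"
  proof (rule engel[OF s ss(1)])
    show "subspace U" "U \<subset> s" using U(1) by auto
    show "bracket x u \<in> U" if "x \<in> s" "u \<in> U" for x u using that U(1) by blast
  qed (use ss nil in auto)
  then obtain w where w: "w \<in> s" "w \<notin> U" "\<And>x. x \<in> s \<Longrightarrow> bracket x w \<in> U" by blast
  let ?U' = "span (insert w U)"
  have st: "bracket y v \<in> U" if "y \<in> s" "v \<in> ?U'" for y v
    by (rule stable_extension[OF _ _ _ that]) (use U w in auto)
  have UU': "U \<subset> ?U'" using w(2) span_superset by blast
  have "?U' \<subseteq> s" using w U ss(1) by (intro span_minimal) auto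
  have "?U' = s"
  proof (rule ccontr)
    assume "?U' \<noteq> s"
    then have "?Q ?U'" using \<open>?U' \<subseteq> s\<close> st UU' by auto
    then have "dim ?U' \<le> dim U" by (rule U(2))
    moreover have "dim U < dim ?U'" using U(1) UU' by (intro dim_psubset_subspace) auto
    ultimately show False by simp
  qed
  then have "commutator s s \<subseteq> U" using st U(1) by (intro commutator_subset) auto
  then show ?thesis using U(1) by blast
qed

lemma eigenvalue_calculus_stable:
  assumes D: "lin D" "\<And>c v. v \<in> gen_eigenspace A c \<Longrightarrow> D v = \<phi> c *s v"
    and A: "lin A" and W: "subspace W" "\<And>w. w \<in> W \<Longrightarrow> A w \<in> W" and w: "w \<in> W"
  shows "D w \<in> W"
proof -
  have "w \<in> span (W \<inter> (\<Union>c. gen_eigenspace A c))"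
    using stable_subspace_gen_eigenspaces[OF A W] w by blast
  then show ?thesis
  proof (induction rule: span_induct_alt)
    case base then show ?case using lp.linear_0[OF D(1)] subspace_0[OF W(1)] by simp
  next
    case (step c s y)
    then have "D s \<in> W" using D(2) W(1) by (auto simp: subspace_scale)
    then show ?case using step W(1)
      by (simp add: lp.linear_add[OF D(1)] lp.linear_scale[OF D(1)] subspace_add subspace_scale)
  qed
qed

text \<open>
  Cartan's criterion. Let \<open>r\<close> be the radical of the trace form on \<open>l\<close>. Complete reducibility makes
  \<open>[r, r]\<close> perfect, and \<open>ad_nilpotent_criterion\<close> applies to all its elements; so \<open>[r, r]\<close> vanishes
  by Engel's theorem, and \<open>r\<close> is an abelian direct factor of \<open>l\<close>.
\<close>

lemma trace_form_radical_central:
  assumes l: "lie_subalgebra l" and red: "reductive_in_ambient l"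
    and x: "x \<in> l" "\<And>y. y \<in> l \<Longrightarrow> killing x y = 0" and y: "y \<in> l"
  shows "bracket x y = 0"
proof -
  note ls = lie_subalgebraD[OF l]
  define r where "r = {x\<in>l. \<forall>y\<in>l. killing x y = 0}"
  have r: "subspace r" unfolding r_def
    using ls(1) by (intro subspaceI) (auto simp: killing_add_left killing_scale_left
        intro: subspace_0 subspace_add subspace_scale)
  have rl: "r \<subseteq> l" unfolding r_def by auto
  have rideal: "bracket y x \<in> r" if "y \<in> l" "x \<in> r" for x y
    using that ls unfolding r_def by (auto simp: killing_invariant)
  define s where "s = commutator r r"
  have s: "subspace s" unfolding s_def by (rule subspace_commutator)
  have sr: "s \<subseteq> r" unfolding s_def
    by (rule commutator_subset[OF r]) (use rideal rl in blast)
  have sideal: "bracket y x \<in> s" if y: "y \<in> l" and x: "x \<in> s" for x y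
  proof (rule span_bracket_in[OF s])
    show "x \<in> span {bracket x y |x y. x \<in> r \<and> y \<in> r}" using x unfolding s_def commutator_def .
    show "bracket y z \<in> s" if z: "z \<in> {bracket x y |x y. x \<in> r \<and> y \<in> r}" for z
    proof -
      obtain a b where ab: "z = bracket a b" "a \<in> r" "b \<in> r" using z by blast
      have "bracket (bracket y a) b \<in> s" "bracket a (bracket y b) \<in> s"
        unfolding s_def by (rule bracket_in_commutator, rule rideal[OF y ab(2)], rule ab(3))
          (rule bracket_in_commutator, rule ab(2), rule rideal[OF y ab(3)])
      then have "bracket (bracket y a) b + bracket a (bracket y b) \<in> s" by (rule subspace_add[OF s])
      then show ?thesis by (simp only: ab(1) ad_derivation[of y a b])
    qed
  qed
  obtain J where J: "subspace J" "\<forall>x\<in>l. \<forall>y\<in>J. bracket x y \<in> J"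
    "\<forall>x\<in>l. \<exists>a\<in>s. \<exists>b\<in>J. x = a + b" "s \<inter> J = {0}"
    using reductive_complement[OF red l s subset_trans[OF sr rl] sideal] by auto
  have rJ: "bracket a b = 0" if "a \<in> r" "b \<in> r" "b \<in> J" for a b
  proof -
    have "bracket a b \<in> s" unfolding s_def using that by (intro bracket_in_commutator)
    moreover have "bracket a b \<in> J" using that J(2) rl by blast
    ultimately show ?thesis using J(4) by blast
  qed
  have perfect: "s \<subseteq> commutator s s"
    unfolding s_def
  proof (rule commutator_subset[OF subspace_commutator])
    fix a b assume ab: "a \<in> r" "b \<in> r"
    have dec: "\<exists>c\<in>s. \<exists>d\<in>r \<inter> J. a = c + d" if "a \<in> r" for a
    proof -
      obtain c d where cd: "c \<in> s" "d \<in> J" "a = c + d" using J(3) \<open>a \<in> r\<close> rl by blast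
      then have "d = a - c" by simp
      moreover have "a - c \<in> r" by (rule subspace_diff[OF r that]) (use cd sr in blast)
      ultimately have "d \<in> r" by simp
      then show ?thesis using cd by blast
    qed
    obtain c d where cd: "c \<in> s" "d \<in> r" "d \<in> J" "a = c + d" using dec[OF ab(1)] by blast
    obtain c' d' where cd': "c' \<in> s" "d' \<in> r" "d' \<in> J" "b = c' + d'" using dec[OF ab(2)] by blast
    have "bracket a d' = 0" "bracket d c' = 0"
      using rJ[OF ab(1) cd'(2,3)] rJ[of c' d] cd cd' sr bracket_antisym[of d c'] by auto
    then have "bracket a b = bracket c c'" using cd(4) cd'(4) by (simp add: bracket_simps)
    then show "bracket a b \<in> commutator (commutator r r) (commutator r r)"
      using cd(1) cd'(1) unfolding s_def by (simp add: bracket_in_commutator)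
  qed
  have nil: "nilspace (bracket x) = UNIV" if x: "x \<in> s" for x
  proof -
    obtain D where D: "lin D" "\<And>c v. v \<in> gen_eigenspace (bracket x) c \<Longrightarrow> D v = cnj c *s v"
      using conj_part_exists by blast
    have "x \<in> commutator s s" using perfect x by blast
    then show ?thesis
    proof (rule ad_nilpotent_criterion[OF _ D])
      fix a b assume ab: "a \<in> s" "b \<in> s"
      have "D b \<in> l"
      proof (rule eigenvalue_calculus_stable[OF D lin_ad ls(1)])
        show "b \<in> l" using ab sr rl by blast
        show "bracket x w \<in> l" if "w \<in> l" for w using that x sr rl ls(2) by blast
      qed
      then show "killing a (D b) = 0" using ab sr unfolding r_def by blast
    qed
  qed
  have "s = {0}"
  proof (rule ccontr)
    assume "s \<noteq> {0}"
    moreover have "lie_subalgebra s" using s sideal sr rl unfolding lie_subalgebra_def by blast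
    ultimately have "commutator s s \<subset> s" using nilpotent_not_perfect nil by blast
    then show False using perfect by blast
  qed
  then have rr: "bracket a b = 0" if "a \<in> r" "b \<in> r" for a b
    using that bracket_in_commutator[of a r b r] unfolding s_def by blast
  obtain J where J: "subspace J" "\<forall>x\<in>l. \<forall>y\<in>J. bracket x y \<in> J"
    "\<forall>x\<in>l. \<exists>a\<in>r. \<exists>b\<in>J. x = a + b" "r \<inter> J = {0}"
    using reductive_complement[OF red l r rl rideal] by auto
  obtain a b where ab: "a \<in> r" "b \<in> J" "y = a + b" using J(3) y by blast
  have xr: "x \<in> r" using x unfolding r_def by blast
  have "b = y - a" using ab by simp
  moreover have "y - a \<in> l" by (rule subspace_diff[OF ls(1) y]) (use ab rl in blast)
  ultimately have bl: "b \<in> l" by simp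
  have "bracket x b \<in> J" using J(2) x ab by blast
  moreover have "bracket x b \<in> r"
    using rideal[OF bl xr] bracket_antisym[of x b] subspace_neg[OF r] by simp
  ultimately have "bracket x b = 0" using J(4) by blast
  then show ?thesis using rr[OF xr ab(1)] ab(3) by (simp add: bracket_simps)
qed

lemma killing_radical_inter_derived:
  assumes red: "reductive_in_ambient UNIV" 
    and x: "x \<in> commutator UNIV UNIV" "\<And>y. killing x y = 0"
  shows "x = 0"
proof (rule center_inter_derived[OF red x(1)])
  show "bracket x y = 0" for y
    by (rule trace_form_radical_central[OF _ red]) (use x in \<open>auto simp: lie_subalgebra_def\<close>)
qed

end

section \<open>Cartan subalgebras and root spaces\<close>

locale reductive_lie = complex_lie scale Basis bracket
  for scale :: "complex \<Rightarrow> 'a::ab_group_add \<Rightarrow> 'a" (infixr "*s" 75)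
    and Basis :: "'a set" and bracket :: "'a \<Rightarrow> 'a \<Rightarrow> 'a" +
  fixes h :: "'a set"
  assumes reductive: "reductive_in_ambient UNIV"
    and cartan: "cartan_subalgebra h"
begin

lemma lie_subalgebra_h: "lie_subalgebra h"
  using cartan unfolding cartan_subalgebra_def by blast

lemmas h_sub = lie_subalgebraD[OF lie_subalgebra_h]

lemma lie_subalgebra_UNIV: "lie_subalgebra UNIV" by (simp add: lie_subalgebra_def)

lemma self_normalizing: assumes "\<And>y. y \<in> h \<Longrightarrow> bracket x y \<in> h" shows "x \<in> h"
proof -
  have "x \<in> lie_normalizer h" using assms unfolding lie_normalizer_def by blast
  then show ?thesis using cartan unfolding cartan_subalgebra_def by simp
qed

lemma centralizer_in_h: assumes "\<And>y. y \<in> h \<Longrightarrow> bracket y x = 0" shows "x \<in> h"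
proof (rule self_normalizing)
  fix y assume "y \<in> h"
  then show "bracket x y \<in> h"
    using assms[of y] bracket_antisym[of x y] subspace_0[OF h_sub(1)] by simp
qed

lemma gen_eigenspace_zero: "gen_eigenspace A 0 = nilspace A"
  by (simp add: gen_eigenspace_def)

lemma ad_h_nilpotent: assumes "x \<in> h" shows "h \<subseteq> nilspace (bracket x)"
proof
  fix y assume y: "y \<in> h"
  obtain k where k: "(commutator h ^^ k) h = {0}"
    using cartan unfolding cartan_subalgebra_def lie_nilpotent_def by blast
  have "(bracket x ^^ j) y \<in> (commutator h ^^ j) h" for j
    using y assms by (induction j) (auto intro: bracket_in_commutator)
  from this[of k] show "y \<in> nilspace (bracket x)" unfolding k nilspace_def by auto
qed

text \<open>
  Fitting decomposition: a minimal \<open>h\<close>-stable \<open>W \<supseteq> h\<close> with \<open>W + [h, g] = g\<close> is acted on nilpotently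
  by \<open>h\<close>, so Engel's theorem gives a vector normalizing \<open>h\<close> unless \<open>W = h\<close>.
\<close>

lemma span_h_bracket: "span (h \<union> {bracket z u |z u. z \<in> h}) = UNIV"
proof -
  let ?B = "{bracket z u |z u. z \<in> h}"
  let ?Q = "\<lambda>W. subspace W \<and> h \<subseteq> W \<and> (\<forall>y\<in>h. \<forall>w\<in>W. bracket y w \<in> W) \<and> span (W \<union> ?B) = UNIV"
  have "?Q UNIV" by simp
  then obtain W where W: "?Q W" "\<And>W'. ?Q W' \<Longrightarrow> dim W \<le> dim W'"
    using ex_has_least_nat[of ?Q UNIV dim] by blast
  have nil: "W \<subseteq> nilspace (bracket z)" if z: "z \<in> h" for z
  proof -
    let ?W0 = "W \<inter> nilspace (bracket z)"
    have W0: "subspace ?W0" using W(1) subspace_nilspace[OF lin_ad] by (intro subspace_inter) auto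
    have st: "bracket y w \<in> ?W0" if "y \<in> h" "w \<in> ?W0" for y w
    proof -
      have "y \<in> gen_eigenspace (bracket z) 0" "w \<in> gen_eigenspace (bracket z) 0"
        using that ad_h_nilpotent[OF z] by (auto simp: gen_eigenspace_zero)
      from gen_eigenspace_bracket[OF this] show ?thesis
        using that W(1) by (simp add: gen_eigenspace_zero)
    qed
    have "W \<inter> (\<Union>c. gen_eigenspace (bracket z) c) \<subseteq> span (?W0 \<union> ?B)"
    proof
      fix v assume v: "v \<in> W \<inter> (\<Union>c. gen_eigenspace (bracket z) c)"
      then obtain c where c: "v \<in> gen_eigenspace (bracket z) c" by blast
      show "v \<in> span (?W0 \<union> ?B)"
      proof (cases "c = 0")
        case True
        then have "v \<in> ?W0" using c v by (simp add: gen_eigenspace_zero)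
        then show ?thesis by (intro span_base) blast
      next
        case False
        then obtain u where "v = bracket z u" using gen_eigenspace_in_range[OF lin_ad c] by blast
        then show ?thesis using z by (intro span_base) blast
      qed
    qed
    then have "span (W \<inter> (\<Union>c. gen_eigenspace (bracket z) c)) \<subseteq> span (?W0 \<union> ?B)"
      by (rule span_minimal) simp
    moreover have "W \<subseteq> span (W \<inter> (\<Union>c. gen_eigenspace (bracket z) c))"
      by (rule stable_subspace_gen_eigenspaces[OF lin_ad]) (use W(1) z in auto)
    ultimately have "W \<subseteq> span (?W0 \<union> ?B)" by (rule subset_trans[rotated])
    moreover have "?B \<subseteq> span (?W0 \<union> ?B)" by (rule subset_trans[OF Un_upper2 span_superset])
    ultimately have "W \<union> ?B \<subseteq> span (?W0 \<union> ?B)" by (rule Un_least)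
    then have "span (W \<union> ?B) \<subseteq> span (?W0 \<union> ?B)" by (rule span_minimal) simp
    then have "span (?W0 \<union> ?B) = UNIV" using W(1) by auto
    then have "?Q ?W0" using W0 st W(1) ad_h_nilpotent[OF z] by auto
    then have "dim W \<le> dim ?W0" by (rule W(2))
    then have "?W0 = W" using W0 W(1) by (intro subspace_dim_equal) auto
    then show ?thesis by blast
  qed
  have "W = h"
  proof (rule ccontr)
    assume "W \<noteq> h"
    have "\<exists>w\<in>W - h. \<forall>x\<in>h. bracket x w \<in> h"
    proof (rule engel[OF lie_subalgebra_h])
      show "subspace W" "subspace h" "h \<subset> W" using W(1) h_sub \<open>W \<noteq> h\<close> by auto
      show "bracket x w \<in> W" if "x \<in> h" "w \<in> W" for x w using W(1) that by blast
    qed (use h_sub nil ad_h_nilpotent in auto)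
    then obtain w where w: "w \<notin> h" "\<And>x. x \<in> h \<Longrightarrow> bracket x w \<in> h" by blast
    have "w \<in> h"
    proof (rule self_normalizing)
      fix y assume "y \<in> h"
      then show "bracket w y \<in> h"
        using w(2)[of y] bracket_antisym[of w y] subspace_neg[OF h_sub(1)] by simp
    qed
    then show False using w(1) by blast
  qed
  then show ?thesis using W(1) by simp
qed

lemma killing_eq_zero_if_on_h:
  assumes "\<And>z. z \<in> h \<Longrightarrow> bracket z n = 0" "\<And>y. y \<in> h \<Longrightarrow> killing n y = 0"
  shows "killing n y = 0"
proof (rule killing_span_zero)
  show "y \<in> span (h \<union> {bracket z u |z u. z \<in> h})" using span_h_bracket by simp
  show "killing n s = 0" if "s \<in> h \<union> {bracket z u |z u. z \<in> h}" for s
    using that assms killing_comm[of n s] by (auto simp: killing_invariant)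
qed

text \<open>
  A nonzero central element of \<open>h\<close> in \<open>[h, h]\<close> would be nilpotent, hence orthogonal to \<open>h\<close>, hence
  in the radical of the trace form, because it is also orthogonal to \<open>[h, g]\<close>.
\<close>

lemma h_abelian: assumes "x \<in> h" "y \<in> h" shows "bracket x y = 0"
proof (rule ccontr)
  assume nz: "bracket x y \<noteq> 0"
  let ?C = "\<lambda>k. (commutator h ^^ k) h"
  obtain k0 where "?C k0 = {0}"
    using cartan unfolding cartan_subalgebra_def lie_nilpotent_def by blast
  define k where "k = (LEAST k. ?C k = {0})"
  have k: "?C k = {0}" unfolding k_def using \<open>?C k0 = {0}\<close> by (rule LeastI)
  have lt: "?C j \<noteq> {0}" if "j < k" for j using that not_less_Least unfolding k_def by blast
  have sub: "subspace (?C j) \<and> ?C j \<subseteq> h" for j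
  proof (induction j)
    case (Suc j)
    have "commutator h (?C j) \<subseteq> h"
      by (rule commutator_subset[OF h_sub(1)]) (use Suc h_sub(2) in blast)
    then show ?case by (simp add: subspace_commutator)
  qed (simp add: h_sub)
  have "k \<noteq> 0" using k nz assms by (cases k) auto
  moreover have "k \<noteq> 1"
  proof
    assume "k = 1"
    then have "commutator h h = {0}" using k by simp
    then show False using nz bracket_in_commutator[OF assms] by simp
  qed
  ultimately obtain j where j: "k = Suc (Suc j)" by (metis One_nat_def not0_implies_Suc)
  have "?C (Suc j) \<noteq> {0}" using lt[of "Suc j"] j by simp
  then obtain n where n: "n \<in> ?C (Suc j)" "n \<noteq> 0" using sub[of "Suc j"] subspace_0 by blast
  have nh: "n \<in> commutator h h" using n(1) sub[of j] commutator_mono[of h h "?C j" h] by auto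
  have cen: "bracket z n = 0" if "z \<in> h" for z
    using bracket_in_commutator[OF that n(1)] k j by auto
  obtain D where D: "lin D" "\<And>c v. v \<in> gen_eigenspace (bracket n) c \<Longrightarrow> D v = cnj c *s v"
    using conj_part_exists by blast
  have nil: "nilspace (bracket n) = UNIV"
  proof (rule ad_nilpotent_criterion[OF nh D])
    fix a b assume "b \<in> h"
    then have "bracket n b = 0" using cen bracket_antisym[of n b] by simp
    then have "b \<in> gen_eigenspace (bracket n) 0"
      unfolding gen_eigenspace_zero nilspace_def by (auto intro: exI[of _ 1])
    then show "killing a (D b) = 0" using D(2) by simp
  qed
  have "n = 0"
  proof (rule killing_radical_inter_derived[OF reductive])
    show "n \<in> commutator UNIV UNIV" using nh commutator_mono[of h UNIV h UNIV] by blast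
    show "killing n y = 0" for y
    proof (rule killing_eq_zero_if_on_h[OF cen])
      fix y assume "y \<in> h"
      then show "killing n y = 0"
        using killing_nilpotent_commuting[OF nil] cen bracket_antisym[of n y] by simp
    qed
  qed
  then show False using n(2) by simp
qed

text \<open>
  The nilpotent part \<open>N\<close> of \<open>ad x\<close> is a derivation that vanishes on \<open>h\<close>, and \<open>tr (N \<circ> ad y) = 0\<close> for
  all \<open>y\<close>; hence its values lie in the radical of the trace form. They also lie in the derived algebra,
  so they vanish.
\<close>

lemma h_diagonalizable:
  assumes x: "x \<in> h" and v: "v \<in> gen_eigenspace (bracket x) c"
  shows "bracket x v = c *s v"
proof -
  obtain S where S: "lin S" "\<And>c v. v \<in> gen_eigenspace (bracket x) c \<Longrightarrow> S v = c *s v"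
    using eigenvalue_calculus[OF lin_ad, of x "\<lambda>c. c"] by blast
  have Sder: "S (bracket u v) = bracket (S u) v + bracket u (S v)" for u v
    by (rule eigenvalue_calculus_derivation[where x = x and \<phi> = "\<lambda>c. c", OF S]) auto
  define N where "N v = bracket x v - S v" for v
  have N_eta: "N = (\<lambda>v. bracket x v - S v)" by (rule ext) (simp add: N_def)
  have linN: "lin N" unfolding N_eta by (rule lin_diff[OF lin_ad S(1)])
  have nilN: "nilspace N = UNIV" unfolding N_eta by (rule nilpotent_part[OF lin_ad S])
  have Nder: "N (bracket u v) = bracket (N u) v + bracket u (N v)" for u v
    unfolding N_def Sder ad_derivation[of x u v] by (simp add: bracket_simps algebra_simps)
  have Nh: "N b = 0" if "b \<in> h" for b
  proof -
    have "bracket x b = 0" using h_abelian x that by blast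
    moreover have "b \<in> gen_eigenspace (bracket x) 0"
      using ad_h_nilpotent[OF x] that by (auto simp: gen_eigenspace_zero)
    ultimately show ?thesis using S(2) by (simp add: N_def)
  qed
  have tr: "trace (\<lambda>v. N (bracket y v)) = 0" for y
  proof -
    have "y \<in> span (h \<union> {bracket z u |z u. z \<in> h})" using span_h_bracket by simp
    then show ?thesis
    proof (induction rule: span_induct_alt)
      case base then show ?case using lp.linear_0[OF linN] by (simp add: trace_zero)
    next
      case (step c s y)
      have "trace (\<lambda>v. N (bracket s v)) = 0"
      proof (cases "s \<in> h")
        case True
        have "N (bracket s v) = bracket s (N v)" for v using Nder Nh[OF True] by simp
        then have "nilspace (\<lambda>v. N (bracket s v)) = UNIV"
          by (rule nilspace_comp_commuting[OF linN lin_ad _ nilN])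
        then show ?thesis by (rule trace_nilpotent[OF lin_comp[OF linN lin_ad]])
      next
        case False
        then obtain z u where zu: "s = bracket z u" "z \<in> h" using step by blast
        have "trace (\<lambda>v. N (bracket u (bracket z v))) = trace (\<lambda>v. bracket z (N (bracket u v)))"
          by (rule trace_comm[OF lin_comp[OF linN lin_ad] lin_ad])
        also have "\<dots> = trace (\<lambda>v. N (bracket z (bracket u v)))"
          using Nder[of z] Nh[OF zu(2)] by simp
        finally show ?thesis
          by (simp add: zu bracket_bracket lp.linear_diff[OF linN] trace_diff)
      qed
      then show ?case using step
        by (simp add: bracket_simps lp.linear_add[OF linN] lp.linear_scale[OF linN] trace_add trace_scale)
    qed
  qed
  have rad: "killing (N u) v = 0" for u v
  proof -
    have "trace (\<lambda>w. bracket u (N (bracket v w))) = trace (\<lambda>w. N (bracket v (bracket u w)))"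
      by (rule trace_comm[OF lin_ad lin_comp[OF linN lin_ad]])
    moreover have "bracket (N u) w = N (bracket u w) - bracket u (N w)" for w
      using Nder by simp
    ultimately have "killing (N u) v =
        trace (\<lambda>w. N (bracket u (bracket v w))) - trace (\<lambda>w. N (bracket v (bracket u w)))"
      by (simp add: killing_def trace_diff)
    also have "\<dots> = trace (\<lambda>w. N (bracket (bracket u v) w))"
      by (simp add: bracket_bracket lp.linear_diff[OF linN] trace_diff)
    finally show ?thesis using tr by simp
  qed
  have "v \<in> commutator UNIV UNIV" if c0: "c \<noteq> 0"
  proof -
    obtain u where "v = bracket x u" using gen_eigenspace_in_range[OF lin_ad v c0] by blast
    then show ?thesis by (simp add: bracket_in_commutator)
  qed
  then have "c *s v \<in> commutator UNIV UNIV"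
    using subspace_scale[OF subspace_commutator] subspace_0[OF subspace_commutator] by (cases "c = 0") auto
  then have "N v \<in> commutator UNIV UNIV"
    unfolding N_def S(2)[OF v] by (intro subspace_diff subspace_commutator bracket_in_commutator) auto
  then have "N v = 0" using killing_radical_inter_derived[OF reductive] rad by blast
  then show ?thesis using S(2)[OF v] by (simp add: N_def)
qed

lemma weight_space_iff: "v \<in> weight_space h \<alpha> \<longleftrightarrow> (\<forall>z\<in>h. bracket z v = \<alpha> z *s v)"
  by (simp add: weight_space_def)

lemma subspace_weight_space: "subspace (weight_space h \<alpha>)"
  unfolding weight_space_def
  by (rule subspaceI) (auto simp: bracket_simps scale_right_distrib scale_left_commute)

definition weight_vectors :: "'a set" where
  "weight_vectors = (\<Union>\<alpha>. weight_space h \<alpha>)"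

text \<open>
  An element of \<open>h\<close> that does not act on \<open>W\<close> by a scalar splits \<open>W\<close> into proper eigenspaces, which
  are again \<open>h\<close>-stable.
\<close>

lemma stable_subspace_weight_vectors:
  assumes "subspace W" "\<And>z w. z \<in> h \<Longrightarrow> w \<in> W \<Longrightarrow> bracket z w \<in> W"
  shows "W \<subseteq> span (W \<inter> weight_vectors)"
  using assms
proof (induction "dim W" arbitrary: W rule: less_induct)
  case less
  show ?case
  proof (cases "\<forall>z\<in>h. \<exists>c. \<forall>v\<in>W. bracket z v = c *s v")
    case True
    then obtain \<alpha> where "\<And>z v. z \<in> h \<Longrightarrow> v \<in> W \<Longrightarrow> bracket z v = \<alpha> z *s v" by metis
    then have "W \<subseteq> weight_vectors" unfolding weight_vectors_def weight_space_def by blast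
    then show ?thesis using span_superset by blast
  next
    case False
    then obtain z where z: "z \<in> h" "\<And>c. \<exists>v\<in>W. bracket z v \<noteq> c *s v" by blast
    have "W \<inter> (\<Union>c. gen_eigenspace (bracket z) c) \<subseteq> span (W \<inter> weight_vectors)"
    proof
      fix v assume v: "v \<in> W \<inter> (\<Union>c. gen_eigenspace (bracket z) c)"
      then obtain c where c: "v \<in> gen_eigenspace (bracket z) c" by blast
      let ?Wc = "W \<inter> gen_eigenspace (bracket z) c"
      have Wc: "subspace ?Wc" using less.prems(1) subspace_gen_eigenspace[OF lin_ad] by (rule subspace_inter)
      have "?Wc \<noteq> W" using z(2)[of c] h_diagonalizable[OF z(1)] by blast
      then have "dim ?Wc < dim W" using Wc less.prems(1) by (intro dim_psubset_subspace) auto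
      moreover have "bracket y w \<in> ?Wc" if "y \<in> h" "w \<in> ?Wc" for y w
      proof -
        have "y \<in> gen_eigenspace (bracket z) 0"
          using ad_h_nilpotent[OF z(1)] that by (auto simp: gen_eigenspace_zero)
        then have "bracket y w \<in> gen_eigenspace (bracket z) (0 + c)"
          using that by (intro gen_eigenspace_bracket) auto
        then show ?thesis using that less.prems(2) by simp
      qed
      ultimately have "?Wc \<subseteq> span (?Wc \<inter> weight_vectors)" using less.hyps Wc by blast
      also have "\<dots> \<subseteq> span (W \<inter> weight_vectors)" by (intro span_mono) blast
      finally show "v \<in> span (W \<inter> weight_vectors)" using v c by blast
    qed
    then have "span (W \<inter> (\<Union>c. gen_eigenspace (bracket z) c)) \<subseteq> span (W \<inter> weight_vectors)"
      by (rule span_minimal) simp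
    moreover have "W \<subseteq> span (W \<inter> (\<Union>c. gen_eigenspace (bracket z) c))"
      by (rule stable_subspace_gen_eigenspaces[OF lin_ad less.prems(1)]) (use z less.prems(2) in auto)
    ultimately show ?thesis by (rule subset_trans[rotated])
  qed
qed

lemma span_weight_vectors: "span weight_vectors = UNIV"
  using stable_subspace_weight_vectors[of UNIV] by auto

lemma killing_weights:
  assumes e: "e \<in> weight_space h \<alpha>" and f: "f \<in> weight_space h \<beta>"
    and z: "z \<in> h" "\<alpha> z + \<beta> z \<noteq> 0"
  shows "killing e f = 0"
proof -
  have "killing (bracket z e) f = - killing e (bracket z f)" by (rule killing_invariant)
  then have "\<alpha> z * killing e f = - (\<beta> z * killing e f)"
    using e f z(1) by (simp add: weight_space_iff killing_scale_left killing_scale_right)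
  then have "(\<alpha> z + \<beta> z) * killing e f = 0" by (simp add: distrib_right)
  then show ?thesis using z(2) by simp
qed

lemma bracket_weights:
  assumes e: "e \<in> weight_space h \<alpha>" and f: "f \<in> weight_space h \<beta>"
  shows "bracket e f \<in> weight_space h (\<lambda>z. \<alpha> z + \<beta> z)"
  unfolding weight_space_iff
proof
  fix z assume "z \<in> h"
  then show "bracket z (bracket e f) = (\<alpha> z + \<beta> z) *s bracket e f"
    using e f unfolding weight_space_iff ad_derivation[of z e f]
    by (simp add: bracket_simps scale_left_distrib)
qed

lemma bracket_opposite_weights:
  assumes e: "e \<in> weight_space h \<alpha>" and f: "f \<in> weight_space h (\<lambda>z. - \<alpha> z)"
  shows "bracket e f \<in> h"
  by (rule centralizer_in_h) (use bracket_weights[OF e f] in \<open>simp add: weight_space_iff\<close>)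

text \<open>Otherwise \<open>e\<close> would lie in the radical of the trace form on \<open>l\<close>, hence in the center of \<open>l\<close>.\<close>

lemma opposite_root_vector:
  assumes l: "lie_subalgebra l" "reductive_in_ambient l" "h \<subseteq> l"
    and e: "e \<in> l" "e \<in> weight_space h \<alpha>" "e \<noteq> 0" and z: "z \<in> h" "\<alpha> z \<noteq> 0"
  shows "\<exists>f\<in>l. f \<in> weight_space h (\<lambda>z. - \<alpha> z) \<and> killing e f \<noteq> 0"
proof (rule ccontr)
  assume none: "\<not> ?thesis"
  have ls: "subspace l" using l(1) by (rule lie_subalgebraD)
  have "killing e y = 0" if "y \<in> l" for y
  proof (rule killing_span_zero)
    show "y \<in> span (l \<inter> weight_vectors)"
      using stable_subspace_weight_vectors[OF ls] l lie_subalgebraD(2)[OF l(1)] that by blast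
    show "killing e f = 0" if f: "f \<in> l \<inter> weight_vectors" for f
    proof -
      obtain \<beta> where \<beta>: "f \<in> weight_space h \<beta>" using f unfolding weight_vectors_def by blast
      show ?thesis
      proof (cases "\<exists>z\<in>h. \<alpha> z + \<beta> z \<noteq> 0")
        case True
        then show ?thesis using killing_weights[OF e(2) \<beta>] by blast
      next
        case False
        then have "\<beta> z = - \<alpha> z" if "z \<in> h" for z using that by (metis add.commute eq_neg_iff_add_eq_0)
        then have "f \<in> weight_space h (\<lambda>z. - \<alpha> z)" using \<beta> by (simp add: weight_space_iff)
        then show ?thesis using none f by blast
      qed
    qed
  qed
  then have "bracket e z = 0" using trace_form_radical_central[OF l(1,2) e(1)] z l(3) by blast
  then have "\<alpha> z *s e = 0" using e(2) z(1) bracket_antisym[of z e] by (simp add: weight_space_iff)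
  then show False using e(3) z(2) by simp
qed

text \<open>
  If \<open>\<alpha> ([e, f]) = 0\<close>, then \<open>[e, f]\<close> commutes with \<open>f\<close> and the criterion makes it nilpotent. Being
  also diagonalizable, it is central, hence \<open>0\<close>; but its pairing with \<open>z\<close> is \<open>\<alpha> z * killing e f\<close>.
\<close>

lemma coroot_nondegenerate:
  assumes e: "e \<in> weight_space h \<alpha>" and f: "f \<in> weight_space h (\<lambda>z. - \<alpha> z)"
    and k: "killing e f \<noteq> 0" and z: "z \<in> h" "\<alpha> z \<noteq> 0"
  shows "\<alpha> (bracket e f) \<noteq> 0"
proof
  let ?t = "bracket e f"
  assume 0: "\<alpha> ?t = 0"
  have t: "?t \<in> h" by (rule bracket_opposite_weights[OF e f])
  obtain D where D: "lin D" "\<And>c v. v \<in> gen_eigenspace (bracket ?t) c \<Longrightarrow> D v = cnj c *s v"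
    using conj_part_exists by blast
  have "nilspace (bracket ?t) = UNIV"
  proof (rule ad_nilpotent_criterion[OF _ D])
    show "?t \<in> commutator {e} {f}" by (intro bracket_in_commutator) auto
    have "bracket ?t f = 0" using f t 0 by (simp add: weight_space_iff)
    then have "f \<in> gen_eigenspace (bracket ?t) 0"
      unfolding gen_eigenspace_zero nilspace_def by (auto intro: exI[of _ 1])
    then show "killing a (D b) = 0" if "a \<in> {e}" "b \<in> {f}" for a b using D(2) that by simp
  qed
  then have cen: "bracket ?t v = 0" for v
    using h_diagonalizable[OF t, of v 0] by (simp add: gen_eigenspace_zero)
  have "?t = 0"
    by (rule center_inter_derived[OF reductive bracket_in_commutator cen]) simp_all
  moreover have "killing z ?t = \<alpha> z * killing e f"
  proof -
    have "killing z ?t = killing (bracket z e) f"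
      using killing_invariant[of e z f] bracket_antisym[of z e] killing_scale_left[of "-1" "bracket z e" f]
      by simp
    then show ?thesis using e z(1) by (simp add: weight_space_iff killing_scale_left)
  qed
  ultimately show False using k z(2) by simp
qed

text \<open>
  The criterion applies to \<open>e\<close>, a multiple of \<open>[z, e]\<close>, since \<open>D e = 0\<close>.
\<close>

lemma root_vector_nilpotent:
  assumes e: "e \<in> weight_space h \<alpha>" and z: "z \<in> h" "\<alpha> z \<noteq> 0"
  shows "nilspace (bracket e) = UNIV"
proof -
  obtain D where D: "lin D" "\<And>c v. v \<in> gen_eigenspace (bracket e) c \<Longrightarrow> D v = cnj c *s v"
    using conj_part_exists by blast
  show ?thesis
  proof (rule ad_nilpotent_criterion[OF _ D])
    have "bracket z e \<in> commutator {z} {e}" by (intro bracket_in_commutator) auto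
    then have "(1 / \<alpha> z) *s bracket z e \<in> commutator {z} {e}"
      by (intro subspace_scale subspace_commutator)
    then show "e \<in> commutator {z} {e}" using e z by (simp add: weight_space_iff)
    have "e \<in> gen_eigenspace (bracket e) 0"
      unfolding gen_eigenspace_zero nilspace_def by (auto simp: bracket_self intro: exI[of _ 1])
    then show "killing a (D b) = 0" if "a \<in> {z}" "b \<in> {e}" for a b using D(2) that by simp
  qed
qed

text \<open>
  If \<open>[f, x] = 0\<close>, then \<open>[f, (ad e)\<^sup>k\<^sup>+\<^sup>1 x]\<close> is a nonzero multiple of \<open>(ad e)\<^sup>k x\<close>; so the nilpotency of
  \<open>ad e\<close> forces \<open>x = 0\<close>. This is the fact that a lowest weight of a finite-dimensional
  \<open>sl\<^sub>2\<close>-module cannot be positive.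
\<close>

lemma no_positive_lowest_weight:
  assumes e: "e \<in> weight_space h \<alpha>" and f: "f \<in> weight_space h (\<lambda>z. - \<alpha> z)"
    and t: "\<alpha> (bracket e f) \<noteq> 0" and x: "x \<in> weight_space h \<alpha>" "bracket f x = 0"
  shows "x = 0"
proof -
  define t' where "t' = bracket e f"
  define a where "a = \<alpha> t'"
  have th: "t' \<in> h" unfolding t'_def by (rule bracket_opposite_weights[OF e f])
  have a0: "a \<noteq> 0" using t by (simp add: a_def t'_def)
  let ?x = "\<lambda>k. (bracket e ^^ k) x"
  have wt: "bracket t' (?x k) = (of_nat (Suc k) * a) *s ?x k" for k
  proof -
    have "?x k \<in> weight_space h (\<lambda>z. of_nat (Suc k) * \<alpha> z)"
    proof (induction k)
      case 0 then show ?case using x(1) by simp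
    next
      case (Suc k)
      from bracket_weights[OF e Suc] show ?case by (simp add: distrib_right)
    qed
    then show ?thesis using th by (simp add: weight_space_iff a_def)
  qed
  have low: "bracket f (?x (Suc k)) = (- a * of_nat (Suc k) * of_nat (Suc (Suc k)) / 2) *s ?x k" for k
  proof (induction k)
    case 0
    have "bracket f (?x 1) = bracket (bracket f e) x + bracket e (bracket f x)"
      by (simp add: ad_derivation[of f e x])
    also have "\<dots> = - bracket t' x"
      using x(2) bracket_antisym[of f e] by (simp add: t'_def bracket_simps)
    finally show ?case using wt[of 0] by (simp add: scale_minus_left)
  next
    case (Suc k)
    have "bracket f (?x (Suc (Suc k))) = bracket (bracket f e) (?x (Suc k)) + bracket e (bracket f (?x (Suc k)))"
      using ad_derivation[of f e "?x (Suc k)"] by simp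
    also have "bracket (bracket f e) (?x (Suc k)) = - bracket t' (?x (Suc k))"
      using bracket_antisym[of f e] by (simp add: t'_def bracket_simps)
    also have "bracket e (bracket f (?x (Suc k))) =
        (- a * of_nat (Suc k) * of_nat (Suc (Suc k)) / 2) *s ?x (Suc k)"
      unfolding Suc by (simp add: bracket_simps)
    also have "- bracket t' (?x (Suc k)) = (- (of_nat (Suc (Suc k)) * a)) *s ?x (Suc k)"
      unfolding wt by (simp only: scale_minus_left)
    also have "(- (of_nat (Suc (Suc k)) * a)) *s ?x (Suc k) +
       (- a * of_nat (Suc k) * of_nat (Suc (Suc k)) / 2) *s ?x (Suc k) =
       (- (of_nat (Suc (Suc k)) * a) + - a * of_nat (Suc k) * of_nat (Suc (Suc k)) / 2) *s ?x (Suc k)"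
      by (simp only: scale_left_distrib)
    also have "- (of_nat (Suc (Suc k)) * a) + - a * of_nat (Suc k) * of_nat (Suc (Suc k)) / 2 =
        - a * of_nat (Suc (Suc k)) * of_nat (Suc (Suc (Suc k))) / 2"
      by (simp add: field_simps)
    finally show ?case .
  qed
  have "x \<in> nilspace (bracket e)"
  proof (cases "\<exists>z\<in>h. \<alpha> z \<noteq> 0")
    case True
    then show ?thesis using root_vector_nilpotent[OF e] by blast
  qed (use th a0 a_def in blast)
  then obtain K where "?x K = 0" unfolding nilspace_def by auto
  then show ?thesis
  proof (induction K)
    case (Suc k)
    then have "(- a * of_nat (Suc k) * of_nat (Suc (Suc k)) / 2) *s ?x k = 0"
      using low[of k] by simp
    then show ?case using Suc.IH a0 by (simp del: of_nat_Suc)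
  qed simp
qed

text \<open>
  Subtract a multiple of \<open>u\<close> from \<open>x\<close> so that the difference \<open>x'\<close> becomes orthogonal to \<open>f\<close>. Then
  \<open>[x', f] \<in> h\<close> is orthogonal to everything, so it vanishes, and \<open>no_positive_lowest_weight\<close> applies
  to \<open>x'\<close>.
\<close>

lemma root_space_one_dimensional:
  assumes u: "u \<in> weight_space h \<alpha>" "u \<noteq> 0" and x: "x \<in> weight_space h \<alpha>"
    and z: "z \<in> h" "\<alpha> z \<noteq> 0"
  shows "\<exists>c. x = c *s u"
proof -
  obtain f where f: "f \<in> weight_space h (\<lambda>z. - \<alpha> z)" "killing u f \<noteq> 0"
    using opposite_root_vector[OF lie_subalgebra_UNIV reductive _ _ u z] by blast
  define x' where "x' = x - (killing x f / killing u f) *s u"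
  have x': "x' \<in> weight_space h \<alpha>" unfolding x'_def
    by (intro subspace_diff subspace_scale subspace_weight_space x u)
  have kx': "killing x' f = 0" using f(2) by (simp add: x'_def killing_diff_left killing_scale_left)
  let ?t = "bracket x' f"
  have th: "?t \<in> h" by (rule bracket_opposite_weights[OF x' f(1)])
  have "?t = 0"
  proof (rule killing_radical_inter_derived[OF reductive])
    show "?t \<in> commutator UNIV UNIV" by (simp add: bracket_in_commutator)
    show "killing ?t y = 0" for y
    proof (rule killing_eq_zero_if_on_h)
      show "bracket y ?t = 0" if "y \<in> h" for y using h_abelian that th by blast
      show "killing ?t y = 0" if "y \<in> h" for y
      proof -
        have "killing ?t y = - killing f (bracket x' y)" by (rule killing_invariant)
        also have "bracket x' y = (- \<alpha> y) *s x'"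
          using x' that bracket_antisym[of x' y] by (simp add: weight_space_iff scale_minus_left)
        finally show ?thesis using kx' killing_comm[of f x'] by (simp add: killing_scale_right del: scale_minus_left)
      qed
    qed
  qed
  then have "bracket f x' = 0" using bracket_antisym[of f x'] by simp
  then have "x' = 0"
    using no_positive_lowest_weight[OF u(1) f(1) _ x'] coroot_nondegenerate[OF u(1) f z] by blast
  then show ?thesis unfolding x'_def by auto
qed

lemma root_space_subset:
  assumes "subspace W" "u \<in> W" "u \<in> weight_space h \<alpha>" "u \<noteq> 0" "z \<in> h" "\<alpha> z \<noteq> 0"
  shows "weight_space h \<alpha> \<subseteq> W"
  using root_space_one_dimensional[of u \<alpha> _ z] assms subspace_scale by blast

lemma reductive_root_symmetric:
  assumes l: "lie_subalgebra l" "reductive_in_ambient l" "h \<subseteq> l"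
    and e: "e \<in> l" "e \<in> weight_space h \<alpha>" "e \<noteq> 0" and z: "z \<in> h" "\<alpha> z \<noteq> 0"
  shows "weight_space h (\<lambda>z. - \<alpha> z) \<subseteq> l"
proof -
  obtain f where f: "f \<in> l" "f \<in> weight_space h (\<lambda>z. - \<alpha> z)" "killing e f \<noteq> 0"
    using opposite_root_vector[OF assms] by blast
  have "f \<noteq> 0" using f(3) by auto
  then show ?thesis
    using root_space_subset[OF lie_subalgebraD(1)[OF l(1)] f(1,2), of z] z by simp
qed

end

section \<open>Parabolic subalgebras and their Langlands decompositions\<close>

context complex_lie
begin

definition matrix_of :: "(nat \<Rightarrow> 'a) \<Rightarrow> ('a \<Rightarrow> 'a) \<Rightarrow> complex mat" where
  "matrix_of bs f = mat (card Basis) (card Basis) (\<lambda>(i, j). representation Basis (f (bs j)) (bs i))"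

lemma matrix_of_carrier: "matrix_of bs f \<in> carrier_mat (card Basis) (card Basis)"
  by (simp add: matrix_of_def)

lemma matrix_of_comp:
  assumes bs: "bij_betw bs {0..<card Basis} Basis" and f: "lin f"
  shows "matrix_of bs (\<lambda>x. f (g x)) = matrix_of bs f * matrix_of bs g"
proof (rule eq_matI)
  fix i j assume "i < dim_row (matrix_of bs f * matrix_of bs g)" "j < dim_col (matrix_of bs f * matrix_of bs g)"
  then have ij: "i < card Basis" "j < card Basis" by (simp_all add: matrix_of_def)
  let ?r = "representation Basis"
  have "?r (f (g (bs j))) (bs i) = (\<Sum>c\<in>Basis. ?r (g (bs j)) c * ?r (f c) (bs i))"
    by (rule representation_lin[OF f independent_Basis span_Basis])
  also have "\<dots> = (\<Sum>k = 0..<card Basis. ?r (g (bs j)) (bs k) * ?r (f (bs k)) (bs i))"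
    by (rule sum.reindex_bij_betw[OF bs, symmetric])
  finally show "matrix_of bs (\<lambda>x. f (g x)) $$ (i, j) = (matrix_of bs f * matrix_of bs g) $$ (i, j)"
    using ij by (simp add: matrix_of_def scalar_prod_def mult.commute)
qed (simp_all add: matrix_of_def)

lemma matrix_of_funpow:
  assumes bs: "bij_betw bs {0..<card Basis} Basis" and f: "lin f"
  shows "matrix_of bs (f ^^ k) = matrix_of bs f ^\<^sub>m k"
proof (induction k)
  case 0
  have "bs i \<in> Basis" if "i < card Basis" for i using bs that by (auto simp: bij_betw_def)
  moreover have "bs i = bs j \<longleftrightarrow> i = j" if "i < card Basis" "j < card Basis" for i j
    using bs that by (auto simp: bij_betw_def inj_on_def)
  ultimately show ?case
    by (intro eq_matI) (auto simp: matrix_of_def representation_basis independent_Basis)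
next
  case (Suc k)
  have "matrix_of bs (f ^^ Suc k) = matrix_of bs (\<lambda>x. (f ^^ k) (f x))"
    by (simp only: funpow_Suc_right o_def)
  also have "\<dots> = matrix_of bs (f ^^ k) * matrix_of bs f" by (rule matrix_of_comp[OF bs lin_funpow[OF f]])
  finally show ?case by (simp only: Suc pow_mat.simps)
qed

lemma matrix_of_eq_zero:
  assumes bs: "bij_betw bs {0..<card Basis} Basis" and f: "lin f"
    and 0: "matrix_of bs f = 0\<^sub>m (card Basis) (card Basis)"
  shows "f v = 0"
proof (rule lp.linear_eq_0_on_span[OF f])
  show "v \<in> span Basis" by (simp add: span_Basis)
  fix b assume "b \<in> Basis"
  then have "b \<in> bs ` {0..<card Basis}" using bij_betw_imp_surj_on[OF bs] by simp
  then obtain j where j: "j < card Basis" "b = bs j" by auto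
  have "representation Basis (f b) c = 0" if "c \<in> Basis" for c
  proof -
    have "c \<in> bs ` {0..<card Basis}" using bij_betw_imp_surj_on[OF bs] that by simp
    then obtain i where i: "i < card Basis" "c = bs i" by auto
    have "matrix_of bs f $$ (i, j) = 0" using i j by (simp add: 0)
    then show ?thesis using i j by (simp add: matrix_of_def)
  qed
  then have "(\<Sum>c\<in>Basis. representation Basis (f b) c *s c) = 0" by simp
  then show "f b = 0"
    using sum_representation_eq[of Basis "f b" Basis] by (simp add: independent_Basis span_Basis finite_Basis)
qed

text \<open>
  The adjoint action on the whole algebra, in coordinates, is one of the representations over which
  the definition quantifies.
\<close>

lemma acts_nilpotently_ad:
  assumes "acts_nilpotently N L" "x \<in> N"
  shows "nilspace (bracket x) = UNIV"
proof -
  obtain bs where bs: "bij_betw bs {0..<card Basis} Basis"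
    using ex_bij_betw_nat_finite[OF finite_Basis] by blast
  let ?\<rho> = "\<lambda>x. matrix_of bs (bracket x)"
  have "lie_representation L (card Basis) ?\<rho>"
    unfolding lie_representation_def
  proof (intro conjI ballI allI)
    fix x y
    show "?\<rho> x \<in> carrier_mat (card Basis) (card Basis)" by (rule matrix_of_carrier)
    show "?\<rho> (x + y) = ?\<rho> x + ?\<rho> y"
      by (rule eq_matI) (auto simp: matrix_of_def bracket_simps representation_add independent_Basis span_Basis)
    show "?\<rho> (c *s x) = c \<cdot>\<^sub>m ?\<rho> x" for c
      by (rule eq_matI) (auto simp: matrix_of_def bracket_simps representation_scale independent_Basis span_Basis)
    have "?\<rho> (bracket x y) = matrix_of bs (\<lambda>v. bracket x (bracket y v)) - matrix_of bs (\<lambda>v. bracket y (bracket x v))"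
      by (rule eq_matI) (auto simp: matrix_of_def bracket_bracket representation_diff independent_Basis span_Basis)
    then show "?\<rho> (bracket x y) = ?\<rho> x * ?\<rho> y - ?\<rho> y * ?\<rho> x"
      by (simp only: matrix_of_comp[OF bs lin_ad, of x "bracket y"]
          matrix_of_comp[OF bs lin_ad, of y "bracket x"])
  qed
  then obtain k where "?\<rho> x ^\<^sub>m k = 0\<^sub>m (card Basis) (card Basis)"
    using assms unfolding acts_nilpotently_def by blast
  then have "(bracket x ^^ k) v = 0" for v
    using matrix_of_eq_zero[OF bs lin_funpow[OF lin_ad]] matrix_of_funpow[OF bs lin_ad] by simp
  then show ?thesis unfolding nilspace_def by blast
qed

abbreviation derived_series :: "'a set \<Rightarrow> nat \<Rightarrow> 'a set" where
  "derived_series L k \<equiv> ((\<lambda>A. commutator A A) ^^ k) L"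

lemma derived_series_subalgebra:
  assumes "lie_subalgebra L" shows "lie_subalgebra (derived_series L k) \<and> derived_series L k \<subseteq> L"
proof (induction k)
  case 0 then show ?case using assms by simp
next
  case (Suc k)
  let ?D = "derived_series L k"
  have D: "lie_subalgebra ?D" "?D \<subseteq> L" using Suc by auto
  have sub: "commutator ?D ?D \<subseteq> ?D"
    by (rule commutator_subset[OF lie_subalgebraD(1)[OF D(1)]]) (rule lie_subalgebraD(2)[OF D(1)])
  then have "bracket x y \<in> commutator ?D ?D" if "x \<in> commutator ?D ?D" "y \<in> commutator ?D ?D" for x y
    using that by (intro bracket_in_commutator) auto
  then have "lie_subalgebra (commutator ?D ?D)"
    by (simp add: lie_subalgebra_def subspace_commutator)
  then show ?case using sub D(2) by auto
qed

text \<open>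
  By Engel's theorem the derived series strictly decreases until it is \<open>0\<close>.
\<close>

lemma nilpotent_elements_solvable:
  assumes L: "lie_subalgebra L" and nil: "\<And>x. x \<in> L \<Longrightarrow> nilspace (bracket x) = UNIV"
  shows "\<exists>k. derived_series L k = {0}"
proof (rule ccontr)
  assume none: "\<not> ?thesis"
  have "dim (derived_series L k) + k \<le> dim L" for k
  proof (induction k)
    case (Suc k)
    let ?D = "derived_series L k"
    have D: "lie_subalgebra ?D" "?D \<subseteq> L" using derived_series_subalgebra[OF L] by auto
    have "commutator ?D ?D \<subset> ?D"
      by (rule nilpotent_not_perfect[OF D(1)]) (use nil D none in blast)+
    then have "dim (commutator ?D ?D) < dim ?D"
      using D(1) by (intro dim_psubset_subspace) (auto simp: subspace_commutator lie_subalgebra_def)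
    then show ?case using Suc by simp
  qed simp
  from this[of "Suc (dim L)"] show False by simp
qed

lemma solvable_extension:
  assumes b: "lie_subalgebra b" "lie_solvable b" and n: "lie_subalgebra n" "lie_solvable n"
    and ideal: "\<And>x y. x \<in> b \<Longrightarrow> y \<in> n \<Longrightarrow> bracket x y \<in> n"
  shows "lie_subalgebra {x + y |x y. x \<in> b \<and> y \<in> n}" (is "lie_subalgebra ?c")
    and "lie_solvable {x + y |x y. x \<in> b \<and> y \<in> n}"
proof -
  note bs = lie_subalgebraD[OF b(1)] and ns = lie_subalgebraD[OF n(1)]
  have br: "bracket (x + y) (x' + y') \<in> {u + v |u v. u \<in> commutator A A \<and> v \<in> n}"
    if "x \<in> A" "x' \<in> A" "y \<in> n" "y' \<in> n" "A \<subseteq> b" for A x x' y y'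
  proof -
    have "bracket y x' \<in> n" using ideal[of x' y] that bracket_antisym[of y x'] subspace_neg[OF ns(1)] by auto
    then have "bracket x y' + bracket y x' + bracket y y' \<in> n"
      using that ideal[of x y'] ns by (intro subspace_add) auto
    moreover have "bracket (x + y) (x' + y') = bracket x x' + (bracket x y' + bracket y x' + bracket y y')"
      by (simp add: bracket_simps algebra_simps)
    moreover have "bracket x x' \<in> commutator A A" using that by (intro bracket_in_commutator)
    ultimately show ?thesis by blast
  qed
  have bb: "commutator b b \<subseteq> b" by (rule commutator_subset[OF bs(1)]) (rule bs(2))
  have sub: "subspace {x + y |x y. x \<in> A \<and> y \<in> n}" if "subspace A" for A
    using that ns(1) by (rule subspace_sums)
  show c: "lie_subalgebra ?c"
    unfolding lie_subalgebra_def
  proof (intro conjI ballI)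
    show "subspace ?c" by (rule sub[OF bs(1)])
    fix v w assume "v \<in> ?c" "w \<in> ?c"
    then obtain x y x' y' where "v = x + y" "w = x' + y'" "x \<in> b" "x' \<in> b" "y \<in> n" "y' \<in> n" by blast
    then have "bracket v w \<in> {u + v |u v. u \<in> commutator b b \<and> v \<in> n}" using br[of x b x' y y'] by simp
    then show "bracket v w \<in> ?c" using bb by blast
  qed
  have D: "derived_series ?c k \<subseteq> {x + y |x y. x \<in> derived_series b k \<and> y \<in> n}" for k
  proof (induction k)
    case (Suc k)
    let ?A = "derived_series b k"
    have A: "?A \<subseteq> b" using derived_series_subalgebra[OF b(1)] by blast
    have "commutator (derived_series ?c k) (derived_series ?c k)
        \<subseteq> {x + y |x y. x \<in> commutator ?A ?A \<and> y \<in> n}"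
    proof (rule commutator_subset[OF sub[OF subspace_commutator]])
      fix v w assume "v \<in> derived_series ?c k" "w \<in> derived_series ?c k"
      then obtain x y x' y' where "v = x + y" "w = x' + y'" "x \<in> ?A" "x' \<in> ?A" "y \<in> n" "y' \<in> n"
        using Suc by blast
      then show "bracket v w \<in> {x + y |x y. x \<in> commutator ?A ?A \<and> y \<in> n}"
        using br[of x ?A x' y y'] A by simp
    qed
    then show ?case by simp
  qed auto
  obtain kb kn where k: "derived_series b kb = {0}" "derived_series n kn = {0}"
    using b(2) n(2) unfolding lie_solvable_def by blast
  have cn: "derived_series ?c kb \<subseteq> n" using D[of kb] k(1) by auto
  have "derived_series ?c (j + kb) \<subseteq> derived_series n j" for j
    by (induction j) (use cn commutator_mono in auto)
  from this[of kn] have "derived_series ?c (kn + kb) \<subseteq> {0}" using k(2) by simp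
  moreover have "0 \<in> derived_series ?c (kn + kb)"
    using derived_series_subalgebra[OF c] subspace_0 unfolding lie_subalgebra_def by blast
  ultimately show "lie_solvable ?c" unfolding lie_solvable_def by blast
qed

end

locale parabolic_levi = reductive_lie scale Basis bracket h
  for scale :: "complex \<Rightarrow> 'a::ab_group_add \<Rightarrow> 'a" (infixr "*s" 75)
    and Basis :: "'a set" and bracket :: "'a \<Rightarrow> 'a \<Rightarrow> 'a" and h :: "'a set" +
  fixes b p l n :: "'a set"
  assumes parabolic: "parabolic_subalgebra p"
    and borel: "borel_subalgebra b" and b_p: "b \<subseteq> p"
    and langlands: "langlands_decomposition p l n"
    and h_l: "h \<subseteq> l"
begin

lemma p_sub: "subspace p" "\<And>x y. x \<in> p \<Longrightarrow> y \<in> p \<Longrightarrow> bracket x y \<in> p"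
  using parabolic unfolding parabolic_subalgebra_def lie_subalgebra_def by auto

lemma l_lie: "lie_subalgebra l" and l_reductive: "reductive_in_ambient l"
  using langlands unfolding langlands_decomposition_def by auto

lemmas l_sub = lie_subalgebraD[OF l_lie]

lemma n_ideal: "subspace n" "n \<subseteq> p" "\<And>x y. x \<in> p \<Longrightarrow> y \<in> n \<Longrightarrow> bracket x y \<in> n"
  using langlands unfolding langlands_decomposition_def is_nilpotent_radical_def lie_ideal_def by auto

lemma p_decomp: "x \<in> p \<Longrightarrow> \<exists>a\<in>l. \<exists>c\<in>n. x = a + c" and l_inter_n: "l \<inter> n = {0}"
  using langlands unfolding langlands_decomposition_def is_direct_sum_def by auto

lemma l_p: "l \<subseteq> p"
proof
  fix x assume "x \<in> l"
  then have "x + 0 \<in> {a + c |a c. a \<in> l \<and> c \<in> n}" using subspace_0[OF n_ideal(1)] by blast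
  then show "x \<in> p" using langlands unfolding langlands_decomposition_def is_direct_sum_def by simp
qed

lemma h_inter_n: "h \<inter> n = {0}"
  using l_inter_n h_l subspace_0[OF h_sub(1)] subspace_0[OF n_ideal(1)] by blast

lemma n_lie: "lie_subalgebra n"
  using n_ideal unfolding lie_subalgebra_def by blast

text \<open>
  \<open>b + n\<close> is solvable, so it equals \<open>b\<close> by maximality.
\<close>

lemma n_subset_borel: "n \<subseteq> b"
proof -
  have b: "lie_subalgebra b" "lie_solvable b"
    "\<And>c. lie_subalgebra c \<Longrightarrow> lie_solvable c \<Longrightarrow> b \<subseteq> c \<Longrightarrow> c = b"
    using borel unfolding borel_subalgebra_def by auto
  have "acts_nilpotently n p"
    using langlands unfolding langlands_decomposition_def is_nilpotent_radical_def by blast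
  then have n: "lie_solvable n" unfolding lie_solvable_def
    by (intro nilpotent_elements_solvable n_lie acts_nilpotently_ad)
  let ?c = "{x + y |x y. x \<in> b \<and> y \<in> n}"
  have ideal: "bracket x y \<in> n" if "x \<in> b" "y \<in> n" for x y using n_ideal(3) that b_p by blast
  have "b \<subseteq> ?c"
  proof
    fix x assume "x \<in> b"
    then have "x + 0 \<in> ?c" using subspace_0[OF n_ideal(1)] by blast
    then show "x \<in> ?c" by simp
  qed
  moreover have "lie_subalgebra ?c" using b(1,2) n_lie n ideal by (rule solvable_extension(1))
  moreover have "lie_solvable ?c" using b(1,2) n_lie n ideal by (rule solvable_extension(2))
  ultimately have "?c = b" using b(3) by blast
  moreover have "n \<subseteq> ?c"
  proof
    fix x assume "x \<in> n"
    then have "0 + x \<in> ?c" using subspace_0[OF lie_subalgebraD(1)[OF b(1)]] by blast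
    then show "x \<in> ?c" by simp
  qed
  ultimately show ?thesis by simp
qed

lemma h_p: "h \<subseteq> p" using h_l l_p by blast

text \<open>
  The components of \<open>v\<close> in \<open>l\<close> and \<open>n\<close> have the same weight as \<open>v\<close>; if the component in \<open>l\<close> is not
  zero, it spans the root space.
\<close>

lemma weight_vector_in_l_or_n:
  assumes v: "v \<in> p" "v \<in> weight_space h \<alpha>"
  shows "v \<in> l \<or> v \<in> n"
proof (cases "\<exists>z\<in>h. \<alpha> z \<noteq> 0")
  case False
  then have "v \<in> h" using v(2) by (intro centralizer_in_h) (simp add: weight_space_iff)
  then show ?thesis using h_l by blast
next
  case True
  then obtain z where z: "z \<in> h" "\<alpha> z \<noteq> 0" by blast
  obtain a c where ac: "a \<in> l" "c \<in> n" "v = a + c" using p_decomp[OF v(1)] by blast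
  have "bracket y a = \<alpha> y *s a" if y: "y \<in> h" for y
  proof -
    have "bracket y a - \<alpha> y *s a = \<alpha> y *s c - bracket y c"
      using v(2) y unfolding ac weight_space_iff by (simp add: bracket_simps scale_right_distrib algebra_simps)
    moreover have "bracket y a - \<alpha> y *s a \<in> l"
      using ac(1) l_sub h_l y by (intro subspace_diff subspace_scale) auto
    moreover have "\<alpha> y *s c - bracket y c \<in> n"
      using ac(2) n_ideal h_p y by (intro subspace_diff subspace_scale) auto
    ultimately have "bracket y a - \<alpha> y *s a \<in> l \<inter> n" by simp
    then show ?thesis by (simp add: l_inter_n)
  qed
  then have "a \<in> weight_space h \<alpha>" by (simp add: weight_space_iff)
  then have "weight_space h \<alpha> \<subseteq> l" if "a \<noteq> 0"
    using root_space_subset[where \<alpha> = \<alpha> and z = z, OF l_sub(1) ac(1)] that z by blast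
  then show ?thesis using v(2) ac by (cases "a = 0") auto
qed

lemma n_weight_nonzero:
  assumes "v \<in> n" "v \<in> weight_space h \<alpha>" "v \<noteq> 0"
  obtains z where "z \<in> h" "\<alpha> z \<noteq> 0"
proof (cases "\<exists>z\<in>h. \<alpha> z \<noteq> 0")
  case False
  then have "v \<in> h" using assms(2) by (intro centralizer_in_h) (simp add: weight_space_iff)
  then show ?thesis using assms h_inter_n by blast
qed (use that in blast)

lemma weight_space_not_both:
  assumes "v \<in> l" "v \<in> weight_space h \<alpha>" "u \<in> n" "u \<in> weight_space h \<alpha>" "u \<noteq> 0"
  shows "v = 0"
proof -
  obtain z where "z \<in> h" "\<alpha> z \<noteq> 0" using n_weight_nonzero assms(3-5) by blast
  then have "v \<in> n" using root_space_subset[OF n_ideal(1) assms(3-5)] assms(2) by blast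
  then show ?thesis using assms(1) l_inter_n by blast
qed

text \<open>
  A weight vector \<open>v \<in> n\<close> has a nonzero weight, so it is a multiple of some \<open>[z, v]\<close>.
\<close>

lemma n_inter_subset_commutator:
  assumes k: "lie_subalgebra k" "h \<subseteq> k"
  shows "n \<inter> k \<subseteq> commutator k k"
proof -
  note ks = lie_subalgebraD[OF k(1)]
  have "n \<inter> k \<subseteq> span (n \<inter> k \<inter> weight_vectors)"
    by (rule stable_subspace_weight_vectors)
      (use ks k(2) n_ideal h_p in \<open>auto intro: subspace_inter\<close>)
  also have "\<dots> \<subseteq> commutator k k"
  proof (rule span_minimal[OF _ subspace_commutator], rule subsetI)
    fix v assume v: "v \<in> n \<inter> k \<inter> weight_vectors"
    then obtain \<alpha> where \<alpha>: "v \<in> weight_space h \<alpha>" unfolding weight_vectors_def by blast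
    show "v \<in> commutator k k"
    proof (cases "v = 0")
      case False
      then obtain z where z: "z \<in> h" "\<alpha> z \<noteq> 0" using n_weight_nonzero v \<alpha> by blast
      then have "(1 / \<alpha> z) *s bracket z v \<in> commutator k k"
        using v k(2) by (intro subspace_scale subspace_commutator bracket_in_commutator) auto
      then show ?thesis using z \<alpha> by (simp add: weight_space_iff)
    qed (simp add: subspace_0[OF subspace_commutator])
  qed
  finally show ?thesis .
qed

lemma l_subset_weight_complement: "l \<subseteq> weight_complement h n"
proof -
  have "l \<subseteq> span (l \<inter> weight_vectors)"
    by (rule stable_subspace_weight_vectors[OF l_sub(1)]) (use l_sub(2) h_l in blast)
  also have "\<dots> \<subseteq> weight_complement h n"
    unfolding weight_complement_def
  proof (rule span_minimal, rule subsetI)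
    fix v assume v: "v \<in> l \<inter> weight_vectors"
    then obtain \<alpha> where \<alpha>: "v \<in> weight_space h \<alpha>" unfolding weight_vectors_def by blast
    show "v \<in> span (\<Union>{W \<in> weight_spaces h. W \<inter> n = {0}})"
    proof (cases "v = 0")
      case True then show ?thesis by (simp add: span_zero)
    next
      case False
      then have "weight_space h \<alpha> \<in> weight_spaces h" using \<alpha> unfolding weight_spaces_def by blast
      moreover have "weight_space h \<alpha> \<inter> n = {0}"
        using weight_space_not_both[of v \<alpha>] v \<alpha> False
          subspace_0[OF n_ideal(1)] subspace_0[OF subspace_weight_space] by blast
      ultimately show ?thesis using \<alpha> by (intro span_base) blast
    qed
  qed simp
  finally show ?thesis .
qed

text \<open>
  The intersection is \<open>h\<close>-stable, so it suffices to consider a weight vector \<open>v\<close> in it. Its weight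
  \<open>\<alpha>\<close> does not occur in the complement; as only vectors of weight \<open>- \<alpha>\<close> could pair nontrivially with
  \<open>v\<close>, and these are orthogonal to all other weights, \<open>v\<close> is orthogonal to everything.
\<close>

lemma n_inter_weight_complement: "n \<inter> weight_complement h n = {0}"
proof -
  let ?C = "weight_complement h n"
  have C: "subspace ?C" by (simp add: weight_complement_def)
  have C_stable: "bracket z w \<in> ?C" if z: "z \<in> h" and w: "w \<in> ?C" for z w
  proof (rule span_bracket_in[OF C])
    show "w \<in> span (\<Union>{W \<in> weight_spaces h. W \<inter> n = {0}})" using w by (simp add: weight_complement_def)
    fix s assume s: "s \<in> \<Union>{W \<in> weight_spaces h. W \<inter> n = {0}}"
    then obtain \<beta> where "s \<in> weight_space h \<beta>" unfolding weight_spaces_def by blast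
    then have "bracket z s = \<beta> z *s s" using z by (simp add: weight_space_iff)
    then show "bracket z s \<in> ?C" using s unfolding weight_complement_def by (simp add: span_base span_scale)
  qed
  have zero: "v = 0" if v: "v \<in> n" "v \<in> ?C" "v \<in> weight_space h \<alpha>" for v \<alpha>
  proof (rule ccontr)
    assume v0: "v \<noteq> 0"
    then obtain z where z: "z \<in> h" "\<alpha> z \<noteq> 0" using n_weight_nonzero v by blast
    have ky: "killing y v = 0" if y: "y \<in> weight_vectors" for y
    proof -
      obtain \<beta> where \<beta>: "y \<in> weight_space h \<beta>" using y unfolding weight_vectors_def by blast
      show ?thesis
      proof (cases "\<exists>z\<in>h. \<beta> z + \<alpha> z \<noteq> 0")
        case True then show ?thesis using killing_weights[OF \<beta> v(3)] by blast
      next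
        case False
        show ?thesis
        proof (rule killing_span_zero)
          show "v \<in> span (\<Union>{W \<in> weight_spaces h. W \<inter> n = {0}})"
            using v(2) by (simp add: weight_complement_def)
          fix s assume "s \<in> \<Union>{W \<in> weight_spaces h. W \<inter> n = {0}}"
          then obtain \<gamma> where s: "s \<in> weight_space h \<gamma>" "weight_space h \<gamma> \<inter> n = {0}"
            unfolding weight_spaces_def by blast
          have "v \<notin> weight_space h \<gamma>" using s(2) v(1) v0 by blast
          then obtain z where "z \<in> h" "\<gamma> z \<noteq> \<alpha> z" using v(3) unfolding weight_space_iff by metis
          then have "z \<in> h" "\<beta> z + \<gamma> z \<noteq> 0" using False by (auto simp: add_eq_0_iff)
          then show "killing y s = 0" using killing_weights[OF \<beta> s(1)] by blast
        qed
      qed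
    qed
    have "v = 0"
    proof (rule killing_radical_inter_derived[OF reductive])
      have "(1 / \<alpha> z) *s bracket z v \<in> commutator UNIV UNIV"
        by (intro subspace_scale subspace_commutator bracket_in_commutator) auto
      then show "v \<in> commutator UNIV UNIV" using z v(3) by (simp add: weight_space_iff)
      show "killing v y = 0" for y
        by (rule killing_span_zero[of y weight_vectors])
          (use ky killing_comm[of v] span_weight_vectors in auto)
    qed
    then show False using v0 by simp
  qed
  have "n \<inter> ?C \<subseteq> span (n \<inter> ?C \<inter> weight_vectors)"
    by (rule stable_subspace_weight_vectors)
      (use n_ideal h_p C C_stable in \<open>auto intro: subspace_inter\<close>)
  also have "\<dots> \<subseteq> {0}"
    by (rule span_minimal) (use zero in \<open>auto simp: weight_vectors_def\<close>)
  finally show ?thesis using subspace_0[OF n_ideal(1)] subspace_0[OF C] by blast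
qed

lemma weight_proj_levi:
  assumes x: "x \<in> l" and u: "u \<in> n"
  shows "weight_proj h n (x + u) = x"
  unfolding weight_proj_def
proof (rule the_equality)
  let ?C = "weight_complement h n"
  have xC: "x \<in> ?C" using x l_subset_weight_complement by blast
  then show "x \<in> ?C \<and> x + u - x \<in> n" using u by simp
  fix y assume y: "y \<in> ?C \<and> x + u - y \<in> n"
  then have "(x + u - y) - u \<in> n" using subspace_diff[OF n_ideal(1) conjunct2 u] by blast
  then have "x - y \<in> n" by (simp add: algebra_simps)
  moreover have "x - y \<in> ?C" using xC y unfolding weight_complement_def by (auto intro: span_diff)
  ultimately have "x - y \<in> n \<inter> ?C" by simp
  then show "y = x" by (simp add: n_inter_weight_complement)
qed

end

locale opposite_parabolics = reductive_lie scale Basis bracket h +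
  P: parabolic_levi scale Basis bracket h b p l n +
  P': parabolic_levi scale Basis bracket h b' p' l' n'
  for scale :: "complex \<Rightarrow> 'a::ab_group_add \<Rightarrow> 'a" (infixr "*s" 75)
    and Basis :: "'a set" and bracket :: "'a \<Rightarrow> 'a \<Rightarrow> 'a" and h :: "'a set"
    and b p l n b' p' l' n' :: "'a set" +
  assumes borels: "b \<inter> b' = h"
begin

text \<open>
  The symmetry between the two parabolic subalgebras; it transfers statements about \<open>i\<close> and \<open>p\<close> to
  \<open>i'\<close> and \<open>p'\<close>.
\<close>

lemma opposite: "opposite_parabolics scale Basis bracket h b' p' l' n' b p l n"
  by unfold_locales (use borels in blast)

text \<open>
  The nilpotent radicals lie in the Borel subalgebras, whose intersection \<open>h\<close> meets \<open>n\<close> trivially.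
\<close>

lemma n_inter_n': "n \<inter> n' = {0}"
proof -
  have "n \<inter> n' \<subseteq> h" using P.n_subset_borel P'.n_subset_borel borels by blast
  then show ?thesis
    using P.h_inter_n subspace_0[OF P.n_ideal(1)] subspace_0[OF P'.n_ideal(1)] by blast
qed

lemma p_inter_p'_decomp:
  assumes x: "x \<in> p" "x \<in> p'"
  shows "\<exists>a\<in>l \<inter> l'. \<exists>c\<in>n \<inter> l'. \<exists>d\<in>l \<inter> n'. x = a + c + d"
proof -
  have sub: "subspace (l \<inter> l')" "subspace (n \<inter> l')" "subspace (l \<inter> n')"
    by (intro subspace_inter P.l_sub P'.l_sub P.n_ideal P'.n_ideal)+
  have "p \<inter> p' \<subseteq> span (p \<inter> p' \<inter> weight_vectors)"
    by (rule stable_subspace_weight_vectors)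
      (use P.p_sub P'.p_sub P.h_p P'.h_p in \<open>auto intro: subspace_inter\<close>)
  also have "\<dots> \<subseteq> span ((l \<inter> l') \<union> ((n \<inter> l') \<union> (l \<inter> n')))"
  proof (rule span_mono, rule subsetI)
    fix v assume v: "v \<in> p \<inter> p' \<inter> weight_vectors"
    then obtain \<alpha> where \<alpha>: "v \<in> weight_space h \<alpha>" unfolding weight_vectors_def by blast
    have "v \<in> l \<or> v \<in> n" "v \<in> l' \<or> v \<in> n'"
      using v \<alpha> P.weight_vector_in_l_or_n P'.weight_vector_in_l_or_n by auto
    moreover have "v \<in> l \<inter> l'" if "v \<in> n \<inter> n'"
      using that n_inter_n' subspace_0[OF P.l_sub(1)] subspace_0[OF P'.l_sub(1)] by simp
    ultimately show "v \<in> (l \<inter> l') \<union> ((n \<inter> l') \<union> (l \<inter> n'))" by auto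
  qed
  also have "\<dots> = {x + y |x y. x \<in> l \<inter> l' \<and> y \<in> {x + y |x y. x \<in> n \<inter> l' \<and> y \<in> l \<inter> n'}}"
    by (simp only: span_Un sub[THEN span_eq_iff[THEN iffD2]])
  finally have "x \<in> {x + y |x y. x \<in> l \<inter> l' \<and> y \<in> {x + y |x y. x \<in> n \<inter> l' \<and> y \<in> l \<inter> n'}}"
    using x by blast
  then obtain a c d where "a \<in> l \<inter> l'" "c \<in> n \<inter> l'" "d \<in> l \<inter> n'" "x = a + (c + d)" by blast
  then show ?thesis by (metis add.assoc)
qed

lemma l_inter_p'_decomp:
  assumes x: "x \<in> l" "x \<in> p'"
  shows "\<exists>a\<in>l \<inter> l'. \<exists>d\<in>l \<inter> n'. x = a + d"
proof -
  obtain a c d where acd: "a \<in> l \<inter> l'" "c \<in> n \<inter> l'" "d \<in> l \<inter> n'" "x = a + c + d"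
    using p_inter_p'_decomp[OF _ x(2)] x(1) P.l_p by blast
  have "c = x - a - d" using acd by simp
  moreover have "x - a - d \<in> l" using acd x(1) by (intro subspace_diff P.l_sub(1)) auto
  ultimately have "c = 0" using P.l_inter_n acd(2) by blast
  then show ?thesis using acd by auto
qed

end

section \<open>Real bilinear forms and Lagrangian subspaces\<close>

lemma sum_mult_delta:
  fixes g :: "'b \<Rightarrow> 'c::semiring_1"
  assumes "finite A" "a \<in> A"
  shows "(\<Sum>x\<in>A. g x * (if x = a then 1 else 0)) = g a"
proof -
  have "(\<Sum>x\<in>A. g x * (if x = a then 1 else 0)) = (\<Sum>x\<in>{a}. g x * (if x = a then 1 else 0))"
    using assms by (intro sum.mono_neutral_right) auto
  then show ?thesis by simp
qed

locale real_form_space = finite_dimensional_vector_space scale Basis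
  for scale :: "real \<Rightarrow> 'a::ab_group_add \<Rightarrow> 'a" (infixr "*s" 75) and Basis :: "'a set" +
  fixes R :: "'a \<Rightarrow> 'a \<Rightarrow> real"
  assumes form_add_left: "R (x + y) z = R x z + R y z"
    and form_scale_left: "R (c *s x) y = c * R x y"
    and form_sym: "R x y = R y x"
begin

lemma form_add_right: "R z (x + y) = R z x + R z y"
  using form_add_left form_sym by metis

lemma form_scale_right: "R y (c *s x) = c * R y x"
  using form_scale_left form_sym by metis

lemma form_zero [simp]: "R 0 y = 0" "R y 0 = 0"
  using form_scale_left[of 0 0 y] form_scale_right[of y 0 0] by simp_all

lemma form_minus_left: "R (- x) y = - R x y"
  using form_add_left[of x "- x" y] by simp

lemma form_diff_left: "R (x - y) z = R x z - R y z"
  using form_add_left[of x "- y" z] form_minus_left[of y z] by simp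

lemma form_diff_right: "R z (x - y) = R z x - R z y"
  using form_diff_left form_sym by metis

lemmas form_simps = form_add_left form_add_right form_diff_left form_diff_right
  form_scale_left form_scale_right

lemma form_sum_left: "R (\<Sum>a\<in>A. f a) y = (\<Sum>a\<in>A. R (f a) y)"
  by (induction A rule: infinite_finite_induct) (simp_all add: form_add_left)

lemma form_sum_right: "R y (\<Sum>a\<in>A. f a) = (\<Sum>a\<in>A. R y (f a))"
  by (induction A rule: infinite_finite_induct) (simp_all add: form_add_right)

lemma form_span_zero:
  assumes "y \<in> span S" "\<And>s. s \<in> S \<Longrightarrow> R x s = 0" shows "R x y = 0"
  using assms(1) by (induction rule: span_induct_alt) (simp_all add: assms(2) form_simps)

text \<open>
  When \<open>q\<close> is added to \<open>F\<close>, subtracting combinations of the vectors dual to \<open>F\<close> makes an element of \<open>P\<close>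
  orthogonal to \<open>F\<close>. Some such element does not annihilate \<open>q\<close>: otherwise \<open>q\<close> minus a combination
  of \<open>F\<close> would be annihilated by all of \<open>P\<close>.
\<close>

lemma dual_family:
  assumes "finite Q" "independent Q" "subspace P"
    and "\<And>q. q \<in> span Q \<Longrightarrow> (\<And>p. p \<in> P \<Longrightarrow> R p q = 0) \<Longrightarrow> q = 0"
  shows "\<exists>w. (\<forall>q\<in>Q. w q \<in> P) \<and> (\<forall>q\<in>Q. \<forall>q'\<in>Q. R (w q) q' = (if q = q' then 1 else 0))"
  using assms
proof (induction Q rule: finite_induct)
  case empty then show ?case by simp
next
  case (insert q F)
  have indF: "independent F" using insert.prems(1) by (rule independent_mono) blast
  have spF: "span F \<subseteq> span (insert q F)" by (rule span_mono) blast
  have "\<exists>w. (\<forall>q\<in>F. w q \<in> P) \<and> (\<forall>q\<in>F. \<forall>q'\<in>F. R (w q) q' = (if q = q' then 1 else 0))"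
    by (rule insert.IH[OF indF insert.prems(2)]) (use spF insert.prems(3) in blast)
  then obtain w where w: "\<And>f. f \<in> F \<Longrightarrow> w f \<in> P"
    "\<And>f f'. f \<in> F \<Longrightarrow> f' \<in> F \<Longrightarrow> R (w f) f' = (if f = f' then 1 else 0)" by metis
  define y where "y = q - (\<Sum>f\<in>F. R (w f) q *s f)"
  have "q \<notin> span F" using insert.prems(1) insert.hyps by (simp add: independent_insert)
  moreover have "(\<Sum>f\<in>F. R (w f) q *s f) \<in> span F" by (intro span_sum span_scale span_base)
  ultimately have y0: "y \<noteq> 0" unfolding y_def by auto
  have "y \<in> span (insert q F)" unfolding y_def
    by (intro span_diff span_sum span_scale) (auto intro: span_base)
  then obtain p where p: "p \<in> P" "R p y \<noteq> 0" using insert.prems(3) y0 by blast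
  define p' where "p' = p - (\<Sum>f\<in>F. R p f *s w f)"
  have p'P: "p' \<in> P" unfolding p'_def
    using p(1) w(1) insert.prems(2) by (intro subspace_diff subspace_sum subspace_scale) auto
  have p'F: "R p' f = 0" if f: "f \<in> F" for f
  proof -
    have "R (\<Sum>f'\<in>F. R p f' *s w f') f = (\<Sum>f'\<in>F. R p f' * (if f' = f then 1 else 0))"
      unfolding form_sum_left form_scale_left by (intro sum.cong refl) (simp add: w(2) f)
    also have "\<dots> = R p f" by (rule sum_mult_delta[OF insert.hyps(1) f])
    finally show ?thesis by (simp add: p'_def form_diff_left)
  qed
  have p'q: "R p' q = R p y"
    by (simp add: p'_def y_def form_diff_left form_diff_right form_sum_left form_sum_right
        form_scale_left form_scale_right mult.commute)
  define v where "v = (1 / R p y) *s p'"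
  have v: "v \<in> P" "R v q = 1" "\<And>f. f \<in> F \<Longrightarrow> R v f = 0"
    using p'P p'F p'q p(2) insert.prems(2) by (simp_all add: v_def form_scale_left subspace_scale)
  define w' where "w' x = (if x = q then v else w x - R (w x) q *s v)" for x
  have "\<forall>x\<in>insert q F. w' x \<in> P"
    using v w insert.prems(2) by (auto simp: w'_def intro!: subspace_diff subspace_scale)
  moreover have "\<forall>x\<in>insert q F. \<forall>x'\<in>insert q F. R (w' x) x' = (if x = x' then 1 else 0)"
    using v w insert.hyps(2) by (auto simp: w'_def form_diff_left form_scale_left)
  ultimately show ?case by blast
qed

lemma independent_orthogonal:
  assumes E: "finite E" and orth: "\<And>x y. x \<in> E \<Longrightarrow> y \<in> E \<Longrightarrow> x \<noteq> y \<Longrightarrow> R x y = 0"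
    and nz: "\<And>x. x \<in> E \<Longrightarrow> R x x \<noteq> 0"
  shows "independent E"
proof
  assume "dependent E"
  then obtain u v where u: "v \<in> E" "u v \<noteq> 0" "(\<Sum>e\<in>E. u e *s e) = 0"
    using E by (auto simp: dependent_finite)
  have "(\<Sum>e\<in>E. u e * R e v) = R (\<Sum>e\<in>E. u e *s e) v" by (simp add: form_sum_left form_scale_left)
  then have "(\<Sum>e\<in>E. u e * R e v) = 0" using u by simp
  moreover have "(\<Sum>e\<in>E. u e * R e v) = (\<Sum>e\<in>{v}. u e * R e v)"
    using E u(1) orth by (intro sum.mono_neutral_right) auto
  ultimately show False using u nz by simp
qed

text \<open>
  If \<open>x\<close> were not in \<open>i\<close>, then a basis of \<open>i\<close>, the vector \<open>x\<close>, and the vectors dual to the basis would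
  be \<open>2 * dim i + 1\<close> independent vectors.
\<close>

lemma lagrangian_maximal:
  assumes i: "subspace i" "\<And>x y. x \<in> i \<Longrightarrow> y \<in> i \<Longrightarrow> R x y = 0" "2 * dim i = card Basis"
    and nondeg: "\<And>x. (\<And>y. R x y = 0) \<Longrightarrow> x = 0"
    and x: "\<And>y. y \<in> i \<Longrightarrow> R x y = 0"
  shows "x \<in> i"
proof (rule ccontr)
  assume xi: "x \<notin> i"
  obtain Q where Q: "Q \<subseteq> i" "independent Q" "i \<subseteq> span Q" "card Q = dim i"
    by (rule basis_exists)
  have spQ: "span Q = i" using Q i(1) span_minimal by blast
  have finQ: "finite Q" using Q(2) by (rule finiteI_independent)
  have "q = 0" if "\<And>p. p \<in> UNIV \<Longrightarrow> R p q = 0" for q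
    using nondeg[of q] that form_sym by simp
  then obtain w where w: "\<And>q q'. q \<in> Q \<Longrightarrow> q' \<in> Q \<Longrightarrow> R (w q) q' = (if q = q' then 1 else 0)"
    using dual_family[OF finQ Q(2) subspace_UNIV] by metis
  let ?P = "insert x Q"
  have indP: "independent ?P" using Q(2) xi spQ by (intro independent_insertI) auto
  have finP: "finite ?P" using finQ by simp
  have PQ: "R v q = 0" if "v \<in> ?P" "q \<in> Q" for v q using that x i(2) Q(1) by auto
  have inj: "inj_on w Q" by (rule inj_onI) (metis w zero_neq_one)
  have disj: "?P \<inter> w ` Q = {}"
  proof (rule ccontr)
    assume "?P \<inter> w ` Q \<noteq> {}"
    then obtain q where "q \<in> Q" "w q \<in> ?P" by blast
    then show False using PQ[of "w q" q] w[of q q] by simp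
  qed
  have "independent (?P \<union> w ` Q)"
  proof
    assume "dependent (?P \<union> w ` Q)"
    then obtain u v where u: "v \<in> ?P \<union> w ` Q" "u v \<noteq> 0" "(\<Sum>e\<in>?P \<union> w ` Q. u e *s e) = 0"
      using finQ dependent_finite[of "?P \<union> w ` Q"] by auto
    have s: "(\<Sum>e\<in>?P. u e *s e) + (\<Sum>q\<in>Q. u (w q) *s w q) = 0"
      using u(3) sum.union_disjoint[OF finP finite_imageI[OF finQ] disj, of "\<lambda>e. u e *s e"]
        sum.reindex[OF inj, of "\<lambda>e. u e *s e"] by (simp del: sum.insert)
    have uw: "u (w q) = 0" if q: "q \<in> Q" for q
    proof -
      have "R ((\<Sum>e\<in>?P. u e *s e) + (\<Sum>q\<in>Q. u (w q) *s w q)) q = 0" unfolding s by simp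
      moreover have "R (\<Sum>e\<in>?P. u e *s e) q = 0"
        unfolding form_sum_left form_scale_left by (rule sum.neutral) (use PQ[OF _ q] in simp)
      moreover have "R (\<Sum>q\<in>Q. u (w q) *s w q) q = (\<Sum>q'\<in>Q. u (w q') * (if q' = q then 1 else 0))"
        unfolding form_sum_left form_scale_left by (intro sum.cong refl) (simp add: w q)
      ultimately show ?thesis by (simp only: form_add_left sum_mult_delta[OF finQ q] add_0)
    qed
    then have "(\<Sum>e\<in>?P. u e *s e) = 0" using s by simp
    then have "u v = 0" if "v \<in> ?P" using independentD[OF indP finP _ _ that] by blast
    then show False using u uw by blast
  qed
  then have "card (?P \<union> w ` Q) \<le> card Basis"
    using independent_card_le_dim[of "?P \<union> w ` Q" UNIV] by (simp add: dimension_def)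
  moreover have "card (?P \<union> w ` Q) = Suc (2 * dim i)"
  proof -
    have "x \<notin> Q" using xi Q(1) by blast
    then show ?thesis
      using card_Un_disjoint[OF finP finite_imageI[OF finQ] disj] card_image[OF inj] Q(4) finQ by simp
  qed
  ultimately show False using i(3) by simp
qed

text \<open>
  On a sum of two isotropic subspaces in duality, the vectors \<open>q \<plusminus> w q\<close>, for a basis \<open>q\<close> of the
  first subspace with dual basis \<open>w q\<close> in the second, form an orthogonal basis.
\<close>

lemma hyperbolic_basis:
  assumes A: "subspace A" and C: "subspace C"
    and isoA: "\<And>x y. x \<in> A \<Longrightarrow> y \<in> A \<Longrightarrow> R x y = 0"
    and isoC: "\<And>x y. x \<in> C \<Longrightarrow> y \<in> C \<Longrightarrow> R x y = 0"
    and nondeg: "\<And>x. x \<in> {a + c |a c. a \<in> A \<and> c \<in> C} \<Longrightarrow>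
        (\<And>y. y \<in> {a + c |a c. a \<in> A \<and> c \<in> C} \<Longrightarrow> R x y = 0) \<Longrightarrow> x = 0"
  shows "\<exists>E. finite E \<and> independent E \<and> span E = {a + c |a c. a \<in> A \<and> c \<in> C} \<and>
     (\<forall>x\<in>E. \<forall>y\<in>E. x \<noteq> y \<longrightarrow> R x y = 0) \<and>
     2 * card {x\<in>E. R x x > 0} = card E \<and> 2 * card {x\<in>E. R x x < 0} = card E"
proof -
  let ?L = "{a + c |a c. a \<in> A \<and> c \<in> C}"
  have L: "subspace ?L" using A C by (rule subspace_sums)
  have AL: "x \<in> ?L" if "x \<in> A" for x
    using that subspace_0[OF C] by (intro CollectI exI[of _ x] exI[of _ 0]) simp
  have CL: "x \<in> ?L" if "x \<in> C" for x
    using that subspace_0[OF A] by (intro CollectI exI[of _ 0] exI[of _ x]) simp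
  obtain Q where Q: "Q \<subseteq> A" "independent Q" "A \<subseteq> span Q" "card Q = dim A" by (rule basis_exists)
  have spQ: "span Q = A" using Q A span_minimal by blast
  have finQ: "finite Q" using Q(2) by (rule finiteI_independent)
  have "q = 0" if q: "q \<in> span Q" "\<And>p. p \<in> C \<Longrightarrow> R p q = 0" for q
  proof (rule nondeg)
    have qA: "q \<in> A" using q spQ by simp
    then show "q \<in> ?L" by (rule AL)
    fix y assume "y \<in> ?L"
    then obtain a c where "y = a + c" "a \<in> A" "c \<in> C" by blast
    then show "R q y = 0" using isoA[OF qA] q(2)[of c] form_sym[of q c] by (simp add: form_add_right)
  qed
  then obtain w where wC: "\<And>q. q \<in> Q \<Longrightarrow> w q \<in> C"
    and w: "\<And>q q'. q \<in> Q \<Longrightarrow> q' \<in> Q \<Longrightarrow> R (w q) q' = (if q = q' then 1 else 0)"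
    using dual_family[OF finQ Q(2) C] by metis
  have w': "R q' (w q) = (if q = q' then 1 else 0)" if "q \<in> Q" "q' \<in> Q" for q q'
    using w[OF that] form_sym by simp
  define P where "P = (\<lambda>q. q + w q) ` Q"
  define M where "M = (\<lambda>q. q - w q) ` Q"
  have zeros: "R q q' = 0" "R (w q) (w q') = 0" if "q \<in> Q" "q' \<in> Q" for q q'
    using isoA isoC wC Q(1) that by blast+
  have pp: "R (q + w q) (q' + w q') = (if q = q' then 2 else 0)" if "q \<in> Q" "q' \<in> Q" for q q'
    using that by (simp add: form_add_left form_add_right zeros w w')
  have mm: "R (q - w q) (q' - w q') = (if q = q' then - 2 else 0)" if "q \<in> Q" "q' \<in> Q" for q q'
    using that by (simp add: form_diff_left form_diff_right zeros w w')
  have pm: "R (q + w q) (q' - w q') = 0" if "q \<in> Q" "q' \<in> Q" for q q'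
    using that by (simp add: form_add_left form_diff_right zeros w w')
  have injP: "inj_on (\<lambda>q. q + w q) Q"
  proof (rule inj_onI, rule ccontr)
    fix q q' assume "q \<in> Q" "q' \<in> Q" "q + w q = q' + w q'" "q \<noteq> q'"
    then show False using pp[of q q'] pp[of q q] by simp
  qed
  have injM: "inj_on (\<lambda>q. q - w q) Q"
  proof (rule inj_onI, rule ccontr)
    fix q q' assume "q \<in> Q" "q' \<in> Q" "q - w q = q' - w q'" "q \<noteq> q'"
    then show False using mm[of q q'] mm[of q q] by simp
  qed
  have P: "R e e = 2" if "e \<in> P" for e using that pp unfolding P_def by auto
  have M: "R e e = - 2" if "e \<in> M" for e using that mm unfolding M_def by auto
  have PM: "P \<inter> M = {}" using P M by fastforce
  have fin: "finite P" "finite M" using finQ by (simp_all add: P_def M_def)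
  have card: "card P = card Q" "card M = card Q"
    by (simp_all add: P_def M_def card_image injP injM)
  have orth: "R x y = 0" if xy: "x \<in> P \<union> M" "y \<in> P \<union> M" "x \<noteq> y" for x y
  proof -
    consider "x \<in> P" "y \<in> P" | "x \<in> P" "y \<in> M" | "x \<in> M" "y \<in> P" | "x \<in> M" "y \<in> M"
      using xy by blast
    then show ?thesis
    proof cases
      case 1 then show ?thesis using pp xy(3) unfolding P_def by auto
    next
      case 2 then show ?thesis using pm unfolding P_def M_def by auto
    next
      case 3 then show ?thesis using pm form_sym[of x y] unfolding P_def M_def by auto
    next
      case 4 then show ?thesis using mm xy(3) unfolding M_def by auto
    qed
  qed
  have ind: "independent (P \<union> M)"
  proof (rule independent_orthogonal)
    show "R x x \<noteq> 0" if "x \<in> P \<union> M" for x using that P M by fastforce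
  qed (use fin orth in auto)
  have "q + w q \<in> ?L \<and> q - w q \<in> ?L" if q: "q \<in> Q" for q
  proof -
    have "q \<in> ?L" "w q \<in> ?L" using AL[of q] CL[OF wC[OF q]] Q(1) q by blast+
    then show ?thesis using subspace_add[OF L] subspace_diff[OF L] by blast
  qed
  then have inL: "P \<union> M \<subseteq> ?L" unfolding P_def M_def by blast
  have half: "q \<in> span (P \<union> M)" "w q \<in> span (P \<union> M)" if q: "q \<in> Q" for q
  proof -
    have b: "q + w q \<in> span (P \<union> M)" "q - w q \<in> span (P \<union> M)"
      using q by (auto intro!: span_base simp: P_def M_def)
    have two: "x + x = 2 *s x" for x using scale_left_distrib[of 1 1 x] by simp
    have "q = (1/2) *s ((q + w q) + (q - w q))" using two[of q] by simp
    then show "q \<in> span (P \<union> M)" using b by (metis span_add span_scale)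
    have "w q = (1/2) *s ((q + w q) - (q - w q))" using two[of "w q"] by simp
    then show "w q \<in> span (P \<union> M)" using b by (metis span_diff span_scale)
  qed
  have "A \<subseteq> span (P \<union> M)" using half(1) spQ span_minimal[of Q "span (P \<union> M)"] by auto
  moreover have "C \<subseteq> span (P \<union> M)"
  proof
    fix c assume c: "c \<in> C"
    define s where "s = (\<Sum>q\<in>Q. R c q *s w q)"
    have sC: "s \<in> C" unfolding s_def using C wC by (intro subspace_sum subspace_scale) auto
    have cs: "c - s \<in> C" using C c sC by (rule subspace_diff)
    have csQ: "R (c - s) q = 0" if q: "q \<in> Q" for q
    proof -
      have "R s q = (\<Sum>q'\<in>Q. R c q' * (if q' = q then 1 else 0))"
        unfolding s_def form_sum_left form_scale_left by (intro sum.cong refl) (simp add: w q)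
      then show ?thesis by (simp only: form_diff_left sum_mult_delta[OF finQ q] diff_self)
    qed
    have "c - s = 0"
    proof (rule nondeg)
      show "c - s \<in> ?L" using cs by (rule CL)
      fix y assume "y \<in> ?L"
      then obtain a d where y: "y = a + d" "a \<in> A" "d \<in> C" by blast
      have "R (c - s) a = 0" by (rule form_span_zero[of a Q]) (use csQ spQ y in auto)
      then show "R (c - s) y = 0" using isoC[OF cs y(3)] y(1) by (simp add: form_add_right)
    qed
    then have "c = s" by simp
    also have "s \<in> span (P \<union> M)" unfolding s_def by (intro span_sum span_scale half)
    finally show "c \<in> span (P \<union> M)" .
  qed
  ultimately have "?L \<subseteq> span (P \<union> M)" by (auto intro: span_add)
  then have "span (P \<union> M) = ?L" using span_minimal[OF inL L] by blast
  moreover have "{x \<in> P \<union> M. R x x > 0} = P" "{x \<in> P \<union> M. R x x < 0} = M" using P M by fastforce+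
  moreover have "card (P \<union> M) = 2 * card Q" using card_Un_disjoint[OF fin PM] card by simp
  ultimately show ?thesis using fin ind orth card by (intro exI[of _ "P \<union> M"]) auto
qed

lemma nondegenerate_if_orthogonal_basis:
  assumes E: "finite E" "span E = UNIV"
    and orth: "\<And>x y. x \<in> E \<Longrightarrow> y \<in> E \<Longrightarrow> x \<noteq> y \<Longrightarrow> R x y = 0"
    and nz: "\<And>x. x \<in> E \<Longrightarrow> R x x \<noteq> 0"
    and x: "\<And>y. R x y = 0"
  shows "x = 0"
proof -
  have "independent E" using independent_orthogonal[OF E(1) orth nz] .
  then have xs: "x = (\<Sum>e\<in>E. representation E x e *s e)"
    using sum_representation_eq[of E x E] E by simp
  have "representation E x e = 0" if e: "e \<in> E" for e
  proof -
    have "0 = R (\<Sum>e\<in>E. representation E x e *s e) e" using xs x by metis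
    also have "\<dots> = (\<Sum>e'\<in>E. representation E x e' * R e' e)"
      by (simp add: form_sum_left form_scale_left)
    also have "\<dots> = (\<Sum>e'\<in>{e}. representation E x e' * R e' e)"
      using E(1) e orth by (intro sum.mono_neutral_right) auto
    finally show ?thesis using nz[OF e] by simp
  qed
  then have "(\<Sum>e\<in>E. representation E x e *s e) = 0" by simp
  then show ?thesis using xs by simp
qed

end

section \<open>Real dimension of a complex space\<close>

lemma complex_scale_split: "c *\<^sub>C (x::'g::complex_lie_algebra) = Re c *\<^sub>R x + Im c *\<^sub>R (\<i> *\<^sub>C x)"
proof -
  have "c *\<^sub>C x = (complex_of_real (Re c) + complex_of_real (Im c) * \<i>) *\<^sub>C x"
    by (simp add: complex_eq mult.commute)
  then show ?thesis by (simp only: scaleC_add_left scaleR_scaleC scaleC_scaleC)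
qed

lemma cx_subspace_imp_real: "cx.subspace W \<Longrightarrow> subspace (W :: 'g::complex_lie_algebra set)"
  by (rule real_vector.subspaceI) (auto simp: scaleR_scaleC cx.subspace_0 cx.subspace_add cx.subspace_scale)

text \<open>A complex coefficient of \<open>e\<close> is the same as real coefficients of \<open>e\<close> and \<open>\<i> e\<close>.\<close>

lemma real_basis_of_complex:
  fixes E :: "'g::complex_lie_algebra set"
  assumes E: "finite E" "cx.independent E"
  shows "independent (E \<union> scaleC \<i> ` E) \<and> span (E \<union> scaleC \<i> ` E) = cx.span E
     \<and> card (E \<union> scaleC \<i> ` E) = 2 * card E"
proof -
  let ?I = "scaleC \<i> :: 'g \<Rightarrow> 'g"
  have inj: "inj_on ?I E" by (rule inj_onI) simp
  have ni: "\<i> *\<^sub>C e \<notin> E" if e: "e \<in> E" for e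
  proof
    assume ie: "\<i> *\<^sub>C e \<in> E"
    have e0: "e \<noteq> 0" using E(2) e cx.dependent_zero by blast
    have "\<i> *\<^sub>C e \<noteq> e" using e0 cx.scale_cancel_right[of "\<i>" e 1] by simp
    moreover have "\<i> *\<^sub>C e \<in> cx.span (E - {\<i> *\<^sub>C e})"
      using e calculation by (intro cx.span_scale cx.span_base) auto
    ultimately show False using ie E(2) cx.dependent_def by blast
  qed
  have disj: "E \<inter> ?I ` E = {}" using ni by auto
  have sums: "(\<Sum>v\<in>E \<union> ?I ` E. u v *\<^sub>R v) = (\<Sum>e\<in>E. Complex (u e) (u (\<i> *\<^sub>C e)) *\<^sub>C e)" for u
  proof -
    have "(\<Sum>v\<in>E \<union> ?I ` E. u v *\<^sub>R v) = (\<Sum>e\<in>E. u e *\<^sub>R e) + (\<Sum>e\<in>E. u (\<i> *\<^sub>C e) *\<^sub>R (\<i> *\<^sub>C e))"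
      by (simp only: sum.union_disjoint[OF E(1) finite_imageI[OF E(1)] disj] sum.reindex[OF inj] o_def)
    also have "\<dots> = (\<Sum>e\<in>E. Complex (u e) (u (\<i> *\<^sub>C e)) *\<^sub>C e)"
      by (simp add: complex_scale_split[of "Complex _ _"] sum.distrib)
    finally show ?thesis .
  qed
  have "independent (E \<union> ?I ` E)"
  proof
    assume "dependent (E \<union> ?I ` E)"
    then obtain u v where u: "v \<in> E \<union> ?I ` E" "u v \<noteq> 0" "(\<Sum>v\<in>E \<union> ?I ` E. u v *\<^sub>R v) = 0"
      using E(1) real_vector.dependent_finite[of "E \<union> ?I ` E"] by auto
    then have "(\<Sum>e\<in>E. Complex (u e) (u (\<i> *\<^sub>C e)) *\<^sub>C e) = 0" using sums by simp
    then have z: "Complex (u e) (u (\<i> *\<^sub>C e)) = 0" if "e \<in> E" for e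
      using cx.independentD[OF E(2,1) order_refl _ that, of "\<lambda>e. Complex (u e) (u (\<i> *\<^sub>C e))"] by simp
    then have "u e = 0 \<and> u (\<i> *\<^sub>C e) = 0" if "e \<in> E" for e
      using z[OF that] by (simp add: complex_eq_iff)
    then show False using u by auto
  qed
  moreover have "span (E \<union> ?I ` E) = cx.span E"
  proof
    show "span (E \<union> ?I ` E) \<subseteq> cx.span E"
      by (rule real_vector.span_minimal[OF _ cx_subspace_imp_real])
        (auto intro: cx.span_base cx.span_scale)
    show "cx.span E \<subseteq> span (E \<union> ?I ` E)"
    proof
      fix x assume "x \<in> cx.span E"
      then show "x \<in> span (E \<union> ?I ` E)"
      proof (induction rule: cx.span_induct_alt)
        case (step c e y)
        have "c *\<^sub>C e \<in> span (E \<union> ?I ` E)"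
          unfolding complex_scale_split[of c e] using step(1)
          by (intro real_vector.span_add real_vector.span_scale real_vector.span_base) auto
        then show ?case using step by (intro real_vector.span_add)
      qed (rule real_vector.span_zero)
    qed
  qed
  moreover have "card (E \<union> ?I ` E) = 2 * card E"
    using card_Un_disjoint[OF E(1) finite_imageI[OF E(1)] disj] card_image[OF inj] by simp
  ultimately show ?thesis by blast
qed

lemma re_lie_subalgebra_iff:
  "re.lie_subalgebra L \<longleftrightarrow> subspace L \<and> (\<forall>x\<in>L. \<forall>y\<in>L. lie_bracket x y \<in> L)"
  by (simp add: re.lie_subalgebra_def subspace_raw_def)

section \<open>The predecessor construction\<close>

text \<open>
  The subspaces \<open>i1\<close> and \<open>i1'\<close> of the theorem (see \<open>weight_proj_image\<close>), described without the
  projection: the components in \<open>l \<inter> l'\<close> of the elements of \<open>i \<inter> ((l \<inter> l') + (l \<inter> n'))\<close>.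
\<close>

definition levi_projection :: "'a::ab_group_add set \<Rightarrow> 'a set \<Rightarrow> 'a set \<Rightarrow> 'a set \<Rightarrow> 'a set" where
  "levi_projection l l' n' i = {y \<in> l \<inter> l'. \<exists>u\<in>l \<inter> n'. y + u \<in> i}"

context opposite_parabolics
begin

lemma weight_proj_image:
  "weight_proj h n' ` (i \<inter> l \<inter> p') = levi_projection l l' n' i"
proof
  show "weight_proj h n' ` (i \<inter> l \<inter> p') \<subseteq> levi_projection l l' n' i"
  proof
    fix y assume "y \<in> weight_proj h n' ` (i \<inter> l \<inter> p')"
    then obtain x where x: "x \<in> i" "x \<in> l" "x \<in> p'" "y = weight_proj h n' x" by blast
    obtain a d where ad: "a \<in> l \<inter> l'" "d \<in> l \<inter> n'" "x = a + d" using l_inter_p'_decomp x by blast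
    have "y = a" unfolding x(4) ad(3) by (rule P'.weight_proj_levi) (use ad in auto)
    then show "y \<in> levi_projection l l' n' i" unfolding levi_projection_def using ad x(1) by blast
  qed
  show "levi_projection l l' n' i \<subseteq> weight_proj h n' ` (i \<inter> l \<inter> p')"
  proof
    fix y assume "y \<in> levi_projection l l' n' i"
    then obtain u where u: "y \<in> l \<inter> l'" "u \<in> l \<inter> n'" "y + u \<in> i" unfolding levi_projection_def by blast
    have "y + u \<in> l" using u by (intro subspace_add P.l_sub) auto
    moreover have "y + u \<in> p'" using u P'.l_p P'.n_ideal(2) by (intro subspace_add P'.p_sub) auto
    moreover have "weight_proj h n' (y + u) = y" using u by (intro P'.weight_proj_levi) auto
    ultimately show "y \<in> weight_proj h n' ` (i \<inter> l \<inter> p')" using u(3) by (intro image_eqI[of _ _ "y + u"]) auto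
  qed
qed

text \<open>
  Uniqueness of the component in \<open>l \<inter> l'\<close>.
\<close>

lemma decomp_zero:
  assumes "y \<in> l \<inter> l'" "c \<in> n \<inter> l'" "d \<in> l \<inter> n'" "y = c + d"
  shows "y = 0"
proof -
  have "y - d \<in> l" using assms by (intro subspace_diff P.l_sub) auto
  then have "c = 0" using assms P.l_inter_n by auto
  then show ?thesis using assms P'.l_inter_n by auto
qed

text \<open>
  Both directions rest on the decomposition of \<open>p \<inter> p'\<close>: for \<open>x \<in> i \<inter> p'\<close> with components \<open>a\<close>, \<open>c\<close>,
  \<open>d\<close> in \<open>l \<inter> l'\<close>, \<open>n \<inter> l'\<close>, \<open>l \<inter> n'\<close>, the component \<open>a\<close> lies in the projection of \<open>i\<close>, because
  \<open>a + d = x - c\<close> and \<open>c \<in> n \<subseteq> i\<close>.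
\<close>

lemma direct_sum_iff:
  assumes i: "0 \<in> i" "\<And>x y. x \<in> i \<Longrightarrow> y \<in> i \<Longrightarrow> x - y \<in> i" "n \<subseteq> i" "i \<subseteq> p"
    and i': "0 \<in> i'" "\<And>x y. x \<in> i' \<Longrightarrow> y \<in> i' \<Longrightarrow> x - y \<in> i'" "n' \<subseteq> i'" "i' \<subseteq> p'"
    and dims: "i \<inter> i' = {0} \<Longrightarrow> UNIV = {a + c |a c. a \<in> i \<and> c \<in> i'}"
  shows "is_direct_sum UNIV i i' \<longleftrightarrow>
    is_direct_sum (l \<inter> l') (levi_projection l l' n' i) (levi_projection l' l n i') \<and>
    n \<inter> (i' \<inter> commutator l' l') = {0} \<and> n' \<inter> (i \<inter> commutator l l) = {0}"
    (is "_ \<longleftrightarrow> is_direct_sum _ ?i1 ?i1' \<and> ?N \<and> ?N'")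
proof -
  have add: "x + y \<in> i" if "x \<in> i" "y \<in> i" for x y using i(2)[OF that(1) i(2)[OF i(1) that(2)]] by simp
  have add': "x + y \<in> i'" if "x \<in> i'" "y \<in> i'" for x y using i'(2)[OF that(1) i'(2)[OF i'(1) that(2)]] by simp
  have in1: "a \<in> ?i1" if "x \<in> i" "a \<in> l \<inter> l'" "c \<in> n \<inter> l'" "d \<in> l \<inter> n'" "x = a + c + d" for x a c d
  proof -
    have "a + d = x - c" using that by simp
    also have "\<dots> \<in> i" using i(2,3) that by blast
    finally show ?thesis unfolding levi_projection_def using that by blast
  qed
  have in1': "a \<in> ?i1'" if "x \<in> i'" "a \<in> l \<inter> l'" "c \<in> n \<inter> l'" "d \<in> l \<inter> n'" "x = a + c + d" for x a c d
  proof -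
    have "a + c = x - d" using that by simp
    also have "\<dots> \<in> i'" using i'(2,3) that by blast
    finally show ?thesis unfolding levi_projection_def using that by blast
  qed
  have zero1: "0 \<in> ?i1" "0 \<in> ?i1'" unfolding levi_projection_def
    using i(1) i'(1) subspace_0[OF P.l_sub(1)] subspace_0[OF P'.l_sub(1)]
      subspace_0[OF P.n_ideal(1)] subspace_0[OF P'.n_ideal(1)] by force+
  show ?thesis
  proof
    assume ds: "is_direct_sum UNIV i i'"
    then have int: "i \<inter> i' = {0}" and sum: "\<And>x. \<exists>a\<in>i. \<exists>c\<in>i'. x = a + c"
      unfolding is_direct_sum_def by blast+
    have "?i1 \<inter> ?i1' = {0}"
    proof -
      have "y = 0" if y: "y \<in> ?i1" "y \<in> ?i1'" for y
      proof -
        obtain u v where uv: "u \<in> l \<inter> n'" "y + u \<in> i" "v \<in> l' \<inter> n" "y + v \<in> i'"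
          using y unfolding levi_projection_def by blast
        have "y + u + v \<in> i" using add[OF uv(2)] uv(3) i(3) by blast
        moreover have "y + v + u \<in> i'" using add'[OF uv(4)] uv(1) i'(3) by blast
        then have "y + u + v \<in> i'" by (simp add: ac_simps)
        ultimately have "y + u + v = 0" using int by blast
        then have "y = - v + - u" by (metis add.commute add.inverse_unique minus_add_distrib add.assoc)
        moreover have "- v \<in> n \<inter> l'" "- u \<in> l \<inter> n'"
          using uv subspace_neg[OF P.n_ideal(1)] subspace_neg[OF P'.n_ideal(1)]
            subspace_neg[OF P.l_sub(1)] subspace_neg[OF P'.l_sub(1)] by auto
        moreover have "y \<in> l \<inter> l'" using y unfolding levi_projection_def by blast
        ultimately show "y = 0" using decomp_zero by blast
      qed
      then show ?thesis using zero1 by blast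
    qed
    moreover have "l \<inter> l' = {a + c |a c. a \<in> ?i1 \<and> c \<in> ?i1'}"
    proof
      show "{a + c |a c. a \<in> ?i1 \<and> c \<in> ?i1'} \<subseteq> l \<inter> l'"
        unfolding levi_projection_def using subspace_add[OF P.l_sub(1)] subspace_add[OF P'.l_sub(1)] by blast
      show "l \<inter> l' \<subseteq> {a + c |a c. a \<in> ?i1 \<and> c \<in> ?i1'}"
      proof
        fix x assume x: "x \<in> l \<inter> l'"
        obtain a c where ac: "a \<in> i" "c \<in> i'" "x = a + c" using sum by blast
        have xp: "x \<in> p" "x \<in> p'" using x P.l_p P'.l_p by auto
        have ap: "a \<in> p" and cp: "c \<in> p'" using ac i(4) i'(4) by auto
        have "x - c \<in> p'" "x - a \<in> p"
          by (rule subspace_diff[OF P'.p_sub(1) xp(2) cp], rule subspace_diff[OF P.p_sub(1) xp(1) ap])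
        then have "a \<in> p'" "c \<in> p" using ac(3) by simp_all
        with ap cp obtain a0 a1 a2 c0 c1 c2 where
          a: "a0 \<in> l \<inter> l'" "a1 \<in> n \<inter> l'" "a2 \<in> l \<inter> n'" "a = a0 + a1 + a2" and
          c: "c0 \<in> l \<inter> l'" "c1 \<in> n \<inter> l'" "c2 \<in> l \<inter> n'" "c = c0 + c1 + c2"
          using p_inter_p'_decomp[of a] p_inter_p'_decomp[of c] by blast
        have "x - (a0 + c0) = (a1 + c1) + (a2 + c2)" using ac(3) a(4) c(4) by (simp add: algebra_simps)
        moreover have "x - (a0 + c0) \<in> l \<inter> l'"
          using x a c by (auto intro!: subspace_diff subspace_add P.l_sub P'.l_sub)
        moreover have "a1 + c1 \<in> n \<inter> l'" "a2 + c2 \<in> l \<inter> n'"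
          using a c by (auto intro!: subspace_add P.l_sub P'.l_sub P.n_ideal(1) P'.n_ideal(1))
        ultimately have "x - (a0 + c0) = 0" by (intro decomp_zero)
        then have "x = a0 + c0" by simp
        then show "x \<in> {a + c |a c. a \<in> ?i1 \<and> c \<in> ?i1'}" using in1[OF ac(1) a] in1'[OF ac(2) c] by blast
      qed
    qed
    moreover have ?N
    proof -
      have "n \<inter> (i' \<inter> commutator l' l') \<subseteq> {0}" using i(3) int by blast
      then show ?thesis
        using subspace_0[OF P.n_ideal(1)] i'(1) subspace_0[OF subspace_commutator] by blast
    qed
    moreover have ?N'
    proof -
      have "n' \<inter> (i \<inter> commutator l l) \<subseteq> {0}" using i'(3) int by blast
      then show ?thesis
        using subspace_0[OF P'.n_ideal(1)] i(1) subspace_0[OF subspace_commutator] by blast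
    qed
    ultimately show "is_direct_sum (l \<inter> l') ?i1 ?i1' \<and> ?N \<and> ?N'" unfolding is_direct_sum_def by blast
  next
    assume R: "is_direct_sum (l \<inter> l') ?i1 ?i1' \<and> ?N \<and> ?N'"
    have "x = 0" if x: "x \<in> i" "x \<in> i'" for x
    proof -
      obtain a c d where acd: "a \<in> l \<inter> l'" "c \<in> n \<inter> l'" "d \<in> l \<inter> n'" "x = a + c + d"
        using p_inter_p'_decomp x i(4) i'(4) by blast
      have "a \<in> ?i1 \<inter> ?i1'" using in1[OF x(1) acd] in1'[OF x(2) acd] by blast
      then have a0: "a = 0" using R unfolding is_direct_sum_def by blast
      have "x - c \<in> i" by (rule i(2)[OF x(1)]) (use acd(2) i(3) in blast)
      moreover have "x - d \<in> i'" by (rule i'(2)[OF x(2)]) (use acd(3) i'(3) in blast)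
      moreover have "x - c = d" "x - d = c" using acd(4) a0 by simp_all
      ultimately have di: "d \<in> i" "c \<in> i'" by (simp_all only:)
      have "d \<in> commutator l l"
        using P'.n_inter_subset_commutator[OF P.l_lie P.h_l] acd(3) by blast
      then have "d = 0" using R di acd by blast
      have "c \<in> commutator l' l'"
        using P.n_inter_subset_commutator[OF P'.l_lie P'.h_l] acd(2) by blast
      then have "c = 0" using R di acd by blast
      show ?thesis using acd(4) a0 \<open>c = 0\<close> \<open>d = 0\<close> by simp
    qed
    then have "i \<inter> i' = {0}" using i(1) i'(1) by blast
    then show "is_direct_sum UNIV i i'" using dims unfolding is_direct_sum_def by blast
  qed
qed

text \<open>
  \<open>l \<inter> n'\<close> is an ideal of \<open>l \<inter> p'\<close>, so the correction terms of the two factors only contribute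
  correction terms.
\<close>

lemma levi_projection_bracket:
  assumes i: "\<And>x y. x \<in> i \<Longrightarrow> y \<in> i \<Longrightarrow> bracket x y \<in> i"
    and x: "x \<in> levi_projection l l' n' i" and y: "y \<in> levi_projection l l' n' i"
  shows "bracket x y \<in> levi_projection l l' n' i"
proof -
  obtain u v where uv: "x \<in> l \<inter> l'" "u \<in> l \<inter> n'" "x + u \<in> i" "y \<in> l \<inter> l'" "v \<in> l \<inter> n'" "y + v \<in> i"
    using x y unfolding levi_projection_def by blast
  have n': "bracket s t \<in> n'" "bracket t s \<in> n'" if "s \<in> p'" "t \<in> n'" for s t
    using P'.n_ideal(3)[OF that] bracket_antisym[of t s] subspace_neg[OF P'.n_ideal(1)] by auto
  have p': "x \<in> p'" "y \<in> p'" "u \<in> p'" using uv P'.l_p P'.n_ideal(2) by auto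
  let ?w = "bracket x v + bracket u y + bracket u v"
  have "?w \<in> l" using uv P.l_sub by (intro subspace_add) auto
  moreover have "?w \<in> n'" using uv p' n' P'.n_ideal(1) by (intro subspace_add) auto
  moreover have "bracket x y + ?w = bracket (x + u) (y + v)" by (simp add: bracket_simps algebra_simps)
  then have "bracket x y + ?w \<in> i" using i uv by metis
  moreover have "bracket x y \<in> l \<inter> l'" using uv P.l_sub P'.l_sub by auto
  ultimately show ?thesis unfolding levi_projection_def by blast
qed

end

section \<open>Invariant forms\<close>

locale invariant_form = reductive_lie scaleC Basis lie_bracket h
  for Basis h :: "'g::complex_lie_algebra set" +
  fixes R :: "'g \<Rightarrow> 'g \<Rightarrow> real"
  assumes form: "re.symmetric_invariant_form_on UNIV R"
    and form_nondegenerate: "re.nondegenerate_on UNIV R"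
begin

lemma R_add: "R (x + y) z = R x z + R y z" "R z (x + y) = R z x + R z y"
  and R_scale: "R (r *\<^sub>R x) y = r * R x y" "R x (r *\<^sub>R y) = r * R x y"
  and R_sym: "R x y = R y x"
  and R_invariant: "R (lie_bracket x y) z = - R y (lie_bracket x z)"
  using form unfolding re.symmetric_invariant_form_on_def re.bilinear_form_on_def by blast+

lemma R_nondegenerate: "(\<And>y. R x y = 0) \<Longrightarrow> x = 0"
  using form_nondegenerate unfolding re.nondegenerate_on_def by blast

lemma R_zero [simp]: "R 0 y = 0" "R y 0 = 0"
  using R_scale[of 0 0 y] R_scale(2)[of y 0 0] by simp_all

lemma R_minus: "R (- x) y = - R x y" "R x (- y) = - R x y"
  using R_scale(1)[of "-1" x y] R_scale(2)[of x "-1" y] by simp_all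

text \<open>
  A complex scalar crosses the form by passing through a bracket. This is why one argument has to lie
  in the derived algebra: on the center a real form need not respect complex scalars.
\<close>

lemma R_scaleC_shift:
  assumes x: "x \<in> commutator UNIV UNIV"
  shows "R (c *\<^sub>C x) y = R x (c *\<^sub>C y)"
proof -
  have br: "R (c *\<^sub>C lie_bracket a b) y = R (lie_bracket a b) (c *\<^sub>C y)" for a b c y
  proof -
    have "R (c *\<^sub>C lie_bracket a b) y = R (lie_bracket (c *\<^sub>C a) b) y" by (simp add: bracket_simps)
    also have "\<dots> = - R b (lie_bracket (c *\<^sub>C a) y)" by (rule R_invariant)
    also have "\<dots> = - R b (lie_bracket a (c *\<^sub>C y))" by (simp add: bracket_simps)
    also have "\<dots> = R (lie_bracket a b) (c *\<^sub>C y)" by (simp only: R_invariant)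
    finally show ?thesis .
  qed
  show ?thesis using x unfolding commutator_def
  proof (induction rule: span_induct_alt)
    case (step d s z)
    then obtain a b where s: "s = lie_bracket a b" by blast
    have "R (c *\<^sub>C d *\<^sub>C s) y = R (d *\<^sub>C s) (c *\<^sub>C y)"
      using br[of "c * d" a b y] br[of d a b "c *\<^sub>C y"] by (simp add: s scaleC_scaleC mult.commute)
    then show ?case using step by (simp add: scaleC_add_right R_add)
  qed simp
qed

lemma weight_vector_derived:
  assumes e: "e \<in> weight_space h \<alpha>" and z: "z \<in> h" "\<alpha> z \<noteq> 0"
  shows "e \<in> commutator UNIV UNIV"
proof -
  have "(1 / \<alpha> z) *\<^sub>C lie_bracket z e \<in> commutator UNIV UNIV"
    by (intro subspace_scale subspace_commutator bracket_in_commutator) auto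
  then show ?thesis using e z by (simp add: weight_space_iff scaleC_scaleC scaleC_one)
qed

text \<open>
  If \<open>e\<close> has a nonzero weight at \<open>z\<close>, it lies in the derived algebra, and the scalar \<open>\<alpha> z + \<beta> z\<close> can be
  moved to one side and normalized to \<open>1\<close>; otherwise \<open>f\<close> takes the role of \<open>e\<close>.
\<close>

lemma R_weights:
  assumes e: "e \<in> weight_space h \<alpha>" and f: "f \<in> weight_space h \<beta>"
    and z: "z \<in> h" "\<alpha> z + \<beta> z \<noteq> 0"
  shows "R e f = 0"
proof -
  have main: "R e f = 0" if e: "e \<in> weight_space h \<alpha>" and f: "f \<in> weight_space h \<beta>"
    and nz: "\<alpha> z + \<beta> z \<noteq> 0" "\<alpha> z \<noteq> 0" for e f \<alpha> \<beta>
  proof -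
    have der: "e \<in> commutator UNIV UNIV" by (rule weight_vector_derived[OF e z(1) nz(2)])
    define k where "k = 1 / (\<alpha> z + \<beta> z)"
    have "R (lie_bracket z (k *\<^sub>C e)) f = - R (k *\<^sub>C e) (lie_bracket z f)" by (rule R_invariant)
    moreover have "lie_bracket z (k *\<^sub>C e) = (k * \<alpha> z) *\<^sub>C e" "lie_bracket z f = \<beta> z *\<^sub>C f"
      using e f z(1) by (simp_all add: weight_space_iff bracket_simps scaleC_scaleC)
    ultimately have "R ((k * \<alpha> z) *\<^sub>C e) f + R (k *\<^sub>C e) (\<beta> z *\<^sub>C f) = 0" by simp
    then have "R e ((k * \<alpha> z) *\<^sub>C f) + R e ((k * \<beta> z) *\<^sub>C f) = 0"
      using R_scaleC_shift[OF der] by (simp add: scaleC_scaleC)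
    then have "R e ((k * \<alpha> z + k * \<beta> z) *\<^sub>C f) = 0" by (simp add: R_add scaleC_add_left)
    moreover have "k * \<alpha> z + k * \<beta> z = 1"
      unfolding distrib_left[symmetric] using nz(1) by (simp add: k_def)
    ultimately show ?thesis by (simp add: scaleC_one)
  qed
  show ?thesis
  proof (cases "\<alpha> z = 0")
    case True
    then have "R f e = 0" using main[OF f e] z(2) by (simp add: add.commute)
    then show ?thesis using R_sym by simp
  next
    case False
    then show ?thesis using main[OF e f z(2)] by blast
  qed
qed

lemma R_zero_if_on_weight_vectors:
  assumes W: "subspace W" "\<And>z w. z \<in> h \<Longrightarrow> w \<in> W \<Longrightarrow> lie_bracket z w \<in> W"
    and zero: "\<And>f. f \<in> W \<Longrightarrow> f \<in> weight_vectors \<Longrightarrow> R x f = 0" and y: "y \<in> W"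
  shows "R x y = 0"
proof -
  have "y \<in> span (W \<inter> weight_vectors)" using stable_subspace_weight_vectors[OF W] y by blast
  then show ?thesis
  proof (induction rule: span_induct_alt)
    case (step c f y)
    then obtain \<alpha> where "f \<in> weight_space h \<alpha>" unfolding weight_vectors_def by blast
    then have "c *\<^sub>C f \<in> weight_vectors"
      unfolding weight_vectors_def using subspace_scale[OF subspace_weight_space] by blast
    moreover have "c *\<^sub>C f \<in> W" using W(1) step(1) by (simp add: subspace_scale)
    ultimately show ?case using zero step by (simp add: R_add)
  qed simp
qed

text \<open>
  Only opposite root vectors \<open>e \<in> n\<close>, \<open>f \<in> p\<close> could pair nontrivially; but \<open>[e, f] \<in> n \<inter> h = 0\<close>, and
  \<open>R e f = R [z, e] f = R z [e, f]\<close> for a suitable \<open>z \<in> h\<close>.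
\<close>

lemma nilradical_orthogonal:
  assumes "parabolic_levi scaleC Basis lie_bracket h b p l n" and u: "u \<in> n" and y: "y \<in> p"
  shows "R u y = 0"
proof -
  interpret P: parabolic_levi scaleC Basis lie_bracket h b p l n by fact
  have ef: "R e f = 0" if e: "e \<in> n" "e \<in> weight_space h \<alpha>" and f: "f \<in> p" "f \<in> weight_space h \<beta>" for e f \<alpha> \<beta>
  proof (cases "e = 0 \<or> (\<exists>z\<in>h. \<alpha> z + \<beta> z \<noteq> 0)")
    case True
    then show ?thesis using R_weights[OF e(2) f(2)] by auto
  next
    case False
    then have e0: "e \<noteq> 0" and opp: "\<And>z. z \<in> h \<Longrightarrow> \<beta> z = - \<alpha> z" by (auto simp: add_eq_0_iff)
    have f': "f \<in> weight_space h (\<lambda>z. - \<alpha> z)" using f(2) opp by (simp add: weight_space_iff)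
    have "lie_bracket e f \<in> n"
      using P.n_ideal(3)[OF f(1) e(1)] bracket_antisym[of e f] subspace_neg[OF P.n_ideal(1)] by simp
    then have "lie_bracket e f \<in> h \<inter> n" using bracket_opposite_weights[OF e(2) f'] by blast
    then have 0: "lie_bracket e f = 0" using P.h_inter_n by simp
    obtain z where z: "z \<in> h" "\<alpha> z \<noteq> 0" using P.n_weight_nonzero[OF e e0] by blast
    define z' where "z' = (1 / \<alpha> z) *\<^sub>C z"
    have "lie_bracket z' e = e" using e(2) z by (simp add: z'_def bracket_simps weight_space_iff scaleC_scaleC scaleC_one)
    then have "R e f = R (lie_bracket z' e) f" by simp
    also have "\<dots> = - R (lie_bracket e z') f" using bracket_antisym[of z' e] by (simp add: R_minus)
    also have "\<dots> = R z' (lie_bracket e f)" by (simp add: R_invariant)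
    finally show ?thesis using 0 by simp
  qed
  have ey: "R e y = 0" if e: "e \<in> n" "e \<in> weight_vectors" for e
  proof (rule R_zero_if_on_weight_vectors[OF P.p_sub(1) _ _ y])
    show "lie_bracket z w \<in> p" if "z \<in> h" "w \<in> p" for z w using that P.h_p P.p_sub(2) by blast
    show "R e f = 0" if "f \<in> p" "f \<in> weight_vectors" for f
      using ef e that unfolding weight_vectors_def by blast
  qed
  have "R y u = 0"
  proof (rule R_zero_if_on_weight_vectors[OF P.n_ideal(1) _ _ u])
    show "lie_bracket z w \<in> n" if "z \<in> h" "w \<in> n" for z w using that P.h_p P.n_ideal(3) by blast
    show "R y f = 0" if "f \<in> n" "f \<in> weight_vectors" for f using ey[OF that] R_sym by simp
  qed
  then show ?thesis using R_sym by simp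
qed

text \<open>
  The roots of \<open>l\<close> and of \<open>l'\<close> come in opposite pairs. So every weight vector outside \<open>l \<inter> l'\<close> is
  orthogonal to \<open>l \<inter> l'\<close>, and a vector of \<open>l \<inter> l'\<close> orthogonal to \<open>l \<inter> l'\<close> is orthogonal to the whole
  algebra.
\<close>

lemma nondegenerate_on_levi_intersection:
  assumes l: "lie_subalgebra l" "reductive_in_ambient l" "h \<subseteq> l"
    and l': "lie_subalgebra l'" "reductive_in_ambient l'" "h \<subseteq> l'"
    and x: "x \<in> l \<inter> l'" "\<And>y. y \<in> l \<inter> l' \<Longrightarrow> R x y = 0"
  shows "x = 0"
proof (rule R_nondegenerate)
  note ls = lie_subalgebraD[OF l(1)] lie_subalgebraD[OF l'(1)]
  have W: "subspace (l \<inter> l')" using ls by (intro subspace_inter)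
  have Wh: "lie_bracket z w \<in> l \<inter> l'" if "z \<in> h" "w \<in> l \<inter> l'" for z w
    using that l l' ls by blast
  fix y
  show "R x y = 0"
  proof (rule R_zero_if_on_weight_vectors[of UNIV])
    fix f assume "f \<in> weight_vectors"
    then obtain \<beta> where f: "f \<in> weight_space h \<beta>" unfolding weight_vectors_def by blast
    show "R x f = 0"
    proof (cases "f \<in> l \<inter> l'")
      case False
      have "R f x = 0"
      proof (rule R_zero_if_on_weight_vectors[OF W Wh _ x(1)])
        fix e assume e: "e \<in> l \<inter> l'" "e \<in> weight_vectors"
        then obtain \<alpha> where \<alpha>: "e \<in> weight_space h \<alpha>" unfolding weight_vectors_def by blast
        show "R f e = 0"
        proof (cases "e = 0 \<or> (\<exists>z\<in>h. \<beta> z + \<alpha> z \<noteq> 0)")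
          case True
          then show ?thesis using R_weights[OF f \<alpha>] by auto
        next
          case opp: False
          then have f': "f \<in> weight_space h (\<lambda>z. - \<alpha> z)"
            using f by (auto simp: weight_space_iff add_eq_0_iff2)
          have "f \<in> l \<inter> l'"
          proof (cases "\<exists>z\<in>h. \<alpha> z \<noteq> 0")
            case True
            then obtain z where z: "z \<in> h" "\<alpha> z \<noteq> 0" by blast
            show ?thesis
              using reductive_root_symmetric[OF l _ \<alpha> _ z] reductive_root_symmetric[OF l' _ \<alpha> _ z] e opp f'
              by blast
          next
            case False
            then have "f \<in> h" using f' by (intro centralizer_in_h) (simp add: weight_space_iff)
            then show ?thesis using l l' by blast
          qed
          then show ?thesis using False by blast
        qed
      qed
      then show ?thesis using R_sym by simp
    qed (rule x(2))
  qed auto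
qed

end

section \<open>Manin triples\<close>

lemma (in lie_algebra) symmetric_invariant_form_on_subset:
  assumes B: "symmetric_invariant_form_on UNIV B" shows "symmetric_invariant_form_on L B"
proof -
  have "B (x + y) z = B x z + B y z" "B z (x + y) = B z x + B z y"
    "B (c *s x) y = c * B x y" "B x (c *s y) = c * B x y" "B x y = B y x"
    "B (bracket x y) z = - B y (bracket x z)" for x y z c
    using B unfolding symmetric_invariant_form_on_def bilinear_form_on_def by blast+
  then show ?thesis
    unfolding symmetric_invariant_form_on_def bilinear_form_on_def by (intro conjI ballI allI)
qed

lemma real_basis_exists:
  fixes W :: "'g::complex_lie_algebra set"
  assumes fd: "finite_dimensional_vector_space (scaleC :: complex \<Rightarrow> 'g \<Rightarrow> 'g) Basis"
    and W: "cx.subspace W"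
  shows "\<exists>E. finite E \<and> independent E \<and> span E = W \<and> card E = 2 * cx.dim W"
proof -
  interpret fd: finite_dimensional_vector_space "scaleC :: complex \<Rightarrow> 'g \<Rightarrow> 'g" Basis by fact
  obtain E where E: "E \<subseteq> W" "cx.independent E" "W \<subseteq> cx.span E" "card E = cx.dim W"
    by (rule cx.basis_exists)
  have fin: "finite E" using E(2) by (rule fd.finiteI_independent)
  have "cx.span E = W" using E cx.span_minimal[OF E(1) W] by blast
  then show ?thesis using real_basis_of_complex[OF fin E(2)] fin E(4)
    by (intro exI[of _ "E \<union> scaleC \<i> ` E"]) auto
qed

lemma real_dim_complex:
  fixes W :: "'g::complex_lie_algebra set"
  assumes "finite_dimensional_vector_space (scaleC :: complex \<Rightarrow> 'g \<Rightarrow> 'g) Basis" "cx.subspace W"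
  shows "dim W = 2 * cx.dim W"
  using real_basis_exists[OF assms] real_vector.dim_span_eq_card_independent by metis

lemma real_form_spaceI:
  fixes R :: "'g::complex_lie_algebra \<Rightarrow> 'g \<Rightarrow> real"
  assumes "re.symmetric_invariant_form_on UNIV R" "finite E" "independent E" "span E = UNIV"
  shows "real_form_space scaleR E R"
  by unfold_locales
    (use assms in \<open>unfold re.symmetric_invariant_form_on_def re.bilinear_form_on_def
      dependent_raw_def span_raw_def, blast+\<close>)

text \<open>
  The positive and negative vectors of the orthogonal basis together number the real dimension, so
  they are all of the basis.
\<close>

lemma nondegenerate_of_signature:
  fixes R :: "'g::complex_lie_algebra \<Rightarrow> 'g \<Rightarrow> real"
  assumes fd: "finite_dimensional_vector_space (scaleC :: complex \<Rightarrow> 'g \<Rightarrow> 'g) Basis"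
    and R: "real_manin_form UNIV R"
  shows "re.nondegenerate_on UNIV R"
proof -
  have form: "re.symmetric_invariant_form_on UNIV R" using R unfolding real_manin_form_def by blast
  obtain E where E: "finite E" "independent E" "span E = (UNIV :: 'g set)"
    "\<And>x y. x \<in> E \<Longrightarrow> y \<in> E \<Longrightarrow> x \<noteq> y \<Longrightarrow> R x y = 0"
    "card {x \<in> E. R x x > 0} = cx.dim (UNIV :: 'g set)" "card {x \<in> E. R x x < 0} = cx.dim (UNIV :: 'g set)"
    using R unfolding real_manin_form_def has_signature_def by blast
  interpret rf: real_form_space scaleR E R by (rule real_form_spaceI[OF form E(1-3)])
  have "card E = 2 * cx.dim (UNIV :: 'g set)"
    using real_dim_complex[OF fd cx.subspace_UNIV] E(2,3) real_vector.dim_span_eq_card_independent by metis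
  moreover have "card ({x \<in> E. R x x > 0} \<union> {x \<in> E. R x x < 0}) = 2 * cx.dim (UNIV :: 'g set)"
    using E(1,5,6) by (subst card_Un_disjoint) auto
  ultimately have "{x \<in> E. R x x > 0} \<union> {x \<in> E. R x x < 0} = E"
    using E(1) by (intro card_subset_eq) auto
  then have E_nz: "R x x \<noteq> 0" if "x \<in> E" for x using that by (metis (mono_tags, lifting) Un_iff less_irrefl mem_Collect_eq)
  then have "x = 0" if "\<And>y. R x y = 0" for x
    using rf.nondegenerate_if_orthogonal_basis[of E x] E E_nz that unfolding span_raw_def by blast
  then show ?thesis unfolding re.nondegenerate_on_def by blast
qed

lemma orthogonal_in_lagrangian:
  fixes R :: "'g::complex_lie_algebra \<Rightarrow> 'g \<Rightarrow> real"
  assumes fd: "finite_dimensional_vector_space (scaleC :: complex \<Rightarrow> 'g \<Rightarrow> 'g) Basis"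
    and form: "re.symmetric_invariant_form_on UNIV R" and nondeg: "re.nondegenerate_on UNIV R"
    and i: "subspace i" "re.isotropic R i" "dim i = cx.dim (UNIV :: 'g set)"
    and x: "\<And>y. y \<in> i \<Longrightarrow> R x y = 0"
  shows "x \<in> i"
proof -
  obtain E where E: "finite E" "independent E" "span E = (UNIV :: 'g set)"
    "card E = 2 * cx.dim (UNIV :: 'g set)"
    using real_basis_exists[OF fd cx.subspace_UNIV] by blast
  interpret rf: real_form_space scaleR E R by (rule real_form_spaceI[OF form E(1-3)])
  show ?thesis
  proof (rule rf.lagrangian_maximal[OF _ _ _ _ x])
    show "module.subspace scaleR i" using i(1) by (simp add: subspace_raw_def)
    show "2 * vector_space.dim scaleR i = card E" using i(3) E(4) by (simp add: dim_raw_def)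
    show "R x y = 0" if "x \<in> i" "y \<in> i" for x y using i(2) that unfolding re.isotropic_def by blast
    show "x = 0" if "\<And>y. R x y = 0" for x using nondeg that unfolding re.nondegenerate_on_def by blast
  qed
qed

lemma lagrangians_span:
  fixes i i' :: "'g::complex_lie_algebra set"
  assumes fd: "finite_dimensional_vector_space (scaleC :: complex \<Rightarrow> 'g \<Rightarrow> 'g) Basis"
    and i: "subspace i" "dim i = cx.dim (UNIV :: 'g set)"
    and i': "subspace i'" "dim i' = cx.dim (UNIV :: 'g set)" and int: "i \<inter> i' = {0}"
  shows "UNIV = {a + c |a c. a \<in> i \<and> c \<in> i'}"
proof -
  obtain E where E: "finite E" "independent E" "span E = (UNIV :: 'g set)"
    "card E = 2 * cx.dim (UNIV :: 'g set)"
    using real_basis_exists[OF fd cx.subspace_UNIV] by blast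
  interpret rf: finite_dimensional_vector_space scaleR E
    by unfold_locales (use E in \<open>unfold dependent_raw_def span_raw_def, blast+\<close>)
  let ?S = "{x + y |x y. x \<in> i \<and> y \<in> i'}"
  have "dim ?S + dim (i \<inter> i') = dim i + dim i'"
    using rf.dim_sums_Int[of i i'] i(1) i'(1) unfolding subspace_raw_def dim_raw_def by blast
  moreover have "dim (i \<inter> i') = 0"
    unfolding int using real_vector.dim_le_card[of "{0}" "{} :: 'g set"] by simp
  moreover have "dim (UNIV :: 'g set) = 2 * cx.dim (UNIV :: 'g set)"
    by (rule real_dim_complex[OF fd cx.subspace_UNIV])
  ultimately have "dim (UNIV :: 'g set) \<le> dim ?S" using i(2) i'(2) by simp
  moreover have "subspace ?S" by (rule real_vector.subspace_sums[OF i(1) i'(1)])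
  ultimately have "?S = UNIV"
    using rf.subspace_dim_equal[of ?S UNIV] real_vector.subspace_UNIV
    unfolding subspace_raw_def dim_raw_def by blast
  then show ?thesis by simp
qed

lemma signature_of_isotropic_sum:
  fixes R :: "'g::complex_lie_algebra \<Rightarrow> 'g \<Rightarrow> real"
  assumes fd: "finite_dimensional_vector_space (scaleC :: complex \<Rightarrow> 'g \<Rightarrow> 'g) Basis"
    and form: "re.symmetric_invariant_form_on UNIV R"
    and W: "cx.subspace W" "re.nondegenerate_on W R" "W = {a + c |a c. a \<in> A \<and> c \<in> C}"
    and A: "subspace A" "re.isotropic R A" and C: "subspace C" "re.isotropic R C"
  shows "has_signature W R (cx.dim W) (cx.dim W)"
proof -
  obtain E where E: "finite E" "independent E" "span E = (UNIV :: 'g set)"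
    using real_basis_exists[OF fd cx.subspace_UNIV] by blast
  interpret rf: real_form_space scaleR E R by (rule real_form_spaceI[OF form E])
  have "\<exists>H. finite H \<and> \<not> module.dependent scaleR H \<and> module.span scaleR H = {a + c |a c. a \<in> A \<and> c \<in> C} \<and>
     (\<forall>x\<in>H. \<forall>y\<in>H. x \<noteq> y \<longrightarrow> R x y = 0) \<and>
     2 * card {x\<in>H. R x x > 0} = card H \<and> 2 * card {x\<in>H. R x x < 0} = card H"
  proof (rule rf.hyperbolic_basis)
    show "module.subspace scaleR A" "module.subspace scaleR C" using A(1) C(1) by (simp_all add: subspace_raw_def)
    show "R x y = 0" if "x \<in> A" "y \<in> A" for x y using A(2) that unfolding re.isotropic_def by blast
    show "R x y = 0" if "x \<in> C" "y \<in> C" for x y using C(2) that unfolding re.isotropic_def by blast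
    show "x = 0" if "x \<in> {a + c |a c. a \<in> A \<and> c \<in> C}"
      "\<And>y. y \<in> {a + c |a c. a \<in> A \<and> c \<in> C} \<Longrightarrow> R x y = 0" for x
      using W(2) that unfolding W(3)[symmetric] re.nondegenerate_on_def by blast
  qed
  then obtain H where H: "finite H" "independent H" "span H = W"
     "\<forall>x\<in>H. \<forall>y\<in>H. x \<noteq> y \<longrightarrow> R x y = 0"
     "2 * card {x\<in>H. R x x > 0} = card H" "2 * card {x\<in>H. R x x < 0} = card H"
    unfolding W(3)[symmetric] dependent_raw_def span_raw_def by blast
  have "card H = 2 * cx.dim W"
    using real_vector.dim_span_eq_card_independent[OF H(2)] real_dim_complex[OF fd W(1)] H(3) by simp
  then show ?thesis unfolding has_signature_def using H by (intro exI[of _ H]) auto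
qed

locale manin_setting = opposite_parabolics scaleC Basis lie_bracket h b p l n b' p' l' n' +
  invariant_form Basis h R
  for Basis h b p l n b' p' l' n' :: "'g::complex_lie_algebra set" and R
begin

lemma swap: "manin_setting Basis h b' p' l' n' b p l n R"
  using opposite by (simp add: manin_setting_def invariant_form_axioms)

lemma fd: "finite_dimensional_vector_space (scaleC :: complex \<Rightarrow> 'g \<Rightarrow> 'g) Basis"
  by (rule finite_dimensional_vector_space_axioms)

text \<open>
  \<open>n\<close> is orthogonal to \<open>p \<supseteq> i\<close>, and a Lagrangian subspace contains its orthogonal complement.
\<close>

lemma lagrangian_contains_nilradical:
  assumes i: "real_vector.subspace i" "re.isotropic R i" "real_vector.dim i = cx.dim (UNIV :: 'g set)"
    and "i \<subseteq> p"
  shows "n \<subseteq> i"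
proof
  fix u assume u: "u \<in> n"
  show "u \<in> i"
  proof (rule orthogonal_in_lagrangian[OF fd form form_nondegenerate i])
    show "R u y = 0" if "y \<in> i" for y
      using nilradical_orthogonal[OF P.parabolic_levi_axioms u] that \<open>i \<subseteq> p\<close> by blast
  qed
qed

lemma R_levi_projection:
  assumes "x \<in> l'" "u \<in> n'" "y \<in> l'" "v \<in> n'"
  shows "R (x + u) (y + v) = R x y"
proof -
  have "R u y = 0" "R u v = 0" "R v x = 0"
    using nilradical_orthogonal[OF P'.parabolic_levi_axioms] assms P'.l_p P'.n_ideal(2) by blast+
  then show ?thesis using R_sym[of x v] by (simp add: R_add)
qed

lemma levi_projection_isotropic:
  assumes "re.isotropic R i" shows "re.isotropic R (levi_projection l l' n' i)"
  unfolding re.isotropic_def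
proof (intro ballI)
  fix x y assume "x \<in> levi_projection l l' n' i" "y \<in> levi_projection l l' n' i"
  then obtain u v where "x \<in> l'" "u \<in> n'" "x + u \<in> i" "y \<in> l'" "v \<in> n'" "y + v \<in> i"
    unfolding levi_projection_def by blast
  then show "R x y = 0" using R_levi_projection[of x u y v] assms unfolding re.isotropic_def by simp
qed

lemma levi_projection_add_closed:
  assumes i: "0 \<in> i" "\<And>x y. x \<in> i \<Longrightarrow> y \<in> i \<Longrightarrow> x + y \<in> i"
  shows "0 \<in> levi_projection l l' n' i"
    and "x \<in> levi_projection l l' n' i \<Longrightarrow> y \<in> levi_projection l l' n' i \<Longrightarrow>
      x + y \<in> levi_projection l l' n' i"
proof -
  show "0 \<in> levi_projection l l' n' i" unfolding levi_projection_def
    using subspace_0[OF P.l_sub(1)] subspace_0[OF P'.l_sub(1)] subspace_0[OF P'.n_ideal(1)] i(1) by force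
  assume "x \<in> levi_projection l l' n' i" "y \<in> levi_projection l l' n' i"
  then obtain u v where u: "x \<in> l \<inter> l'" "u \<in> l \<inter> n'" "x + u \<in> i"
    and v: "y \<in> l \<inter> l'" "v \<in> l \<inter> n'" "y + v \<in> i" unfolding levi_projection_def by blast
  have "u + v \<in> l \<inter> n'" "x + y \<in> l \<inter> l'"
    using u v subspace_add P.l_sub(1) P'.l_sub(1) P'.n_ideal(1) by auto
  moreover have "(x + y) + (u + v) \<in> i" using i(2)[OF u(3) v(3)] by (simp add: ac_simps)
  ultimately show "x + y \<in> levi_projection l l' n' i" unfolding levi_projection_def by blast
qed

lemma levi_projection_scale_closed:
  assumes i: "\<And>x. x \<in> i \<Longrightarrow> c *\<^sub>C x \<in> i" and x: "x \<in> levi_projection l l' n' i"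
  shows "c *\<^sub>C x \<in> levi_projection l l' n' i"
proof -
  obtain u where u: "x \<in> l \<inter> l'" "u \<in> l \<inter> n'" "x + u \<in> i" using x unfolding levi_projection_def by blast
  have "c *\<^sub>C u \<in> l \<inter> n'" "c *\<^sub>C x \<in> l \<inter> l'"
    using u subspace_scale P.l_sub(1) P'.l_sub(1) P'.n_ideal(1) by auto
  moreover have "c *\<^sub>C x + c *\<^sub>C u \<in> i" using i[OF u(3)] by (simp add: scaleC_add_right)
  ultimately show ?thesis unfolding levi_projection_def by blast
qed

lemma levi_projection_subspace:
  assumes "cx.subspace i" shows "cx.subspace (levi_projection l l' n' i)"
  by (intro cx.subspaceI levi_projection_add_closed levi_projection_scale_closed)
    (use assms cx.subspace_0 cx.subspace_add cx.subspace_scale in blast)+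

lemma levi_projection_real_subspace:
  assumes "real_vector.subspace i" shows "real_vector.subspace (levi_projection l l' n' i)"
proof (rule real_vector.subspaceI)
  have zero: "0 \<in> i" and add: "\<And>x y. x \<in> i \<Longrightarrow> y \<in> i \<Longrightarrow> x + y \<in> i"
    using assms real_vector.subspace_0 real_vector.subspace_add by blast+
  show "0 \<in> levi_projection l l' n' i" by (rule levi_projection_add_closed(1)[OF zero add])
  show "x + y \<in> levi_projection l l' n' i"
    if "x \<in> levi_projection l l' n' i" "y \<in> levi_projection l l' n' i" for x y
    by (rule levi_projection_add_closed(2)[OF zero add that])
  show "r *\<^sub>R x \<in> levi_projection l l' n' i" if "x \<in> levi_projection l l' n' i" for r x
    unfolding scaleR_scaleC using that
    by (rule levi_projection_scale_closed[rotated])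
      (use real_vector.subspace_scale[OF assms] in \<open>simp add: scaleR_scaleC\<close>)
qed

lemma levi_intersection_subspace: "cx.subspace (l \<inter> l')"
  by (intro cx.subspace_inter P.l_sub P'.l_sub)

lemma levi_intersection_nondegenerate: "re.nondegenerate_on (l \<inter> l') R"
  unfolding re.nondegenerate_on_def
proof (intro ballI impI)
  fix x assume "x \<in> l \<inter> l'" "\<forall>y\<in>l \<inter> l'. R x y = 0"
  then show "x = 0"
    using nondegenerate_on_levi_intersection[OF P.l_lie P.l_reductive P.h_l P'.l_lie P'.l_reductive P'.h_l]
    by blast
qed

lemma lagrangian_direct_sum_iff:
  assumes i: "real_vector.subspace i" "re.isotropic R i" "real_vector.dim i = cx.dim (UNIV :: 'g set)" "i \<subseteq> p"
    and i': "real_vector.subspace i'" "re.isotropic R i'" "real_vector.dim i' = cx.dim (UNIV :: 'g set)" "i' \<subseteq> p'"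
  shows "is_direct_sum UNIV i i' \<longleftrightarrow>
    is_direct_sum (l \<inter> l') (levi_projection l l' n' i) (levi_projection l' l n i') \<and>
    n \<inter> (i' \<inter> commutator l' l') = {0} \<and> n' \<inter> (i \<inter> commutator l l) = {0}"
proof (rule direct_sum_iff)
  interpret sw: manin_setting Basis h b' p' l' n' b p l n R by (rule swap)
  show "n \<subseteq> i" by (rule lagrangian_contains_nilradical[OF i])
  show "n' \<subseteq> i'" by (rule sw.lagrangian_contains_nilradical[OF i'])
  show "UNIV = {a + c |a c. a \<in> i \<and> c \<in> i'}" if "i \<inter> i' = {0}"
    by (rule lagrangians_span[OF fd i(1,3) i'(1,3) that])
  show "0 \<in> i" "0 \<in> i'" using i i' real_vector.subspace_0 by blast+
  show "x - y \<in> i" if "x \<in> i" "y \<in> i" for x y using real_vector.subspace_diff[OF i(1) that] .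
  show "x - y \<in> i'" if "x \<in> i'" "y \<in> i'" for x y using real_vector.subspace_diff[OF i'(1) that] .
qed (use i i' in auto)

end

lemma (in lie_algebra) under_subset: 
  assumes "under i p" shows "i \<subseteq> p"
proof -
  obtain N where N: "is_nilpotent_radical N i" "p = lie_normalizer N"
    using assms unfolding under_def by blast
  have "lie_ideal N i" using N(1) by (simp add: is_nilpotent_radical_def)
  then show ?thesis unfolding N(2) lie_ideal_def lie_normalizer_def by blast
qed

lemma cx_basis_exists:
  assumes "complex_finite_dimensional TYPE('g::complex_lie_algebra)"
  shows "\<exists>Basis. finite_dimensional_vector_space (scaleC :: complex \<Rightarrow> 'g \<Rightarrow> 'g) Basis"
proof -
  obtain S :: "'g set" where S: "finite S" "cx.span S = UNIV"
    using assms unfolding complex_finite_dimensional_def by blast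
  obtain E where E: "E \<subseteq> S" "cx.independent E" "S \<subseteq> cx.span E" by (rule cx.maximal_independent_subset)
  have "cx.span E = UNIV" using cx.span_minimal[OF E(3)] S(2) by auto
  moreover have "finite E" using E(1) S(1) by (rule finite_subset)
  ultimately have "finite_dimensional_vector_space (scaleC :: complex \<Rightarrow> 'g \<Rightarrow> 'g) E"
    using E(2) by unfold_locales
  then show ?thesis by blast
qed

text \<open>The real part of a complex form loses nothing: \<open>Re (B x (\<i> y))\<close> recovers the imaginary part.\<close>

lemma Re_form:
  fixes B :: "'g::complex_lie_algebra \<Rightarrow> 'g \<Rightarrow> complex"
  assumes B: "complex_manin_form UNIV B"
  shows "re.symmetric_invariant_form_on UNIV (\<lambda>x y. Re (B x y))"
    and "re.nondegenerate_on UNIV (\<lambda>x y. Re (B x y))"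
proof -
  have form: "cx.symmetric_invariant_form_on UNIV B" and nondeg: "cx.nondegenerate_on UNIV B"
    using B unfolding complex_manin_form_def by auto
  have add: "B (x + y) z = B x z + B y z" "B z (x + y) = B z x + B z y"
    and scale: "B (c *\<^sub>C x) y = c * B x y" "B x (c *\<^sub>C y) = c * B x y"
    and sym: "B x y = B y x" and inv: "B (lie_bracket x y) z = - B y (lie_bracket x z)" for x y z c
    using form unfolding cx.symmetric_invariant_form_on_def cx.bilinear_form_on_def by blast+
  show "re.symmetric_invariant_form_on UNIV (\<lambda>x y. Re (B x y))"
    unfolding re.symmetric_invariant_form_on_def re.bilinear_form_on_def
  proof (intro conjI ballI allI)
    show "Re (B x y) = Re (B y x)" for x y by (subst sym) (rule refl)
    show "Re (B (lie_bracket x y) z) = - Re (B y (lie_bracket x z))" for x y z by (subst inv) simp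
  qed (simp_all add: add scaleR_scaleC scale)
  show "re.nondegenerate_on UNIV (\<lambda>x y. Re (B x y))"
    unfolding re.nondegenerate_on_def
  proof (intro ballI impI)
    fix x assume x: "\<forall>y\<in>UNIV. Re (B x y) = 0"
    have "B x y = 0" for y
    proof -
      have "Re (B x y) = 0" "Re (B x (\<i> *\<^sub>C y)) = 0" using x by auto
      then show ?thesis by (simp add: scale complex_eq_iff)
    qed
    then show "x = 0" using nondeg unfolding cx.nondegenerate_on_def by blast
  qed
qed

lemma isotropic_Re_iff:
  assumes "cx.subspace i" and B: "complex_manin_form UNIV B"
  shows "cx.isotropic B i \<longleftrightarrow> re.isotropic (\<lambda>x y. Re (B x y)) i"
proof
  assume "re.isotropic (\<lambda>x y. Re (B x y)) i"
  then have r: "Re (B x y) = 0" if "x \<in> i" "y \<in> i" for x y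
    using that unfolding re.isotropic_def by blast
  show "cx.isotropic B i"
    unfolding cx.isotropic_def
  proof (intro ballI)
    fix x y assume xy: "x \<in> i" "y \<in> i"
    have "B x (\<i> *\<^sub>C y) = \<i> * B x y"
      using B unfolding complex_manin_form_def cx.symmetric_invariant_form_on_def cx.bilinear_form_on_def by blast
    then show "B x y = 0"
      using r[OF xy] r[OF xy(1) cx.subspace_scale[OF assms(1) xy(2)], of "\<i>"] by (simp add: complex_eq_iff)
  qed
qed (auto simp: cx.isotropic_def re.isotropic_def)

theorem theorem3:
  fixes j0 b0 b0' p p' l l' n n' :: "'g::complex_lie_algebra set"
  assumes "complex_finite_dimensional TYPE('g)"
    and "cx.reductive_in_ambient (UNIV :: 'g set)"
    and "cx.cartan_subalgebra j0"
    and "cx.borel_subalgebra b0" and "j0 \<subseteq> b0"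
    and "cx.opposite_borel j0 b0 b0'"
    and "cx.parabolic_subalgebra p" and "b0 \<subseteq> p"
    and "cx.parabolic_subalgebra p'" and "b0' \<subseteq> p'"
    and "cx.langlands_decomposition p l n" and "j0 \<subseteq> l"
    and "cx.langlands_decomposition p' l' n'" and "j0 \<subseteq> l'"
  shows "
      (\<forall>(B :: 'g \<Rightarrow> 'g \<Rightarrow> real) i i'.
        real_manin_form UNIV B \<and> real_lagrangian UNIV B i \<and> real_lagrangian UNIV B i' \<and>
        re.under i p \<and> re.under i' p' \<longrightarrow>
        (let m = cx.commutator l l; m' = cx.commutator l' l';
             h = i \<inter> m; h' = i' \<inter> m'; ht = i \<inter> l; ht' = i' \<inter> l';
             i1 = cx.weight_proj j0 n' ` (ht \<inter> p');
             i1' = cx.weight_proj j0 n ` (ht' \<inter> p)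
         in real_manin_triple UNIV B i i' \<longleftrightarrow>
            (i1 \<subseteq> l \<inter> l' \<and> i1' \<subseteq> l \<inter> l' \<and> real_manin_triple (l \<inter> l') B i1 i1') \<and>
            (n \<inter> h' = {0} \<and> n' \<inter> h = {0}))) \<and>
      (\<forall>(B :: 'g \<Rightarrow> 'g \<Rightarrow> complex) i i'.
        complex_manin_form UNIV B \<and> complex_lagrangian UNIV B i \<and> complex_lagrangian UNIV B i' \<and>
        cx.under i p \<and> cx.under i' p' \<longrightarrow>
        (let m = cx.commutator l l; m' = cx.commutator l' l';
             h = i \<inter> m; h' = i' \<inter> m'; ht = i \<inter> l; ht' = i' \<inter> l';
             i1 = cx.weight_proj j0 n' ` (ht \<inter> p');
             i1' = cx.weight_proj j0 n ` (ht' \<inter> p)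
         in complex_manin_triple UNIV B i i' \<longleftrightarrow>
            (i1 \<subseteq> l \<inter> l' \<and> i1' \<subseteq> l \<inter> l' \<and> complex_manin_triple (l \<inter> l') B i1 i1') \<and>
            (n \<inter> h' = {0} \<and> n' \<inter> h = {0})))"
proof -
  obtain Basis :: "'g set" where fd: "finite_dimensional_vector_space (scaleC :: complex \<Rightarrow> 'g \<Rightarrow> 'g) Basis"
    using cx_basis_exists[OF assms(1)] by blast
  interpret fd: finite_dimensional_vector_space "scaleC :: complex \<Rightarrow> 'g \<Rightarrow> 'g" Basis by (rule fd)
  have borel': "cx.borel_subalgebra b0'" "b0 \<inter> b0' = j0"
    using assms(6) unfolding cx.opposite_borel_def by auto
  interpret opposite_parabolics scaleC Basis lie_bracket j0 b0 p l n b0' p' l' n'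
    by unfold_locales (use assms borel' in auto)
  have setting: "manin_setting Basis j0 b0 p l n b0' p' l' n' R"
    if "re.symmetric_invariant_form_on UNIV R" "re.nondegenerate_on UNIV R" for R
    by unfold_locales (use that in auto)
  note opp = opposite
  let ?i1 = "\<lambda>i. levi_projection l l' n' i" and ?i1' = "\<lambda>i'. levi_projection l' l n i'"
  have image: "cx.weight_proj j0 n' ` (i \<inter> l \<inter> p') = ?i1 i" for i by (rule weight_proj_image)
  have image': "cx.weight_proj j0 n ` (i' \<inter> l' \<inter> p) = ?i1' i'" for i'
    by (rule opposite_parabolics.weight_proj_image[OF opp])
  have sub: "?i1 i \<subseteq> l \<inter> l'" "?i1' i' \<subseteq> l \<inter> l'" for i i' unfolding levi_projection_def by auto
  have real: "real_manin_triple UNIV B i i' \<longleftrightarrow> real_manin_triple (l \<inter> l') B (?i1 i) (?i1' i') \<and>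
      n \<inter> (i' \<inter> cx.commutator l' l') = {0} \<and> n' \<inter> (i \<inter> cx.commutator l l) = {0}"
    if B: "real_manin_form UNIV B" and i: "real_lagrangian UNIV B i" "re.under i p"
      and i': "real_lagrangian UNIV B i'" "re.under i' p'" for B i i'
  proof -
    have form: "re.symmetric_invariant_form_on UNIV B" using B unfolding real_manin_form_def by blast
    interpret M: manin_setting Basis j0 b0 p l n b0' p' l' n' B
      by (rule setting[OF form nondegenerate_of_signature[OF fd B]])
    interpret M': manin_setting Basis j0 b0' p' l' n' b0 p l n B by (rule M.swap)
    have I: "re.lie_subalgebra i" "real_vector.subspace i" "re.isotropic B i"
      "real_vector.dim i = cx.dim (UNIV :: 'g set)" "i \<subseteq> p"
      using i re.under_subset unfolding real_lagrangian_def re_lie_subalgebra_iff by auto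
    have I': "re.lie_subalgebra i'" "real_vector.subspace i'" "re.isotropic B i'"
      "real_vector.dim i' = cx.dim (UNIV :: 'g set)" "i' \<subseteq> p'"
      using i' re.under_subset unfolding real_lagrangian_def re_lie_subalgebra_iff by auto
    have alg: "re.lie_subalgebra (?i1 i)"
      using I(1) M.levi_projection_real_subspace[of i] levi_projection_bracket[of i]
      unfolding re_lie_subalgebra_iff by blast
    have alg': "re.lie_subalgebra (?i1' i')"
      using I'(1) M'.levi_projection_real_subspace[of i']
        opposite_parabolics.levi_projection_bracket[OF opp, of i']
      unfolding re_lie_subalgebra_iff by blast
    note iso = M.levi_projection_isotropic[OF I(3)] M'.levi_projection_isotropic[OF I'(3)]
    have "real_manin_form (l \<inter> l') B" if ds: "is_direct_sum (l \<inter> l') (?i1 i) (?i1' i')"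
      unfolding real_manin_form_def
    proof
      show "re.symmetric_invariant_form_on (l \<inter> l') B"
        by (rule re.symmetric_invariant_form_on_subset[OF form])
      show "has_signature (l \<inter> l') B (cx.dim (l \<inter> l')) (cx.dim (l \<inter> l'))"
        by (rule signature_of_isotropic_sum[OF fd form M.levi_intersection_subspace
              M.levi_intersection_nondegenerate _ _ iso(1) _ iso(2)])
          (use ds alg alg' in \<open>auto simp: is_direct_sum_def re_lie_subalgebra_iff\<close>)
    qed
    then have "real_manin_triple (l \<inter> l') B (?i1 i) (?i1' i') \<longleftrightarrow>
        is_direct_sum (l \<inter> l') (?i1 i) (?i1' i')"
      using alg alg' iso unfolding real_manin_triple_def by blast
    moreover have "real_manin_triple UNIV B i i' \<longleftrightarrow> is_direct_sum UNIV i i'"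
      using B I I' unfolding real_manin_triple_def by blast
    ultimately show ?thesis using M.lagrangian_direct_sum_iff[OF I(2-5) I'(2-5)] by simp
  qed
  have complex: "complex_manin_triple UNIV B i i' \<longleftrightarrow> complex_manin_triple (l \<inter> l') B (?i1 i) (?i1' i') \<and>
      n \<inter> (i' \<inter> cx.commutator l' l') = {0} \<and> n' \<inter> (i \<inter> cx.commutator l l) = {0}"
    if B: "complex_manin_form UNIV B" and i: "complex_lagrangian UNIV B i" "cx.under i p"
      and i': "complex_lagrangian UNIV B i'" "cx.under i' p'" for B i i'
  proof -
    let ?R = "\<lambda>x y. Re (B x y)"
    interpret M: manin_setting Basis j0 b0 p l n b0' p' l' n' ?R
      by (rule setting[OF Re_form[OF B]])
    interpret M': manin_setting Basis j0 b0' p' l' n' b0 p l n ?R by (rule M.swap)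
    have I: "cx.lie_subalgebra i" "cx.isotropic B i" "real_vector.dim i = cx.dim (UNIV :: 'g set)" "i \<subseteq> p"
      using i cx.under_subset unfolding complex_lagrangian_def by auto
    have I': "cx.lie_subalgebra i'" "cx.isotropic B i'" "real_vector.dim i' = cx.dim (UNIV :: 'g set)" "i' \<subseteq> p'"
      using i' cx.under_subset unfolding complex_lagrangian_def by auto
    have s: "cx.subspace i" "cx.subspace i'" using I I' unfolding cx.lie_subalgebra_def by auto
    have rs: "real_vector.subspace i" "real_vector.subspace i'" using s cx_subspace_imp_real by auto
    have riso: "re.isotropic ?R i" "re.isotropic ?R i'"
      using isotropic_Re_iff[OF s(1) B] isotropic_Re_iff[OF s(2) B] I I' by auto
    have s1: "cx.subspace (?i1 i)" "cx.subspace (?i1' i')"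
      using M.levi_projection_subspace[OF s(1)] M'.levi_projection_subspace[OF s(2)] by auto
    have alg: "cx.lie_subalgebra (?i1 i)"
      using I(1) s1(1) levi_projection_bracket[of i] unfolding cx.lie_subalgebra_def by blast
    have alg': "cx.lie_subalgebra (?i1' i')"
      using I'(1) s1(2) opposite_parabolics.levi_projection_bracket[OF opp, of i']
      unfolding cx.lie_subalgebra_def by blast
    have iso: "cx.isotropic B (?i1 i)" "cx.isotropic B (?i1' i')"
      using M.levi_projection_isotropic[OF riso(1)] M'.levi_projection_isotropic[OF riso(2)]
        isotropic_Re_iff[OF s1(1) B] isotropic_Re_iff[OF s1(2) B] by auto
    have "complex_manin_form (l \<inter> l') B"
      unfolding complex_manin_form_def
    proof
      show "cx.symmetric_invariant_form_on (l \<inter> l') B"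
        by (rule cx.symmetric_invariant_form_on_subset) (use B in \<open>simp add: complex_manin_form_def\<close>)
      show "cx.nondegenerate_on (l \<inter> l') B"
        unfolding cx.nondegenerate_on_def
      proof (intro ballI impI)
        fix x assume "x \<in> l \<inter> l'" "\<forall>y\<in>l \<inter> l'. B x y = 0"
        then show "x = 0" using M.levi_intersection_nondegenerate unfolding re.nondegenerate_on_def by auto
      qed
    qed
    then have "complex_manin_triple (l \<inter> l') B (?i1 i) (?i1' i') \<longleftrightarrow>
        is_direct_sum (l \<inter> l') (?i1 i) (?i1' i')"
      using alg alg' iso unfolding complex_manin_triple_def by blast
    moreover have "complex_manin_triple UNIV B i i' \<longleftrightarrow> is_direct_sum UNIV i i'"
      using B I I' unfolding complex_manin_triple_def by blast
    ultimately show ?thesis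
      using M.lagrangian_direct_sum_iff[OF rs(1) riso(1) I(3,4) rs(2) riso(2) I'(3,4)] by simp
  qed
  show ?thesis
    unfolding Let_def image image'
  proof (rule conjI; intro allI impI)
    fix B :: "'g \<Rightarrow> 'g \<Rightarrow> real" and i i'
    assume "real_manin_form UNIV B \<and> real_lagrangian UNIV B i \<and> real_lagrangian UNIV B i' \<and>
        re.under i p \<and> re.under i' p'"
    then have e: "real_manin_triple UNIV B i i' \<longleftrightarrow> real_manin_triple (l \<inter> l') B (?i1 i) (?i1' i') \<and>
        n \<inter> (i' \<inter> cx.commutator l' l') = {0} \<and> n' \<inter> (i \<inter> cx.commutator l l) = {0}"
      by (elim conjE) (rule real)
    show "real_manin_triple UNIV B i i' \<longleftrightarrow>
        (?i1 i \<subseteq> l \<inter> l' \<and> ?i1' i' \<subseteq> l \<inter> l' \<and> real_manin_triple (l \<inter> l') B (?i1 i) (?i1' i')) \<and>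
        (n \<inter> (i' \<inter> cx.commutator l' l') = {0} \<and> n' \<inter> (i \<inter> cx.commutator l l) = {0})"
      by (simp only: e sub simp_thms conj_assoc)
  next
    fix B :: "'g \<Rightarrow> 'g \<Rightarrow> complex" and i i'
    assume "complex_manin_form UNIV B \<and> complex_lagrangian UNIV B i \<and> complex_lagrangian UNIV B i' \<and>
        cx.under i p \<and> cx.under i' p'"
    then have e: "complex_manin_triple UNIV B i i' \<longleftrightarrow> complex_manin_triple (l \<inter> l') B (?i1 i) (?i1' i') \<and>
        n \<inter> (i' \<inter> cx.commutator l' l') = {0} \<and> n' \<inter> (i \<inter> cx.commutator l l) = {0}"
      by (elim conjE) (rule complex)
    show "complex_manin_triple UNIV B i i' \<longleftrightarrow>
        (?i1 i \<subseteq> l \<inter> l' \<and> ?i1' i' \<subseteq> l \<inter> l' \<and> complex_manin_triple (l \<inter> l') B (?i1 i) (?i1' i')) \<and>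
        (n \<inter> (i' \<inter> cx.commutator l' l') = {0} \<and> n' \<inter> (i \<inter> cx.commutator l l) = {0})"
      by (simp only: e sub simp_thms conj_assoc)
  qed
qed

end
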